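(* There is a randomized algorithm for $2$-Sub-Sat running in time $O^*(1.5^r)$, where $r=\dim(A)$ is the dimension of the input affine space $A$, as well as a deterministic algorithm running in time $O^*\big(\binom{n}{\le t}\big)$, where $n$ is the number of variables and $t=n-\dim(A)$ is the co-dimension of $A$. Together, these imply a randomized $O^*(1.4312^n)$ time algorithm for $2$-Sub-Sat as a function of the number $n$ of variables.
   Context: The problem $2$-Sub-Sat: the input is a pair $(\Phi,A)$, where $\Phi$ is a $2$-CNF formula (a conjunction of clauses, each a disjunction of at most $2$ literals) in Boolean variables $x_1,\dots,x_n$, and $A\subseteq\mathbb{F}_2^n$ is an affine subspace given by a system of linear equations over $\mathbb{F}_2$. The task is to determine whether $\Phi$ has a satisfying assignment lying in $A$, and to compute one if it exists. Notation: $O^*(f)$ suppresses factors polynomial in the input size. For nonnegative integers $n,t$, $\binom{n}{\le t}=\sum_{i=0}^t\binom{n}{i}$. A randomized algorithm for the problem is one that, on satisfiable instances, outputs a satisfying assignment in $A$ with probability at least a positive constant (e.g. $2/3$), and never outputs an incorrect assignment. *)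

theory Defs
  imports "HOL-Probability.Probability" "HOL-Library.Z2" "HOL-Library.Function_Algebras"
begin

section \<open>Instances of 2-Sub-Sat\<close>

text \<open>
  Variables are numbered \<open>0, \<dots>, n - 1\<close>. The literal \<open>(i, 1)\<close> is the variable \<open>i\<close>,
  the literal \<open>(i, 0)\<close> its negation. The equation \<open>(as, b)\<close> with \<open>length as = n\<close> is
  \<open>(\<Sum>i<n. as ! i * x i) = b\<close>.
\<close>

type_synonym literal = "nat \<times> bit"
type_synonym clause = "literal list"
type_synonym equation = "bit list \<times> bit"

record subsat =
  nvars :: nat
  clauses :: "clause list"
  equations :: "equation list"

definition well_formed :: "subsat \<Rightarrow> bool" where
  "well_formed I \<longleftrightarrow>
     (\<forall>C\<in>set (clauses I). length C \<le> 2 \<and> (\<forall>(i, b)\<in>set C. i < nvars I)) \<and>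
     (\<forall>(as, b)\<in>set (equations I). length as = nvars I)"

text \<open>
  \<open>\<bbbF>\<^sub>2\<^sup>n\<close> is represented by the functions \<^typ>\<open>nat \<Rightarrow> bit\<close> that vanish outside \<open>{..<n}\<close>, so that
  \<open>n\<close> may vary within a statement. Addition of functions is pointwise.
\<close>

definition F2_space :: "nat \<Rightarrow> (nat \<Rightarrow> bit) set" where
  "F2_space n = {x. \<forall>i\<ge>n. x i = 0}"

definition F2_scale :: "bit \<Rightarrow> (nat \<Rightarrow> bit) \<Rightarrow> (nat \<Rightarrow> bit)" where
  "F2_scale c x = (\<lambda>i. c * x i)"

global_interpretation F2: vector_space F2_scale
  by unfold_locales (auto simp: F2_scale_def fun_eq_iff distrib_left distrib_right mult.assoc)

definition affine_part :: "subsat \<Rightarrow> (nat \<Rightarrow> bit) set" where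
  "affine_part I =
     {x \<in> F2_space (nvars I). \<forall>(as, b)\<in>set (equations I). (\<Sum>i<nvars I. as ! i * x i) = b}"

definition satisfies :: "(nat \<Rightarrow> bit) \<Rightarrow> clause list \<Rightarrow> bool" where
  "satisfies x \<Phi> \<longleftrightarrow> (\<forall>C\<in>set \<Phi>. \<exists>(i, b)\<in>set C. x i = b)"

definition solutions :: "subsat \<Rightarrow> (nat \<Rightarrow> bit) set" where
  "solutions I = {x \<in> affine_part I. satisfies x (clauses I)}"

text \<open>
  The dimension of an affine subspace is the dimension of its direction space. For an inconsistent
  system of equations this yields \<open>dim_A I = 0\<close> and \<open>codim_A I = nvars I\<close>.
\<close>

definition dim_A :: "subsat \<Rightarrow> nat" where
  "dim_A I = F2.dim {x - y | x y. x \<in> affine_part I \<and> y \<in> affine_part I}"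

definition codim_A :: "subsat \<Rightarrow> nat" where
  "codim_A I = nvars I - dim_A I"

definition binom_le :: "nat \<Rightarrow> nat \<Rightarrow> nat" where
  "binom_le n t = (\<Sum>i\<le>t. n choose i)"


section \<open>Machine model\<close>

text \<open>
  Algorithms are programs of a first-order functional language, in A-normal form, whose data are
  binary trees, in the style of Jones' languages F and WHILE. A program is a list of bodies of
  (mutually recursive) functions; the main function is number 0 and has one argument.
  Variables are de Bruijn indices into the environment, and \<open>ECall f xs\<close> starts the body of \<open>f\<close> in
  the environment that consists of the values of the variables \<open>xs\<close>.
  The only test is whether a tree is a leaf, and trees are built by sharing, so every elementary
  step takes constant time on a pointer machine. Hence the step count is
  polynomially related to the running time of (probabilistic) Turing machines.
  \<open>ECoin\<close> is a fair coin toss and the only source of randomness.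
\<close>

datatype tree = Leaf | Node tree tree

datatype expr =
    EVar nat
  | ELeaf
  | ENode nat nat
  | ECoin
  | ECall nat "nat list"
  | ELet expr expr
  | ECase nat expr expr

type_synonym program = "expr list"

definition lookup :: "tree list \<Rightarrow> nat \<Rightarrow> tree" where
  "lookup env i = (if i < length env then env ! i else Leaf)"

text \<open>
  \<open>exec P fuel e env\<close> is the distribution of the pair (value, number of steps). The missing mass is
  the probability that the recursion depth of the evaluation exceeds \<open>fuel\<close> or that an undefined
  function is called.
\<close>

primrec exec :: "program \<Rightarrow> nat \<Rightarrow> expr \<Rightarrow> tree list \<Rightarrow> (tree \<times> nat) spmf" where
  "exec P 0 e env = return_pmf None"
| "exec P (Suc fuel) e env =
     (case e of
        EVar i \<Rightarrow> return_spmf (lookup env i, 1)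
      | ELeaf \<Rightarrow> return_spmf (Leaf, 1)
      | ENode i j \<Rightarrow> return_spmf (Node (lookup env i) (lookup env j), 1)
      | ECoin \<Rightarrow> map_spmf (\<lambda>b. (if b then Node Leaf Leaf else Leaf, 1)) coin_spmf
      | ECall f xs \<Rightarrow>
          if f < length P
          then map_spmf (\<lambda>(v, s). (v, s + length xs + 1)) (exec P fuel (P ! f) (map (lookup env) xs))
          else return_pmf None
      | ELet e1 e2 \<Rightarrow>
          bind_spmf (exec P fuel e1 env) (\<lambda>(v, s).
          map_spmf (\<lambda>(w, s'). (w, s + s' + 1)) (exec P fuel e2 (v # env)))
      | ECase i e1 e2 \<Rightarrow>
          map_spmf (\<lambda>(v, s). (v, s + 1))
            (case lookup env i of
               Leaf \<Rightarrow> exec P fuel e1 env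
             | Node l r \<Rightarrow> exec P fuel e2 (l # r # env)))"

primrec coin_free :: "expr \<Rightarrow> bool" where
  "coin_free (EVar i) = True"
| "coin_free ELeaf = True"
| "coin_free (ENode i j) = True"
| "coin_free ECoin = False"
| "coin_free (ECall f xs) = True"
| "coin_free (ELet e1 e2) = (coin_free e1 \<and> coin_free e2)"
| "coin_free (ECase i e1 e2) = (coin_free e1 \<and> coin_free e2)"

text \<open>
  The step count bounds the recursion depth, so a computation of at most \<open>T\<close> steps needs at most
  \<open>T\<close> units of fuel; \<open>halts_within\<close> is a worst-case bound over all coin tosses.
\<close>

definition run :: "program \<Rightarrow> nat \<Rightarrow> tree \<Rightarrow> (tree \<times> nat) spmf" where
  "run P T x = exec P T (ECall 0 [0]) [x]"

definition halts_within :: "program \<Rightarrow> nat \<Rightarrow> tree \<Rightarrow> bool" where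
  "halts_within P T x \<longleftrightarrow> lossless_spmf (run P T x) \<and> (\<forall>(v, s)\<in>set_spmf (run P T x). s \<le> T)"

definition output_dist :: "program \<Rightarrow> nat \<Rightarrow> tree \<Rightarrow> tree spmf" where
  "output_dist P T x = map_spmf fst (run P T x)"

text \<open>More fuel does not change the result of a computation that halts.\<close>

lemma exec_mono_Suc: "ord_spmf (=) (exec P k e env) (exec P (Suc k) e env)"
proof (induction k arbitrary: e env)
  case 0
  then show ?case by simp
next
  case (Suc k)
  have *: "ord_spmf (=) (map_spmf f (exec P k e env)) (map_spmf f (exec P (Suc k) e env))"
    for f :: "tree \<times> nat \<Rightarrow> tree \<times> nat" and e env
    unfolding ord_spmf_map_spmf12 by (rule ord_spmf_mono[OF Suc.IH]) simp
  show ?case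
    unfolding exec.simps(2)[of P k e] exec.simps(2)[of P "Suc k" e]
    by (auto simp del: exec.simps split: expr.split tree.split
        intro!: * bind_spmf_mono' Suc.IH)
qed

lemma run_mono:
  assumes "lossless_spmf (run P T x)" "T \<le> T'"
  shows "run P T' x = run P T x"
proof -
  have le: "ord_spmf (=) (run P T x) (run P T' x)"
    using assms(2)
  proof (induction rule: dec_induct)
    case base
    show ?case by (simp add: ord_spmf_reflI)
  next
    case (step k)
    then show ?case
      unfolding run_def by (blast intro: spmf.leq_trans exec_mono_Suc)
  qed
  then have "pmf (run P T' x) None = pmf (run P T x) None"
    using assms(1) ord_spmf_eqD_pmf_None[OF Complete_Partial_Order.chain_empty le] pmf_nonneg[of "run P T' x" None]
    by (simp add: lossless_iff_pmf_None)
  with le show ?thesis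
    by (metis ord_spmf_eq_pmf_None_eq[OF Complete_Partial_Order.chain_empty])
qed


section \<open>Encoding of inputs and outputs\<close>

primrec enc_list :: "tree list \<Rightarrow> tree" where
  "enc_list [] = Leaf"
| "enc_list (t # ts) = Node t (enc_list ts)"

definition enc_nat :: "nat \<Rightarrow> tree" where
  "enc_nat n = enc_list (replicate n Leaf)"

definition enc_bit :: "bit \<Rightarrow> tree" where
  "enc_bit b = (if b = 1 then Node Leaf Leaf else Leaf)"

definition enc_clause :: "clause \<Rightarrow> tree" where
  "enc_clause C = enc_list (map (\<lambda>(i, b). Node (enc_nat i) (enc_bit b)) C)"

definition enc_equation :: "equation \<Rightarrow> tree" where
  "enc_equation E = (case E of (as, b) \<Rightarrow> Node (enc_list (map enc_bit as)) (enc_bit b))"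

definition enc_input :: "subsat \<Rightarrow> tree" where
  "enc_input I =
     Node (enc_nat (nvars I))
       (Node (enc_list (map enc_clause (clauses I))) (enc_list (map enc_equation (equations I))))"

primrec tree_size :: "tree \<Rightarrow> nat" where
  "tree_size Leaf = 1"
| "tree_size (Node l r) = tree_size l + tree_size r + 1"

definition input_size :: "subsat \<Rightarrow> nat" where
  "input_size I = tree_size (enc_input I)"

definition no_solution_found :: tree where
  "no_solution_found = Leaf"

definition solution_found :: "nat \<Rightarrow> (nat \<Rightarrow> bit) \<Rightarrow> tree" where
  "solution_found n x = Node Leaf (enc_list (map (\<lambda>i. enc_bit (x i)) [0..<n]))"

definition correct_solutions :: "subsat \<Rightarrow> tree set" where
  "correct_solutions I = solution_found (nvars I) ` solutions I"


section \<open>Algorithms for 2-Sub-Sat\<close>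

definition in_O_star :: "(subsat \<Rightarrow> nat) \<Rightarrow> (subsat \<Rightarrow> real) \<Rightarrow> bool" where
  "in_O_star \<tau> f \<longleftrightarrow>
     (\<exists>(c::real) (k::nat). \<forall>I. well_formed I \<longrightarrow> real (\<tau> I) \<le> c * real (input_size I) ^ k * f I)"

definition deterministic_algorithm :: "program \<Rightarrow> (subsat \<Rightarrow> nat) \<Rightarrow> bool" where
  "deterministic_algorithm P \<tau> \<longleftrightarrow> list_all coin_free P \<and>
     (\<forall>I. well_formed I \<longrightarrow>
        halts_within P (\<tau> I) (enc_input I) \<and>
        set_spmf (output_dist P (\<tau> I) (enc_input I)) \<subseteq>
          (if solutions I = {} then {no_solution_found} else correct_solutions I))"

definition randomized_algorithm :: "program \<Rightarrow> (subsat \<Rightarrow> nat) \<Rightarrow> bool" where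
  "randomized_algorithm P \<tau> \<longleftrightarrow>
     (\<forall>I. well_formed I \<longrightarrow>
        halts_within P (\<tau> I) (enc_input I) \<and>
        set_spmf (output_dist P (\<tau> I) (enc_input I)) \<subseteq> {no_solution_found} \<union> correct_solutions I \<and>
        (solutions I \<noteq> {} \<longrightarrow>
           measure (measure_spmf (output_dist P (\<tau> I) (enc_input I))) (correct_solutions I) \<ge> 2 / 3))"

end

theory Submission
  imports Defs
begin

text \<open>
  Randomized algorithm. Maintain the affine space as an offset and a basis. A clause \<open>l \<or> l'\<close> is implied
  by each of the linear equations \<open>l = 1\<close>, \<open>l' = 1\<close> and \<open>l + l' = 1\<close>, and an assignment that satisfies the
  clause satisfies exactly two of them. So if none of the equations holds on the whole space, adding a
  random one keeps a given solution with probability \<open>2/3\<close> and lowers the dimension by one; a trial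
  succeeds with probability about \<open>(2/3)\<^sup>r\<close>.

  Deterministic algorithm. Let \<open>y\<close> be any solution of the 2-CNF formula, and describe the other
  solutions by the set of variables on which they differ from \<open>y\<close>. The solutions below a solution \<open>X\<close>
  form a lattice of sets. If \<open>X\<close> is a minimal solution in the affine space, then it is generated by at
  most \<open>t\<close> variables, because removing the parts of \<open>X\<close> that belong to single generators is a linear
  operation, and more than \<open>t\<close> of them would be linearly dependent modulo the space. So it suffices to
  flip at most \<open>t\<close> variables of \<open>y\<close> and to propagate.

  The third bound results from choosing the deterministic algorithm if \<open>449 t \<le> 52 n\<close>. The fraction
  \<open>52/449\<close> is slightly smaller than the \<open>\<delta>\<close> at which \<open>2 powr H(\<delta>) = 1.5 powr (1 - \<delta>)\<close>, so this
  choice does not exceed \<open>1.5\<^sup>r\<close> either and one program serves for both randomized bounds.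
\<close>

section \<open>A program logic for the machine model\<close>

text \<open>A trial visits every clause once. After its step the clause holds on the whole current
  space, and it stays true because the space only shrinks; so every point of a nonempty final space
  is a solution, and no solution has to be known. A step costs probability only if it changes the
  space, and a change that keeps the solution lowers the rank; hence the exponent is the rank and
  not the number of clauses. The propagation of the deterministic algorithm is forced: relative to
  the solution \<open>y\<close>, a violated clause contains a variable that is already flipped,
  which leaves at most one literal to change. So the target \<open>x\<close> occurs only in the
  proofs. The same propagation yields \<open>y\<close> itself: clauses are added one at a time, and
  a violated new clause is repaired by flipping one of its literals. At codimension 52 n / 449 the
  rank is 397 n / 449, and 1.5 ^ (397/449) lies just below 1.4312. The machine has no numbers:
  counters, the comparison and the number of trials are unary lists, and computing them must respect
  the claimed bounds as well.\<close>

inductive ev :: "program \<Rightarrow> expr \<Rightarrow> tree list \<Rightarrow> tree \<Rightarrow> nat \<Rightarrow> bool" for P where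
  ev_EVar: "ev P (EVar i) env (lookup env i) 1"
| ev_ELeaf: "ev P ELeaf env Leaf 1"
| ev_ENode: "ev P (ENode i j) env (Node (lookup env i) (lookup env j)) 1"
| ev_ECall: "f < length P \<Longrightarrow> ev P (P ! f) (map (lookup env) xs) v s \<Longrightarrow> ev P (ECall f xs) env v (s + length xs + 1)"
| ev_ELet: "ev P e1 env v s \<Longrightarrow> ev P e2 (v # env) w s' \<Longrightarrow> ev P (ELet e1 e2) env w (s + s' + 1)"
| ev_ECase_Leaf: "lookup env i = Leaf \<Longrightarrow> ev P e1 env v s \<Longrightarrow> ev P (ECase i e1 e2) env v (s + 1)"
| ev_ECase_Node: "lookup env i = Node l r \<Longrightarrow> ev P e2 (l # r # env) v s \<Longrightarrow> ev P (ECase i e1 e2) env v (s + 1)"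

text \<open>\<open>ev\<close> has no rule for \<open>ECoin\<close>, so a derivation describes a
  single deterministic outcome. Every level of recursion adds at least one step, hence the step
  count is enough fuel.\<close>

lemma exec_ev:
  assumes "ev P e env v s" "s \<le> fuel"
  shows "exec P fuel e env = return_spmf (v, s)"
  using assms
proof (induction arbitrary: fuel rule: ev.induct)
  case (ev_ECall f env xs v s)
  then show ?case by (cases fuel) auto
next
  case (ev_ELet e1 env v s e2 w s')
  then show ?case by (cases fuel) auto
next
  case (ev_ECase_Leaf env i e1 v s e2)
  then show ?case by (cases fuel) auto
next
  case (ev_ECase_Node env i l r e2 v s e1)
  then show ?case by (cases fuel) auto
qed (case_tac fuel; simp)+

inductive_cases ev_elims:
  "ev P (EVar i) env v s" "ev P ELeaf env v s" "ev P (ENode i j) env v s"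
  "ev P (ECall f xs) env v s" "ev P (ELet e1 e2) env v s" "ev P (ECase i e1 e2) env v s"

definition wp :: "program \<Rightarrow> expr \<Rightarrow> tree list \<Rightarrow> (tree \<Rightarrow> nat \<Rightarrow> bool) \<Rightarrow> bool" where
  "wp P e env Q \<longleftrightarrow> (\<exists>v s. ev P e env v s \<and> Q v s)"

definition wpf :: "program \<Rightarrow> nat \<Rightarrow> tree list \<Rightarrow> (tree \<Rightarrow> nat \<Rightarrow> bool) \<Rightarrow> bool" where
  "wpf P f args Q \<longleftrightarrow> f < length P \<and> wp P (P ! f) args Q"

text \<open>As rewrite rules these execute code symbolically; only calls survive, as
  \<open>wpf\<close> goals that the specification of the callee discharges.\<close>

lemma wp_simps [simp]:
  "wp P (EVar i) env Q \<longleftrightarrow> Q (lookup env i) 1"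
  "wp P ELeaf env Q \<longleftrightarrow> Q Leaf 1"
  "wp P (ENode i j) env Q \<longleftrightarrow> Q (Node (lookup env i) (lookup env j)) 1"
  "wp P (ECall f xs) env Q \<longleftrightarrow> wpf P f (map (lookup env) xs) (\<lambda>v s. Q v (s + length xs + 1))"
  "wp P (ELet e1 e2) env Q \<longleftrightarrow> wp P e1 env (\<lambda>v s. wp P e2 (v # env) (\<lambda>w s'. Q w (s + s' + 1)))"
  "wp P (ECase i e1 e2) env Q \<longleftrightarrow>
     (case lookup env i of
        Leaf \<Rightarrow> wp P e1 env (\<lambda>v s. Q v (s + 1))
      | Node l r \<Rightarrow> wp P e2 (l # r # env) (\<lambda>v s. Q v (s + 1)))"
  unfolding wp_def wpf_def
  by (fastforce split: tree.splits intro: ev.intros elim: ev_elims)+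

text \<open>Without these congruence rules the simplifier would execute continuations symbolically before the
  values they depend on are known.\<close>

lemma wp_weak_cong [cong]:
  "e = e' \<Longrightarrow> env = env' \<Longrightarrow> wp P e env Q = wp P e' env' Q"
  "args = args' \<Longrightarrow> wpf P f args Q = wpf P f args' Q"
  by simp_all

lemma wpf_mono: "wpf P f args Q \<Longrightarrow> (\<And>v s. Q v s \<Longrightarrow> Q' v s) \<Longrightarrow> wpf P f args Q'"
  unfolding wpf_def wp_def by blast

text \<open>A copy of \<open>\<le>\<close> that the simplifier does not see through: it keeps arithmetic on step counts out of
  the symbolic execution.\<close>

definition cost_le :: "nat \<Rightarrow> nat \<Rightarrow> bool" where
  "cost_le s T \<longleftrightarrow> s \<le> T"

lemma cost_le_weak_cong [cong]: "cost_le s T = cost_le s T"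
  by simp

definition runs :: "program \<Rightarrow> nat \<Rightarrow> tree list \<Rightarrow> tree \<Rightarrow> nat \<Rightarrow> bool" where
  "runs P f args v T \<longleftrightarrow> wpf P f args (\<lambda>v' s. v' = v \<and> s \<le> T)"

lemma runs_wpf: "runs P f args v T \<Longrightarrow> (\<And>s. cost_le s T \<Longrightarrow> Q v s) \<Longrightarrow> wpf P f args Q"
  unfolding runs_def cost_le_def by (erule wpf_mono) blast

text \<open>Replacing the bound \<open>T\<close> by an arbitrary \<open>X\<close> above it keeps a
  large polynomial out of the goal during symbolic execution. It comes back as an assumption when
  \<open>cost_le\<close> is unfolded at the end.\<close>

lemma runsI:
  assumes "f < length P" "\<And>X. cost_le T X \<Longrightarrow> wp P (P ! f) args (\<lambda>v' s. v' = v \<and> cost_le s X)"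
  shows "runs P f args v T"
  using assms unfolding runs_def wpf_def cost_le_def by blast

lemma runs_mono: "runs P f args v T \<Longrightarrow> T \<le> T' \<Longrightarrow> runs P f args v T'"
  unfolding runs_def by (erule wpf_mono) simp

lemma lookup_simps [simp]:
  "lookup (x # env) 0 = x" "lookup (x # env) (Suc i) = lookup env i"
  "lookup (x # env) (numeral k) = lookup env (pred_numeral k)"
  by (auto simp: lookup_def numeral_eq_Suc)

text \<open>Code is parametrized by the length of the environment, and a variable is represented by the length
  of the environment at its binding. Thus bound variables of the logic can stand for program variables, and
  their de Bruijn indices are computed by the simplifier.\<close>

type_synonym code = "nat \<Rightarrow> expr"

definition VAR :: "nat \<Rightarrow> code" where "VAR x = (\<lambda>d. EVar (d - 1 - x))"
definition LEAF :: code where "LEAF = (\<lambda>d. ELeaf)"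
definition COIN :: code where "COIN = (\<lambda>d. ECoin)"
definition LET :: "code \<Rightarrow> (nat \<Rightarrow> code) \<Rightarrow> code" where "LET e f = (\<lambda>d. ELet (e d) (f d (d + 1)))"
definition NODE :: "code \<Rightarrow> code \<Rightarrow> code" where
  "NODE e1 e2 = LET e1 (\<lambda>x. LET e2 (\<lambda>y d. ENode (d - 1 - x) (d - 1 - y)))"
definition CASE :: "code \<Rightarrow> code \<Rightarrow> (nat \<Rightarrow> nat \<Rightarrow> code) \<Rightarrow> code" where
  "CASE e e1 e2 = LET e (\<lambda>x d. ECase (d - 1 - x) (e1 d) (e2 (d + 1) d (d + 2)))"
primrec CALLV :: "nat \<Rightarrow> code list \<Rightarrow> nat list \<Rightarrow> code" where
  "CALLV f [] xs = (\<lambda>d. ECall f (map (\<lambda>x. d - 1 - x) xs))"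
| "CALLV f (e # es) xs = LET e (\<lambda>x. CALLV f es (xs @ [x]))"
definition CALL :: "nat \<Rightarrow> code list \<Rightarrow> code" where "CALL f es = CALLV f es []"
definition TRUE :: code where "TRUE = NODE LEAF LEAF"
definition IF :: "code \<Rightarrow> code \<Rightarrow> code \<Rightarrow> code" where "IF e e1 e2 = CASE e e2 (\<lambda>_ _. e1)"
definition NOT :: "code \<Rightarrow> code" where "NOT e = IF e LEAF TRUE"
definition EQB :: "code \<Rightarrow> code \<Rightarrow> code" where "EQB e1 e2 = IF e1 e2 (NOT e2)"

lemmas code_defs = VAR_def LEAF_def COIN_def LET_def NODE_def CASE_def CALL_def TRUE_def IF_def NOT_def EQB_def

definition enc_vec :: "nat \<Rightarrow> (nat \<Rightarrow> bit) \<Rightarrow> tree" where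
  "enc_vec n x = enc_list (map (\<lambda>i. enc_bit (x i)) [0..<n])"

lemma enc_vec_0 [simp]: "enc_vec 0 x = Leaf" by (simp add: enc_vec_def)
lemma enc_vec_Suc [simp]: "enc_vec (Suc n) x = Node (enc_bit (x 0)) (enc_vec n (\<lambda>i. x (Suc i)))"
  unfolding enc_vec_def by (simp add: upt_conv_Cons map_Suc_upt[symmetric] comp_def del: upt_Suc map_Suc_upt)

definition dot :: "nat \<Rightarrow> (nat \<Rightarrow> bit) \<Rightarrow> (nat \<Rightarrow> bit) \<Rightarrow> bit" where
  "dot n a x = (\<Sum>i<n. a i * x i)"

lemma dot_0 [simp]: "dot 0 a x = 0" by (simp add: dot_def)
lemma dot_Suc [simp]: "dot (Suc n) a x = a 0 * x 0 + dot n (\<lambda>i. a (Suc i)) (\<lambda>i. x (Suc i))"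
  unfolding dot_def by (simp add: sum.lessThan_Suc_shift del: sum.lessThan_Suc)

lemma case_enc_bit [simp]: "(case enc_bit b of Leaf \<Rightarrow> A | Node l r \<Rightarrow> B l r) = (if b = 1 then B Leaf Leaf else A)"
  by (simp add: enc_bit_def)
lemma enc_bit_simps: "enc_bit 0 = Leaf" "enc_bit 1 = Node Leaf Leaf"
  by (simp_all add: enc_bit_def)

section \<open>The programs\<close>

text \<open>Positions of the functions in the programs below; the main function has position 0.\<close>

abbreviation (input) "f_det \<equiv> 1 :: nat"
abbreviation (input) "f_dot \<equiv> 2 :: nat"
abbreviation (input) "f_vadd \<equiv> 3 :: nat"
abbreviation (input) "f_elim \<equiv> 4 :: nat"
abbreviation (input) "f_red \<equiv> 5 :: nat"
abbreviation (input) "f_addeq \<equiv> 6 :: nat"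
abbreviation (input) "f_implied \<equiv> 7 :: nat"
abbreviation (input) "f_addeqs \<equiv> 8 :: nat"
abbreviation (input) "f_unit \<equiv> 9 :: nat"
abbreviation (input) "f_shift \<equiv> 10 :: nat"
abbreviation (input) "f_basis \<equiv> 11 :: nat"
abbreviation (input) "f_checkeqs \<equiv> 12 :: nat"
abbreviation (input) "f_satc \<equiv> 13 :: nat"
abbreviation (input) "f_satall \<equiv> 14 :: nat"
abbreviation (input) "f_fixl \<equiv> 15 :: nat"
abbreviation (input) "f_pass \<equiv> 16 :: nat"
abbreviation (input) "f_passes \<equiv> 17 :: nat"
abbreviation (input) "f_tryl \<equiv> 18 :: nat"
abbreviation (input) "f_twosat \<equiv> 19 :: nat"
abbreviation (input) "f_attempt \<equiv> 20 :: nat"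
abbreviation (input) "f_search \<equiv> 21 :: nat"
abbreviation (input) "f_revapp \<equiv> 22 :: nat"
abbreviation (input) "f_minus \<equiv> 23 :: nat"
abbreviation (input) "f_mul \<equiv> 24 :: nat"
abbreviation (input) "f_grow \<equiv> 25 :: nat"
abbreviation (input) "f_pow \<equiv> 26 :: nat"
abbreviation (input) "f_eqb \<equiv> 27 :: nat"
abbreviation (input) "f_step2 \<equiv> 28 :: nat"
abbreviation (input) "f_step \<equiv> 29 :: nat"
abbreviation (input) "f_walk \<equiv> 30 :: nat"
abbreviation (input) "f_choose \<equiv> 31 :: nat"
abbreviation (input) "f_choices \<equiv> 32 :: nat"
abbreviation (input) "f_loop \<equiv> 33 :: nat"

text \<open>The numerals after a body bind its parameters and fix the initial depth. Arguments are
  numbered down to 0 at the end of the list, because \<open>VAR x\<close> at depth \<open>d\<close>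
  is the index \<open>d - 1 - x\<close>; the last numeral is the number of arguments.\<close>

definition det_code :: expr where
  "det_code = (\<lambda>F E n B.
    CASE (CALL f_twosat [VAR F, LEAF, VAR n, VAR n]) LEAF (\<lambda>_ y.
      CALL f_search [CALL f_revapp [VAR y, LEAF], CALL f_minus [VAR n, VAR B], LEAF, VAR F, VAR E, VAR n, VAR y])) 3 2 1 0 4"

definition dot_code :: expr where
  "dot_code = (\<lambda>a x.
    CASE (VAR a) LEAF (\<lambda>p a'. CASE (VAR x) LEAF (\<lambda>q x'.
      LET (CALL f_dot [VAR a', VAR x']) (\<lambda>r. IF (VAR p) (IF (VAR q) (NOT (VAR r)) (VAR r)) (VAR r))))) 1 0 2"

definition vadd_code :: expr where
  "vadd_code = (\<lambda>a x.
    CASE (VAR a) LEAF (\<lambda>p a'. CASE (VAR x) LEAF (\<lambda>q x'.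
      NODE (IF (VAR p) (NOT (VAR q)) (VAR q)) (CALL f_vadd [VAR a', VAR x'])))) 1 0 2"

definition elim_code :: expr where
  "elim_code = (\<lambda>a v B.
    CASE (VAR B) LEAF (\<lambda>w B'.
      NODE (IF (CALL f_dot [VAR a, VAR w]) (CALL f_vadd [VAR w, VAR v]) (VAR w)) (CALL f_elim [VAR a, VAR v, VAR B']))) 2 1 0 3"

definition red_code :: expr where
  "red_code = (\<lambda>a B.
    CASE (VAR B) LEAF (\<lambda>w B'.
      IF (CALL f_dot [VAR a, VAR w])
        (NODE (VAR w) (CALL f_elim [VAR a, VAR w, VAR B']))
        (CASE (CALL f_red [VAR a, VAR B']) LEAF (\<lambda>v B''. NODE (VAR v) (NODE (VAR w) (VAR B'')))))) 1 0 2"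

definition addeq_code :: expr where
  "addeq_code = (\<lambda>a b S.
    CASE (VAR S) LEAF (\<lambda>p B.
      LET (EQB (CALL f_dot [VAR a, VAR p]) (VAR b)) (\<lambda>ok.
      CASE (CALL f_red [VAR a, VAR B])
        (IF (VAR ok) (VAR S) LEAF)
        (\<lambda>v B'. NODE (IF (VAR ok) (VAR p) (CALL f_vadd [VAR p, VAR v])) (VAR B'))))) 2 1 0 3"

definition implied_code :: expr where
  "implied_code = (\<lambda>a b S.
    CASE (VAR S) LEAF (\<lambda>p B.
      CASE (CALL f_red [VAR a, VAR B]) (EQB (CALL f_dot [VAR a, VAR p]) (VAR b)) (\<lambda>_ _. LEAF))) 2 1 0 3"

definition addeqs_code :: expr where
  "addeqs_code = (\<lambda>E S.
    CASE (VAR E) (VAR S) (\<lambda>e E'. CASE (VAR e) LEAF (\<lambda>a b.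
      CALL f_addeqs [VAR E', CALL f_addeq [VAR a, VAR b, VAR S]]))) 1 0 2"

definition unit_code :: expr where
  "unit_code = (\<lambda>i n.
    CASE (VAR n) LEAF (\<lambda>_ n'.
      CASE (VAR i) (NODE TRUE (VAR n')) (\<lambda>_ i'. NODE LEAF (CALL f_unit [VAR i', VAR n'])))) 1 0 2"

definition shift_code :: expr where
  "shift_code = (\<lambda>B.
    CASE (VAR B) LEAF (\<lambda>v B'. NODE (NODE LEAF (VAR v)) (CALL f_shift [VAR B']))) 0 1"

definition basis_code :: expr where
  "basis_code = (\<lambda>n.
    CASE (VAR n) LEAF (\<lambda>_ n'.
      NODE (NODE TRUE (VAR n')) (CALL f_shift [CALL f_basis [VAR n']]))) 0 1"

definition checkeqs_code :: expr where
  "checkeqs_code = (\<lambda>E z.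
    CASE (VAR E) TRUE (\<lambda>e E'. CASE (VAR e) LEAF (\<lambda>a b.
      IF (EQB (CALL f_dot [VAR a, VAR z]) (VAR b)) (CALL f_checkeqs [VAR E', VAR z]) LEAF))) 1 0 2"

definition satc_code :: expr where
  "satc_code = (\<lambda>C n z.
    CASE (VAR C) LEAF (\<lambda>l C'. CASE (VAR l) LEAF (\<lambda>i b.
      IF (EQB (CALL f_dot [CALL f_unit [VAR i, VAR n], VAR z]) (VAR b)) TRUE (CALL f_satc [VAR C', VAR n, VAR z])))) 2 1 0 3"

definition satall_code :: expr where
  "satall_code = (\<lambda>F n z.
    CASE (VAR F) TRUE (\<lambda>C F'.
      IF (CALL f_satc [VAR C, VAR n, VAR z]) (CALL f_satall [VAR F', VAR n, VAR z]) LEAF)) 2 1 0 3"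

definition fixl_code :: expr where
  "fixl_code = (\<lambda>C n y z.
    CASE (VAR C) (VAR z) (\<lambda>l C'. CASE (VAR l) LEAF (\<lambda>i b.
      LET (CALL f_unit [VAR i, VAR n]) (\<lambda>u.
      IF (EQB (CALL f_dot [VAR u, VAR z]) (CALL f_dot [VAR u, VAR y]))
        (CALL f_vadd [VAR z, VAR u])
        (CALL f_fixl [VAR C', VAR n, VAR y, VAR z]))))) 3 2 1 0 4"

definition pass_code :: expr where
  "pass_code = (\<lambda>F n y z.
    CASE (VAR F) (VAR z) (\<lambda>C F'.
      CALL f_pass [VAR F', VAR n, VAR y,
        IF (CALL f_satc [VAR C, VAR n, VAR z]) (VAR z) (CALL f_fixl [VAR C, VAR n, VAR y, VAR z])])) 3 2 1 0 4"

definition passes_code :: expr where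
  "passes_code = (\<lambda>k F n y z.
    CASE (VAR k) (VAR z) (\<lambda>_ k'.
      CALL f_passes [VAR k', VAR F, VAR n, VAR y, CALL f_pass [VAR F, VAR n, VAR y, VAR z]])) 4 3 2 1 0 5"

definition tryl_code :: expr where
  "tryl_code = (\<lambda>C F D n y.
    CASE (VAR C) LEAF (\<lambda>l C'. CASE (VAR l) LEAF (\<lambda>i b.
      LET (CALL f_passes [VAR n, VAR F, VAR n, VAR y, CALL f_vadd [VAR y, CALL f_unit [VAR i, VAR n]]]) (\<lambda>z.
      IF (CALL f_satall [VAR D, VAR n, VAR z])
        (NODE LEAF (VAR z))
        (CALL f_tryl [VAR C', VAR F, VAR D, VAR n, VAR y]))))) 4 3 2 1 0 5"

definition twosat_code :: expr where
  "twosat_code = (\<lambda>R F n y.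
    CASE (VAR R) (NODE LEAF (VAR y)) (\<lambda>C R'.
      LET (NODE (VAR C) (VAR F)) (\<lambda>D.
      IF (CALL f_satc [VAR C, VAR n, VAR y])
        (CALL f_twosat [VAR R', VAR D, VAR n, VAR y])
        (CASE (CALL f_tryl [VAR C, VAR F, VAR D, VAR n, VAR y]) LEAF (\<lambda>_ z.
          CALL f_twosat [VAR R', VAR D, VAR n, VAR z]))))) 3 2 1 0 4"

definition attempt_code :: expr where
  "attempt_code = (\<lambda>F E n y z0.
    LET (CALL f_passes [VAR n, VAR F, VAR n, VAR y, VAR z0]) (\<lambda>z.
      IF (CALL f_satall [VAR F, VAR n, VAR z])
        (IF (CALL f_checkeqs [VAR E, VAR z]) (NODE LEAF (VAR z)) LEAF)
        LEAF)) 4 3 2 1 0 5"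

definition search_code :: expr where
  "search_code = (\<lambda>w t acc F E n y.
    CASE (VAR w) (CALL f_attempt [VAR F, VAR E, VAR n, VAR y, VAR acc]) (\<lambda>b w'.
      CASE (CALL f_search [VAR w', VAR t, NODE (VAR b) (VAR acc), VAR F, VAR E, VAR n, VAR y])
        (CASE (VAR t) LEAF (\<lambda>_ t'.
          CALL f_search [VAR w', VAR t', NODE (NOT (VAR b)) (VAR acc), VAR F, VAR E, VAR n, VAR y]))
        (\<lambda>x z. NODE (VAR x) (VAR z)))) 6 5 4 3 2 1 0 7"

definition revapp_code :: expr where
  "revapp_code = (\<lambda>xs acc.
    CASE (VAR xs) (VAR acc) (\<lambda>x xs'. CALL f_revapp [VAR xs', NODE (VAR x) (VAR acc)])) 1 0 2"

definition minus_code :: expr where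
  "minus_code = (\<lambda>n B.
    CASE (VAR B) (VAR n) (\<lambda>_ B'. CASE (VAR n) LEAF (\<lambda>_ n'. CALL f_minus [VAR n', VAR B']))) 1 0 2"

definition mul_code :: expr where
  "mul_code = (\<lambda>a b.
    CASE (VAR a) LEAF (\<lambda>_ a'. CALL f_revapp [VAR b, CALL f_mul [VAR a', VAR b]])) 1 0 2"

definition grow_code :: expr where
  "grow_code = (\<lambda>k.
    CASE (VAR k) LEAF (\<lambda>_ k'. CASE (VAR k')
      (NODE LEAF (NODE LEAF LEAF))
      (\<lambda>_ k''. NODE LEAF (NODE LEAF (NODE LEAF (CALL f_grow [VAR k''])))))) 0 1"

definition pow_code :: expr where
  "pow_code = (\<lambda>r.
    CASE (VAR r) (NODE LEAF (NODE LEAF (NODE LEAF LEAF))) (\<lambda>_ r'. CALL f_grow [CALL f_pow [VAR r']])) 0 1"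

definition eqb_code :: expr where
  "eqb_code = (\<lambda>a b. EQB (VAR a) (VAR b)) 1 0 2"

definition step2_code :: expr where
  "step2_code = (\<lambda>l l2 c n S.
    CASE (VAR l) LEAF (\<lambda>i b. CASE (VAR l2) LEAF (\<lambda>i2 b2.
      LET (CALL f_unit [VAR i, VAR n]) (\<lambda>u. LET (CALL f_unit [VAR i2, VAR n]) (\<lambda>u2.
      LET (CALL f_vadd [VAR u, VAR u2]) (\<lambda>u3. LET (CALL f_eqb [VAR b, VAR b2]) (\<lambda>b3.
      IF (CALL f_implied [VAR u, VAR b, VAR S]) (VAR S) (
      IF (CALL f_implied [VAR u2, VAR b2, VAR S]) (VAR S) (
      IF (CALL f_implied [VAR u3, VAR b3, VAR S]) (VAR S) (
      CASE (VAR c) LEAF (\<lambda>c1 c2.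
      IF (VAR c1) (CALL f_addeq [VAR u, VAR b, VAR S]) (
      IF (VAR c2) (CALL f_addeq [VAR u2, VAR b2, VAR S]) (
      CALL f_addeq [VAR u3, VAR b3, VAR S]))))))))))))) 4 3 2 1 0 5"

definition step_code :: expr where
  "step_code = (\<lambda>C c n S.
    CASE (VAR C) LEAF (\<lambda>l C'. CASE (VAR C')
      (CALL f_step2 [VAR l, VAR l, VAR c, VAR n, VAR S])
      (\<lambda>l2 _. CALL f_step2 [VAR l, VAR l2, VAR c, VAR n, VAR S]))) 3 2 1 0 4"

definition walk_code :: expr where
  "walk_code = (\<lambda>F cs n S.
    CASE (VAR F) (VAR S) (\<lambda>C F'. CASE (VAR cs) LEAF (\<lambda>c cs'.
      CALL f_walk [VAR F', VAR cs', VAR n, CALL f_step [VAR C, VAR c, VAR n, VAR S]]))) 3 2 1 0 4"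

definition choose_code :: expr where
  "choose_code = (\<lambda>k.
    CASE (VAR k) (NODE LEAF LEAF) (\<lambda>_ k'. LET COIN (\<lambda>a. LET COIN (\<lambda>b.
      IF (VAR a) (IF (VAR b) (CALL f_choose [VAR k']) (NODE (VAR a) (VAR b))) (NODE (VAR a) (VAR b)))))) 0 1"

definition choices_code :: expr where
  "choices_code = (\<lambda>F k.
    CASE (VAR F) LEAF (\<lambda>_ F'. NODE (CALL f_choose [VAR k]) (CALL f_choices [VAR F', VAR k]))) 1 0 2"

definition loop_code :: expr where
  "loop_code = (\<lambda>T F n S.
    CASE (VAR T) LEAF (\<lambda>_ T'.
      CASE (CALL f_walk [VAR F, CALL f_choices [VAR F, VAR n], VAR n, VAR S])
        (CALL f_loop [VAR T', VAR F, VAR n, VAR S])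
        (\<lambda>p _. NODE LEAF (VAR p)))) 3 2 1 0 4"

definition lib :: program where
  "lib = [det_code, dot_code, vadd_code, elim_code, red_code, addeq_code, implied_code, addeqs_code, unit_code, shift_code, basis_code, checkeqs_code, satc_code, satall_code, fixl_code, pass_code, passes_code, tryl_code, twosat_code, attempt_code, search_code, revapp_code, minus_code, mul_code, grow_code, pow_code, eqb_code, step2_code, step_code, walk_code]"

definition coin_lib :: program where
  "coin_lib = [choose_code, choices_code, loop_code]"

lemmas body_defs = code_defs det_code_def dot_code_def vadd_code_def elim_code_def red_code_def addeq_code_def implied_code_def addeqs_code_def unit_code_def shift_code_def basis_code_def checkeqs_code_def satc_code_def satall_code_def fixl_code_def pass_code_def passes_code_def tryl_code_def twosat_code_def attempt_code_def search_code_def revapp_code_def minus_code_def mul_code_def grow_code_def pow_code_def eqb_code_def step2_code_def step_code_def walk_code_def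

text \<open>Both programs share \<open>lib\<close> at the same positions: \<open>rest\<close> is
  empty for the deterministic one, which must be coin-free, and \<open>coin_lib\<close> for the
  randomized one.\<close>

locale prog =
  fixes P :: program and main :: expr and rest :: program
  assumes P: "P = main # lib @ rest"
begin

lemma P_nth [simp]:
  "P ! f_det = det_code"
  "P ! f_dot = dot_code"
  "P ! f_vadd = vadd_code"
  "P ! f_elim = elim_code"
  "P ! f_red = red_code"
  "P ! f_addeq = addeq_code"
  "P ! f_implied = implied_code"
  "P ! f_addeqs = addeqs_code"
  "P ! f_unit = unit_code"
  "P ! f_shift = shift_code"
  "P ! f_basis = basis_code"
  "P ! f_checkeqs = checkeqs_code"
  "P ! f_satc = satc_code"
  "P ! f_satall = satall_code"
  "P ! f_fixl = fixl_code"
  "P ! f_pass = pass_code"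
  "P ! f_passes = passes_code"
  "P ! f_tryl = tryl_code"
  "P ! f_twosat = twosat_code"
  "P ! f_attempt = attempt_code"
  "P ! f_search = search_code"
  "P ! f_revapp = revapp_code"
  "P ! f_minus = minus_code"
  "P ! f_mul = mul_code"
  "P ! f_grow = grow_code"
  "P ! f_pow = pow_code"
  "P ! f_eqb = eqb_code"
  "P ! f_step2 = step2_code"
  "P ! f_step = step_code"
  "P ! f_walk = walk_code"
  by (simp_all add: P lib_def)

lemma P_len [simp]: "length P > 30"
  unfolding P lib_def by simp

lemma P_len2 [simp]: "i \<le> 30 \<Longrightarrow> i < length P"
  using P_len by linarith

end

section \<open>The functions computed by the programs\<close>

type_synonym vec = "nat \<Rightarrow> bit"
type_synonym rep = "(vec \<times> vec list) option"

definition enc_bool :: "bool \<Rightarrow> tree" where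
  "enc_bool b = (if b then Node Leaf Leaf else Leaf)"

primrec enc_vecs :: "nat \<Rightarrow> vec list \<Rightarrow> tree" where
  "enc_vecs n [] = Leaf"
| "enc_vecs n (v # B) = Node (enc_vec n v) (enc_vecs n B)"

definition enc_rep :: "nat \<Rightarrow> rep \<Rightarrow> tree" where
  "enc_rep n S = (case S of None \<Rightarrow> Leaf | Some (p, B) \<Rightarrow> Node (enc_vec n p) (enc_vecs n B))"

definition enc_res :: "nat \<Rightarrow> vec option \<Rightarrow> tree" where
  "enc_res n r = (case r of None \<Rightarrow> Leaf | Some z \<Rightarrow> Node Leaf (enc_vec n z))"

primrec enc_clause' :: "clause \<Rightarrow> tree" where
  "enc_clause' [] = Leaf"
| "enc_clause' (l # C) = Node (Node (enc_nat (fst l)) (enc_bit (snd l))) (enc_clause' C)"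

primrec enc_cnf :: "clause list \<Rightarrow> tree" where
  "enc_cnf [] = Leaf"
| "enc_cnf (C # F) = Node (enc_clause' C) (enc_cnf F)"

primrec enc_eqs :: "equation list \<Rightarrow> tree" where
  "enc_eqs [] = Leaf"
| "enc_eqs (e # E) = Node (enc_equation e) (enc_eqs E)"

definition enc_bits :: "bit list \<Rightarrow> tree" where
  "enc_bits xs = enc_list (map enc_bit xs)"

lemma enc_bits_simps [simp]:
  "enc_bits [] = Leaf" "enc_bits (b # xs) = Node (enc_bit b) (enc_bits xs)"
  by (simp_all add: enc_bits_def)

lemma enc_nat_simps [simp]:
  "enc_nat 0 = Leaf" "enc_nat (Suc n) = Node Leaf (enc_nat n)"
  by (simp_all add: enc_nat_def)

lemma case_enc_bool [simp]: "(case enc_bool b of Leaf \<Rightarrow> x | Node l r \<Rightarrow> f l r) = (if b then f Leaf Leaf else x)"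
  by (simp add: enc_bool_def)

lemma case_enc_rep [simp]: "(case enc_rep n S of Leaf \<Rightarrow> x | Node l r \<Rightarrow> f l r) =
    (case S of None \<Rightarrow> x | Some (p, B) \<Rightarrow> f (enc_vec n p) (enc_vecs n B))"
  by (simp add: enc_rep_def split: option.splits)

lemma case_enc_res [simp]: "(case enc_res n r of Leaf \<Rightarrow> x | Node l r \<Rightarrow> f l r) =
    (case r of None \<Rightarrow> x | Some z \<Rightarrow> f Leaf (enc_vec n z))"
  by (simp add: enc_res_def split: option.splits)

lemma enc_rep_simps [simp]: "enc_rep n None = Leaf" "enc_rep n (Some (p, B)) = Node (enc_vec n p) (enc_vecs n B)"
  by (simp_all add: enc_rep_def)

lemma enc_res_simps [simp]: "enc_res n None = Leaf" "enc_res n (Some z) = Node Leaf (enc_vec n z)"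
  by (simp_all add: enc_res_def)

lemma bit_cases: "(b :: bit) = 0 \<or> b = 1" by (cases b) auto

definition unit :: "nat \<Rightarrow> vec" where
  "unit i = (\<lambda>j. if j = i then 1 else 0)"

definition elim :: "nat \<Rightarrow> vec \<Rightarrow> vec \<Rightarrow> vec list \<Rightarrow> vec list" where
  "elim n a v B = map (\<lambda>w. if dot n a w = 1 then w + v else w) B"

text \<open>One step of Gaussian elimination. The functional \<open>dot n a\<close> splits the span
  of the list into its kernel and a pivot \<open>v\<close> outside; \<open>None\<close> means that
  the functional vanishes on the span, so that it is constant on every affine space with these
  directions.\<close>

primrec red :: "nat \<Rightarrow> vec \<Rightarrow> vec list \<Rightarrow> rep" where
  "red n a [] = None"
| "red n a (w # B) =
    (if dot n a w = 1 then Some (w, elim n a w B)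
     else case red n a B of None \<Rightarrow> None | Some (v, B') \<Rightarrow> Some (v, w # B'))"

definition addeq :: "nat \<Rightarrow> vec \<Rightarrow> bit \<Rightarrow> rep \<Rightarrow> rep" where
  "addeq n a b S = (case S of None \<Rightarrow> None | Some (p, B) \<Rightarrow>
     (case red n a B of
        None \<Rightarrow> if dot n a p = b then S else None
      | Some (v, B') \<Rightarrow> Some (if dot n a p = b then p else p + v, B')))"

definition implied :: "nat \<Rightarrow> vec \<Rightarrow> bit \<Rightarrow> rep \<Rightarrow> bool" where
  "implied n a b S = (case S of None \<Rightarrow> False | Some (p, B) \<Rightarrow> red n a B = None \<and> dot n a p = b)"

primrec addeqs :: "nat \<Rightarrow> equation list \<Rightarrow> rep \<Rightarrow> rep" where
  "addeqs n [] S = S"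
| "addeqs n (e # E) S = addeqs n E (addeq n (\<lambda>i. fst e ! i) (snd e) S)"

definition checkeqs :: "nat \<Rightarrow> equation list \<Rightarrow> vec \<Rightarrow> bool" where
  "checkeqs n E z \<longleftrightarrow> (\<forall>e\<in>set E. dot n (\<lambda>i. fst e ! i) z = snd e)"

definition satc :: "vec \<Rightarrow> clause \<Rightarrow> bool" where
  "satc z C \<longleftrightarrow> (\<exists>l\<in>set C. z (fst l) = snd l)"

definition satall :: "vec \<Rightarrow> clause list \<Rightarrow> bool" where
  "satall z F \<longleftrightarrow> (\<forall>C\<in>set F. satc z C)"

text \<open>A variable counts as flipped when \<open>z\<close> and \<open>y\<close> differ there.
  Only unflipped variables are changed, so flips are never undone.\<close>

primrec fixl :: "clause \<Rightarrow> vec \<Rightarrow> vec \<Rightarrow> vec" where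
  "fixl [] y z = z"
| "fixl (l # C) y z = (if z (fst l) = y (fst l) then z + unit (fst l) else fixl C y z)"

primrec pass :: "clause list \<Rightarrow> vec \<Rightarrow> vec \<Rightarrow> vec" where
  "pass [] y z = z"
| "pass (C # F) y z = pass F y (if satc z C then z else fixl C y z)"

primrec passes :: "nat \<Rightarrow> clause list \<Rightarrow> vec \<Rightarrow> vec \<Rightarrow> vec" where
  "passes 0 F y z = z"
| "passes (Suc k) F y z = passes k F y (pass F y z)"

text \<open>Propagation uses \<open>F\<close>, which \<open>y\<close> satisfies; the new clause,
  which \<open>y\<close> violates, enters only through the final check against
  \<open>D\<close>.\<close>

primrec tryl :: "nat \<Rightarrow> clause \<Rightarrow> clause list \<Rightarrow> clause list \<Rightarrow> vec \<Rightarrow> vec option" where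
  "tryl n [] F D y = None"
| "tryl n (l # C) F D y =
    (let z = passes n F y (y + unit (fst l)) in if satall z D then Some z else tryl n C F D y)"

primrec twosat :: "nat \<Rightarrow> clause list \<Rightarrow> clause list \<Rightarrow> vec \<Rightarrow> vec option" where
  "twosat n [] F y = Some y"
| "twosat n (C # R) F y =
    (if satc y C then twosat n R (C # F) y
     else case tryl n C F (C # F) y of None \<Rightarrow> None | Some z \<Rightarrow> twosat n R (C # F) z)"

definition attempt :: "nat \<Rightarrow> clause list \<Rightarrow> equation list \<Rightarrow> vec \<Rightarrow> vec \<Rightarrow> vec option" where
  "attempt n F E y z0 = (let z = passes n F y z0 in if satall z F \<and> checkeqs n E z then Some z else None)"

definition vec_of :: "bit list \<Rightarrow> vec" where
  "vec_of xs = (\<lambda>i. if i < length xs then xs ! i else 0)"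

text \<open>\<open>acc\<close> collects the chosen bits in reverse, so the search has to start from
  the reversed list of the bits of \<open>y\<close>. The budget \<open>t\<close> counts the
  complemented bits that are still allowed.\<close>

primrec search :: "nat \<Rightarrow> clause list \<Rightarrow> equation list \<Rightarrow> vec \<Rightarrow> bit list \<Rightarrow> nat \<Rightarrow> bit list \<Rightarrow> vec option" where
  "search n F E y [] t acc = attempt n F E y (vec_of acc)"
| "search n F E y (b # w) t acc =
    (case search n F E y w t (b # acc) of
       None \<Rightarrow> if t = 0 then None else search n F E y w (t - 1) ((b + 1) # acc)
     | Some z \<Rightarrow> Some z)"

text \<open>This is 3k/2 rounded up, in a form that works on unary numbers: two units become
  three.\<close>

fun grow :: "nat \<Rightarrow> nat" where
  "grow 0 = 0"
| "grow (Suc 0) = 2"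
| "grow (Suc (Suc k)) = 3 + grow k"

primrec trials :: "nat \<Rightarrow> nat" where
  "trials 0 = 3"
| "trials (Suc r) = grow (trials r)"

text \<open>The choices (1,0), (0,1) and (0,0) select the first, second and third equation. A
  literal (i,b) has the truth value x i + b + 1, so two truth values add up to 1 iff the two
  variables add up to \<open>b''\<close>.\<close>

definition step2 :: "nat \<Rightarrow> nat \<times> bit \<Rightarrow> nat \<times> bit \<Rightarrow> bit \<times> bit \<Rightarrow> rep \<Rightarrow> rep" where
  "step2 n l l' c S =
    (let u = unit (fst l); u' = unit (fst l'); b'' = (if snd l = snd l' then 1 else 0)
     in if implied n u (snd l) S \<or> implied n u' (snd l') S \<or> implied n (u + u') b'' S then S
        else if fst c = 1 then addeq n u (snd l) S
        else if snd c = 1 then addeq n u' (snd l') S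
        else addeq n (u + u') b'' S)"

text \<open>A clause with one literal is treated as the disjunction of that literal with itself. The
  third equation then reads 0 = 1 and loses every solution, which is again one bad choice out of
  three.\<close>

definition step :: "nat \<Rightarrow> clause \<Rightarrow> bit \<times> bit \<Rightarrow> rep \<Rightarrow> rep" where
  "step n C c S = (case C of [] \<Rightarrow> None | l # C' \<Rightarrow> step2 n l (case C' of [] \<Rightarrow> l | l' # _ \<Rightarrow> l') c S)"

fun walk :: "nat \<Rightarrow> clause list \<Rightarrow> (bit \<times> bit) list \<Rightarrow> rep \<Rightarrow> rep" where
  "walk n [] cs S = S"
| "walk n (C # F) [] S = None"
| "walk n (C # F) (c # cs) S = walk n F cs (step n C c S)"

primrec enc_choices :: "(bit \<times> bit) list \<Rightarrow> tree" where
  "enc_choices [] = Leaf"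
| "enc_choices (c # cs) = Node (Node (enc_bit (fst c)) (enc_bit (snd c))) (enc_choices cs)"

text \<open>Bounds the cost of an elimination by a polynomial in \<open>n\<close>; adding equations
  never lengthens the basis.\<close>

definition rank_le :: "nat \<Rightarrow> rep \<Rightarrow> bool" where
  "rank_le n S \<longleftrightarrow> (case S of None \<Rightarrow> True | Some (p, B) \<Rightarrow> length B \<le> n)"

lemma length_elim [simp]: "length (elim n a v B) = length B"
  by (simp add: elim_def)

lemma length_red: "red n a B = Some (v, B') \<Longrightarrow> length B = Suc (length B')"
  by (induction B arbitrary: v B') (auto split: if_splits option.splits)

lemma rank_le_addeq [simp]: "rank_le n S \<Longrightarrow> rank_le n (addeq n a b S)"
  using length_red by (force simp: rank_le_def addeq_def split: option.splits)

lemma rank_le_step [simp]: "rank_le n S \<Longrightarrow> rank_le n (step n C c S)"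
  by (cases C) (auto simp: step_def step2_def Let_def, auto simp: rank_le_def)

definition wf_clause :: "nat \<Rightarrow> clause \<Rightarrow> bool" where
  "wf_clause n C \<longleftrightarrow> length C \<le> 2 \<and> (\<forall>l\<in>set C. fst l < n)"

lemma elim_simps [simp]:
  "elim n a v [] = []"
  "elim n a v (w # B) = (if dot n a w = 1 then w + v else w) # elim n a v B"
  by (simp_all add: elim_def)

lemma checkeqs_simps [simp]:
  "checkeqs n [] z"
  "checkeqs n (e # E) z \<longleftrightarrow> dot n (\<lambda>i. fst e ! i) z = snd e \<and> checkeqs n E z"
  by (auto simp: checkeqs_def)

lemma satc_simps [simp]:
  "\<not> satc z []"
  "satc z (l # C) \<longleftrightarrow> z (fst l) = snd l \<or> satc z C"
  by (auto simp: satc_def)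

lemma satall_simps [simp]:
  "satall z []"
  "satall z (C # F) \<longleftrightarrow> satc z C \<and> satall z F"
  by (auto simp: satall_def)

text \<open>Lists offer no random access, so the programs read the variable \<open>i\<close> as a
  product with a unit vector.\<close>

lemma dot_unit [simp]: "i < n \<Longrightarrow> dot n (unit i) z = z i"
proof -
  assume "i < n"
  have "dot n (unit i) z = (\<Sum>j<n. if j = i then z j else 0)"
    unfolding dot_def by (rule sum.cong) (auto simp: unit_def)
  also have "\<dots> = z i"
    using \<open>i < n\<close> by (subst sum.delta) auto
  finally show ?thesis .
qed

lemma unit_Suc: "(\<lambda>j. unit (Suc i) (Suc j)) = unit i" "unit i 0 = (if i = 0 then 1 else 0)"
  by (auto simp: unit_def)

text \<open>The unary number \<open>n\<close> doubles as the zero vector: the main programs use it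
  as the initial offset, and \<open>det_code\<close> as the start of the 2-SAT computation.\<close>

lemma enc_nat_vec: "enc_nat n = enc_vec n (\<lambda>_. 0)"
  by (induction n) (simp_all add: enc_bit_def)

lemma enc_vec_unit_0: "enc_vec n (\<lambda>j. unit 0 (Suc j)) = enc_nat n"
  by (simp add: enc_nat_vec unit_def)

lemma enc_equation_vec: "length as = n \<Longrightarrow> enc_equation (as, b) = Node (enc_vec n (\<lambda>i. as ! i)) (enc_bit b)"
  by (simp add: enc_equation_def enc_vec_def, subst (1) map_nth[symmetric]) (simp add: comp_def del: map_nth)

section \<open>Running times of the deterministic parts\<close>

context prog
begin

text \<open>The bounds in this section are generous. The proofs execute the bodies symbolically,
  with the specifications of callees as introduction rules, and end with a comparison of
  polynomials.\<close>

lemma dot_runs: "runs P f_dot [enc_vec n a, enc_vec n x] (enc_bit (dot n a x)) (40 * (n + 1))"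
proof (induction n arbitrary: a x)
  case 0
  show ?case by (rule runsI) (auto simp: body_defs enc_bit_simps, simp_all add: cost_le_def algebra_simps)
next
  case (Suc n)
  note [intro!] = runs_wpf[OF Suc.IH]
  show ?case by (rule runsI) (auto simp: body_defs enc_bit_def, simp_all add: cost_le_def algebra_simps)
qed

lemmas dot_wpf [intro!] = runs_wpf[OF dot_runs]

lemma vadd_runs: "runs P f_vadd [enc_vec n a, enc_vec n x] (enc_vec n (a + x)) (40 * (n + 1))"
proof (induction n arbitrary: a x)
  case 0
  show ?case by (rule runsI) (auto simp: body_defs, simp_all add: cost_le_def algebra_simps)
next
  case (Suc n)
  note [intro!] = runs_wpf[OF Suc.IH]
  show ?case by (rule runsI) (auto simp: body_defs enc_bit_def plus_fun_def, simp_all add: cost_le_def algebra_simps)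
qed

lemmas vadd_wpf [intro!] = runs_wpf[OF vadd_runs]

lemma elim_runs:
  "runs P f_elim [enc_vec n a, enc_vec n v, enc_vecs n B] (enc_vecs n (elim n a v B))
     (200 * (n + 1) * (length B + 1))"
proof (induction B)
  case Nil
  show ?case by (rule runsI) (auto simp: body_defs, simp_all add: cost_le_def algebra_simps)
next
  case (Cons w B)
  note [intro!] = runs_wpf[OF Cons.IH]
  show ?case by (rule runsI) (auto simp: body_defs, simp_all add: cost_le_def algebra_simps)
qed

lemmas elim_wpf [intro!] = runs_wpf[OF elim_runs]

lemma red_runs:
  "runs P f_red [enc_vec n a, enc_vecs n B] (enc_rep n (red n a B)) (400 * (n + 1) * (length B + 1))"
proof (induction B)
  case Nil
  show ?case by (rule runsI) (auto simp: body_defs, simp_all add: cost_le_def algebra_simps)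
next
  case (Cons w B)
  note [intro!] = runs_wpf[OF Cons.IH]
  show ?case by (rule runsI) (auto simp: body_defs split: option.split, simp_all add: cost_le_def algebra_simps)
qed

lemma red_wpf [intro!]:
  assumes "length B \<le> n" "\<And>s. cost_le s (400 * (n + 1) * (n + 1)) \<Longrightarrow> Q (enc_rep n (red n a B)) s"
  shows "wpf P f_red [enc_vec n a, enc_vecs n B] Q"
proof (rule runs_wpf[OF red_runs])
  fix s assume "cost_le s (400 * (n + 1) * (length B + 1))"
  then have "s \<le> 400 * (n + 1) * (length B + 1)" by (simp add: cost_le_def)
  also have "\<dots> \<le> 400 * (n + 1) * (n + 1)" using assms(1) by (intro mult_le_mono2) simp
  finally show "Q (enc_rep n (red n a B)) s" by (intro assms(2)) (simp add: cost_le_def)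
qed

lemma addeq_runs:
  "rank_le n S \<Longrightarrow> runs P f_addeq [enc_vec n a, enc_bit b, enc_rep n S] (enc_rep n (addeq n a b S)) (600 * (n + 1) * (n + 1))"
  by (rule runsI)
    (auto simp: body_defs addeq_def rank_le_def enc_bit_def split: option.split, simp_all add: cost_le_def algebra_simps)

lemmas addeq_wpf [intro!] = runs_wpf[OF addeq_runs]

lemma implied_runs:
  "rank_le n S \<Longrightarrow> runs P f_implied [enc_vec n a, enc_bit b, enc_rep n S] (enc_bool (implied n a b S)) (600 * (n + 1) * (n + 1))"
  by (rule runsI)
    (auto simp: body_defs implied_def rank_le_def enc_bit_def enc_bool_def split: option.split, simp_all add: cost_le_def algebra_simps)

lemmas implied_wpf [intro!] = runs_wpf[OF implied_runs]

lemma addeqs_runs: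
  "rank_le n S \<Longrightarrow> \<forall>e\<in>set E. length (fst e) = n \<Longrightarrow>
     runs P f_addeqs [enc_eqs E, enc_rep n S] (enc_rep n (addeqs n E S)) (700 * (n + 1) * (n + 1) * (length E + 1))"
proof (induction E arbitrary: S)
  case Nil
  show ?case by (rule runsI) (auto simp: body_defs, simp_all add: cost_le_def algebra_simps)
next
  case (Cons e E)
  obtain a b where e: "e = (a, b)" by (cases e)
  with Cons.prems have [simp]: "length a = n" "rank_le n S" by auto
  have [simp]: "\<And>a b. (a, b) \<in> set E \<Longrightarrow> length a = n" using Cons.prems by auto
  note [intro!] = runs_wpf[OF Cons.IH]
  show ?case unfolding e
    by (rule runsI) (auto simp: body_defs enc_equation_vec[of _ n], simp_all add: cost_le_def algebra_simps)
qed

lemmas addeqs_wpf [intro!] = runs_wpf[OF addeqs_runs]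

lemma unit_runs: "runs P f_unit [enc_nat i, enc_nat n] (enc_vec n (unit i)) (40 * (n + 1))"
proof (induction n arbitrary: i)
  case 0
  show ?case by (rule runsI) (auto simp: body_defs, simp_all add: cost_le_def algebra_simps)
next
  case (Suc n)
  note [intro!] = runs_wpf[OF Suc.IH]
  show ?case by (cases i; intro runsI)
    (auto simp: body_defs unit_Suc enc_bit_simps enc_vec_unit_0, simp_all add: cost_le_def algebra_simps)
qed

lemmas unit_wpf [intro!] = runs_wpf[OF unit_runs]

lemma shift_runs: "runs P f_shift [enc_list ts] (enc_list (map (Node Leaf) ts)) (40 * (length ts + 1))"
proof (induction ts)
  case Nil
  show ?case by (rule runsI) (auto simp: body_defs, simp_all add: cost_le_def algebra_simps)
next
  case (Cons w B)
  note [intro!] = runs_wpf[OF Cons.IH]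
  show ?case by (rule runsI) (auto simp: body_defs, simp_all add: cost_le_def algebra_simps)
qed

lemmas shift_wpf [intro!] = runs_wpf[OF shift_runs]

lemma basis_runs: "runs P f_basis [enc_nat n] (enc_list (map (\<lambda>i. enc_vec n (unit i)) [0..<n])) (60 * (n + 1) * (n + 1))"
proof (induction n)
  case 0
  show ?case by (rule runsI) (auto simp: body_defs, simp_all add: cost_le_def algebra_simps)
next
  case (Suc n)
  have eq: "map f [0..<Suc n] = f 0 # map (\<lambda>i. f (Suc i)) [0..<n]" for f :: "nat \<Rightarrow> tree"
    by (simp add: upt_conv_Cons map_Suc_upt[symmetric] comp_def del: upt_Suc map_Suc_upt)
  note [intro!] = runs_wpf[OF Suc.IH]
  show ?case unfolding eq by (rule runsI)
    (auto simp: body_defs unit_Suc enc_bit_simps enc_vec_unit_0 comp_def, simp_all add: cost_le_def algebra_simps)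
qed

lemmas basis_wpf [intro!] = runs_wpf[OF basis_runs]

lemma checkeqs_runs: "\<forall>e\<in>set E. length (fst e) = n \<Longrightarrow>
  runs P f_checkeqs [enc_eqs E, enc_vec n z] (enc_bool (checkeqs n E z)) (80 * (n + 1) * (length E + 1))"
proof (induction E)
  case Nil
  show ?case by (rule runsI) (auto simp: body_defs enc_bool_def, simp_all add: cost_le_def algebra_simps)
next
  case (Cons e E)
  obtain a b where e: "e = (a, b)" by (cases e)
  with Cons.prems have [simp]: "length a = n" by auto
  have [simp]: "\<And>a b. (a, b) \<in> set E \<Longrightarrow> length a = n" using Cons.prems by auto
  note [intro!] = runs_wpf[OF Cons.IH]
  show ?case unfolding e
    by (rule runsI) (auto simp: body_defs enc_equation_vec[of _ n], auto simp: enc_bool_def, simp_all add: cost_le_def algebra_simps)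
qed

lemmas checkeqs_wpf [intro!] = runs_wpf[OF checkeqs_runs]

lemma satc_runs: "\<forall>l\<in>set C. fst l < n \<Longrightarrow>
  runs P f_satc [enc_clause' C, enc_nat n, enc_vec n z] (enc_bool (satc z C)) (140 * (n + 1) * (length C + 1))"
proof (induction C)
  case Nil
  show ?case by (rule runsI) (auto simp: body_defs enc_bool_def, simp_all add: cost_le_def algebra_simps)
next
  case (Cons l C)
  note [intro!] = runs_wpf[OF Cons.IH]
  show ?case using Cons.prems
    by (intro runsI) (auto simp: body_defs, auto simp: enc_bool_def, simp_all add: cost_le_def algebra_simps)
qed

lemma satc_wpf [intro!]:
  assumes "wf_clause n C" "\<And>s. cost_le s (420 * (n + 1)) \<Longrightarrow> Q (enc_bool (satc z C)) s"
  shows "wpf P f_satc [enc_clause' C, enc_nat n, enc_vec n z] Q"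
proof (rule runs_wpf[OF satc_runs])
  show "\<forall>l\<in>set C. fst l < n" using assms by (simp add: wf_clause_def)
  fix s assume "cost_le s (140 * (n + 1) * (length C + 1))"
  then have "s \<le> 140 * (n + 1) * (length C + 1)" by (simp add: cost_le_def)
  also have "\<dots> \<le> 140 * (n + 1) * 3" using assms(1) by (intro mult_le_mono2) (simp add: wf_clause_def)
  finally show "Q (enc_bool (satc z C)) s" by (intro assms(2)) (simp add: cost_le_def)
qed

lemma satall_runs: "\<forall>C\<in>set F. wf_clause n C \<Longrightarrow>
  runs P f_satall [enc_cnf F, enc_nat n, enc_vec n z] (enc_bool (satall z F)) (500 * (n + 1) * (length F + 1))"
proof (induction F)
  case Nil
  show ?case by (rule runsI) (auto simp: body_defs enc_bool_def, simp_all add: cost_le_def algebra_simps)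
next
  case (Cons C F)
  note [intro!] = runs_wpf[OF Cons.IH]
  show ?case using Cons.prems
    by (intro runsI) (auto simp: body_defs, auto simp: enc_bool_def, simp_all add: cost_le_def algebra_simps)
qed

lemmas satall_wpf [intro!] = runs_wpf[OF satall_runs]

lemma fixl_runs: "\<forall>l\<in>set C. fst l < n \<Longrightarrow>
  runs P f_fixl [enc_clause' C, enc_nat n, enc_vec n y, enc_vec n z] (enc_vec n (fixl C y z)) (250 * (n + 1) * (length C + 1))"
proof (induction C)
  case Nil
  show ?case by (rule runsI) (auto simp: body_defs, simp_all add: cost_le_def algebra_simps)
next
  case (Cons l C)
  note [intro!] = runs_wpf[OF Cons.IH]
  show ?case using Cons.prems
    by (intro runsI) (auto simp: body_defs, simp_all add: cost_le_def algebra_simps)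
qed

lemma fixl_wpf [intro!]:
  assumes "wf_clause n C" "\<And>s. cost_le s (750 * (n + 1)) \<Longrightarrow> Q (enc_vec n (fixl C y z)) s"
  shows "wpf P f_fixl [enc_clause' C, enc_nat n, enc_vec n y, enc_vec n z] Q"
proof (rule runs_wpf[OF fixl_runs])
  show "\<forall>l\<in>set C. fst l < n" using assms by (simp add: wf_clause_def)
  fix s assume "cost_le s (250 * (n + 1) * (length C + 1))"
  then have "s \<le> 250 * (n + 1) * (length C + 1)" by (simp add: cost_le_def)
  also have "\<dots> \<le> 250 * (n + 1) * 3" using assms(1) by (intro mult_le_mono2) (simp add: wf_clause_def)
  finally show "Q (enc_vec n (fixl C y z)) s" by (intro assms(2)) (simp add: cost_le_def)
qed

lemma pass_runs: "\<forall>C\<in>set F. wf_clause n C \<Longrightarrow>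
  runs P f_pass [enc_cnf F, enc_nat n, enc_vec n y, enc_vec n z] (enc_vec n (pass F y z)) (1300 * (n + 1) * (length F + 1))"
proof (induction F arbitrary: z)
  case Nil
  show ?case by (rule runsI) (auto simp: body_defs, simp_all add: cost_le_def algebra_simps)
next
  case (Cons C F)
  note [intro!] = runs_wpf[OF Cons.IH]
  show ?case using Cons.prems
    by (intro runsI) (auto simp: body_defs, simp_all add: cost_le_def algebra_simps)
qed

lemmas pass_wpf [intro!] = runs_wpf[OF pass_runs]

lemma passes_runs: "\<forall>C\<in>set F. wf_clause n C \<Longrightarrow>
  runs P f_passes [enc_nat k, enc_cnf F, enc_nat n, enc_vec n y, enc_vec n z] (enc_vec n (passes k F y z))
    (1400 * (n + 1) * (length F + 1) * (k + 1))"
proof (induction k arbitrary: z)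
  case 0
  show ?case by (rule runsI) (auto simp: body_defs, simp_all add: cost_le_def algebra_simps)
next
  case (Suc k)
  note [intro!] = runs_wpf[OF Suc.IH]
  show ?case using Suc.prems
    by (intro runsI) (auto simp: body_defs, simp_all add: cost_le_def algebra_simps)
qed

lemmas passes_wpf [intro!] = runs_wpf[OF passes_runs]

end

section \<open>Binomial sums, 2-SAT and the search\<close>

lemma binom_le_0 [simp]: "binom_le n 0 = 1"
  by (simp add: binom_le_def)

lemma binom_le_zero [simp]: "binom_le 0 t = 1"
  by (induction t) (simp_all add: binom_le_def)

text \<open>Pascal's rule, summed. The two terms are the two recursive calls of
  \<open>search\<close>: keep the next bit, or complement it and spend one unit of the
  budget.\<close>

lemma binom_le_Suc_Suc: "binom_le (Suc n) (Suc t) = binom_le n (Suc t) + binom_le n t"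
proof -
  have "binom_le (Suc n) (Suc t) = 1 + (\<Sum>i\<le>t. Suc n choose Suc i)"
    unfolding binom_le_def by (subst sum.atMost_Suc_shift) simp
  also have "\<dots> = (1 + (\<Sum>i\<le>t. n choose Suc i)) + binom_le n t"
    by (simp add: sum.distrib binom_le_def)
  also have "1 + (\<Sum>i\<le>t. n choose Suc i) = binom_le n (Suc t)"
    unfolding binom_le_def by (subst sum.atMost_Suc_shift) simp
  finally show ?thesis .
qed

lemma binom_le_pos: "binom_le n t \<ge> 1"
  unfolding binom_le_def by (induction t) auto

lemma enc_vecs_list: "enc_vecs n B = enc_list (map (enc_vec n) B)"
  by (induction B) auto

lemma enc_bits_vec: "length xs = n \<Longrightarrow> enc_bits xs = enc_vec n (vec_of xs)"
proof -
  assume "length xs = n"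
  then have "xs = map (vec_of xs) [0..<n]"
    by (intro nth_equalityI) (auto simp: vec_of_def)
  then have "enc_bits xs = enc_bits (map (vec_of xs) [0..<n])"
    by (rule arg_cong)
  then show ?thesis
    by (simp add: enc_bits_def enc_vec_def comp_def)
qed

lemma grow_ge: "grow k \<ge> k"
  by (induction k rule: grow.induct) auto

context prog
begin

lemma tryl_runs: "\<forall>l\<in>set C. fst l < n \<Longrightarrow> \<forall>C\<in>set (C0 # F). wf_clause n C \<Longrightarrow>
  runs P f_tryl [enc_clause' C, enc_cnf F, enc_cnf (C0 # F), enc_nat n, enc_vec n y]
    (enc_res n (tryl n C F (C0 # F) y)) (2600 * (n + 1) * (n + 1) * (length F + 1) * (length C + 1))"
proof (induction C)
  case Nil
  show ?case by (rule runsI) (auto simp: body_defs, simp_all add: cost_le_def algebra_simps)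
next
  case (Cons l C)
  note [intro!] = runs_wpf[OF Cons.IH[unfolded enc_cnf.simps]]
    satall_wpf[of "C0 # F", unfolded enc_cnf.simps]
  show ?case using Cons.prems
    by (intro runsI) (auto simp: body_defs Let_def, simp_all add: cost_le_def algebra_simps)
qed

lemma tryl_wpf [intro!]:
  assumes "\<forall>C\<in>set (C # F). wf_clause n C"
    "\<And>s. cost_le s (7800 * (n + 1) * (n + 1) * (length F + 1)) \<Longrightarrow> Q (enc_res n (tryl n C F (C # F) y)) s"
  shows "wpf P f_tryl [enc_clause' C, enc_cnf F, Node (enc_clause' C) (enc_cnf F), enc_nat n, enc_vec n y] Q"
proof (rule runs_wpf[OF tryl_runs[of C n C F, unfolded enc_cnf.simps]])
  show "\<forall>l\<in>set C. fst l < n" "\<forall>C\<in>set (C # F). wf_clause n C"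
    using assms by (simp_all add: wf_clause_def)
  fix s assume "cost_le s (2600 * (n + 1) * (n + 1) * (length F + 1) * (length C + 1))"
  then have "s \<le> 2600 * (n + 1) * (n + 1) * (length F + 1) * (length C + 1)" by (simp add: cost_le_def)
  also have "\<dots> \<le> 2600 * (n + 1) * (n + 1) * (length F + 1) * 3"
    using assms(1) by (intro mult_le_mono2) (simp add: wf_clause_def)
  finally show "Q (enc_res n (tryl n C F (C # F) y)) s" by (intro assms(2)) (simp add: cost_le_def algebra_simps)
qed

lemma twosat_runs: "\<forall>C\<in>set R. wf_clause n C \<Longrightarrow> \<forall>C\<in>set F. wf_clause n C \<Longrightarrow>
  runs P f_twosat [enc_cnf R, enc_cnf F, enc_nat n, enc_vec n y] (enc_res n (twosat n R F y))
    (8500 * (n + 1) * (n + 1) * (length R + length F + 1) * (length R + 1))"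
proof (induction R arbitrary: F y)
  case Nil
  show ?case by (rule runsI) (auto simp: body_defs, simp_all add: cost_le_def algebra_simps)
next
  case (Cons C R)
  note [intro!] = runs_wpf[OF Cons.IH[of "C # F" for F, simplified]]
  show ?case using Cons.prems
    by (intro runsI) (auto simp: body_defs split: option.split, simp_all add: cost_le_def algebra_simps)
qed

lemmas twosat_wpf [intro!] = runs_wpf[OF twosat_runs]

lemma attempt_runs: "\<forall>C\<in>set F. wf_clause n C \<Longrightarrow> \<forall>e\<in>set E. length (fst e) = n \<Longrightarrow>
  runs P f_attempt [enc_cnf F, enc_eqs E, enc_nat n, enc_vec n y, enc_vec n z] (enc_res n (attempt n F E y z))
    (2500 * (n + 1) * (n + 1) * (length F + length E + 1))"
  by (rule runsI) (auto simp: body_defs attempt_def Let_def, simp_all add: cost_le_def algebra_simps)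

text \<open>The search tree has at most \<open>binom_le (length w) t\<close> leaves. Each pays
  \<open>K\<close> for its attempt and 100 for every level above it.\<close>

lemma search_runs: 
  assumes wf: "\<forall>C\<in>set F. wf_clause n C" "\<forall>e\<in>set E. length (fst e) = n"
    and K: "K = 2500 * (n + 1) * (n + 1) * (length F + length E + 1)"
  shows "length acc + length w = n \<Longrightarrow>
    runs P f_search [enc_bits w, enc_nat t, enc_bits acc, enc_cnf F, enc_eqs E, enc_nat n, enc_vec n y]
      (enc_res n (search n F E y w t acc)) (binom_le (length w) t * (K + 100 * (length w + 1)))"
proof (induction w arbitrary: t acc)
  case Nil
  have [simp]: "enc_bits acc = enc_vec n (vec_of acc)" using Nil by (intro enc_bits_vec) simp
  note [intro!] = runs_wpf[OF attempt_runs[OF wf], folded K]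
  show ?case by (rule runsI) (auto simp: body_defs, simp_all add: cost_le_def algebra_simps)
next
  case (Cons b w)
  have len: "length (c # acc) + length w = n" for c using Cons.prems by simp
  show ?case
  proof (cases t)
    case 0
    note [intro!] = runs_wpf[OF Cons.IH[OF len[of b], of 0, simplified]]
    show ?thesis unfolding 0
      by (intro runsI) (auto simp: body_defs split: option.split, simp_all add: cost_le_def algebra_simps)
  next
    case (Suc t')
    note [intro!] = runs_wpf[OF Cons.IH[OF len[of b], of "Suc t'", simplified]]
      runs_wpf[OF Cons.IH[OF len[of 0], of t', simplified enc_bits_simps enc_bit_simps]]
      runs_wpf[OF Cons.IH[OF len[of 1], of t', simplified enc_bits_simps enc_bit_simps]]
    \<comment> \<open>Positivity lets the leaves absorb the constant overhead of the current
      node.\<close>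
    have "binom_le (length w) t' \<ge> 1" "binom_le (length w) (Suc t') \<ge> 1" by (rule binom_le_pos)+
    then show ?thesis unfolding Suc
      by (intro runsI) (auto simp: body_defs binom_le_Suc_Suc split: option.split, simp_all add: cost_le_def algebra_simps binom_le_Suc_Suc)
  qed
qed

section \<open>Unary arithmetic and the random walk\<close>

lemma revapp_runs: "runs P f_revapp [enc_list xs, enc_list ys] (enc_list (rev xs @ ys)) (40 * (length xs + 1))"
proof (induction xs arbitrary: ys)
  case Nil
  show ?case by (rule runsI) (auto simp: body_defs, simp_all add: cost_le_def algebra_simps)
next
  case (Cons x xs)
  note [intro!] = runs_wpf[OF Cons.IH[of "x # ys" for ys, simplified]]
  show ?case by (rule runsI) (auto simp: body_defs, simp_all add: cost_le_def algebra_simps)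
qed

lemma minus_runs: "runs P f_minus [enc_nat a, enc_list ts] (enc_nat (a - length ts)) (40 * (length ts + 1))"
proof (induction ts arbitrary: a)
  case Nil
  show ?case by (rule runsI) (auto simp: body_defs, simp_all add: cost_le_def algebra_simps)
next
  case (Cons x ts)
  note [intro!] = runs_wpf[OF Cons.IH]
  show ?case by (cases a; intro runsI) (auto simp: body_defs, simp_all add: cost_le_def algebra_simps)
qed

lemma mul_runs: "runs P f_mul [enc_nat a, enc_nat b] (enc_nat (a * b)) (100 * (a + 1) * (b + 1))"
proof (induction a)
  case 0
  show ?case by (rule runsI) (auto simp: body_defs, simp_all add: cost_le_def algebra_simps)
next
  case (Suc a)
  note [intro!] = runs_wpf[OF Suc.IH]
    runs_wpf[OF revapp_runs[of "replicate b Leaf" "replicate c Leaf" for c, folded replicate_add, simplified, folded replicate_add enc_nat_def]]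
  show ?case by (rule runsI) (auto simp: body_defs, simp_all add: cost_le_def algebra_simps)
qed

lemma grow_runs: "runs P f_grow [enc_nat k] (enc_nat (grow k)) (40 * (k + 1))"
proof (induction k rule: grow.induct)
  case (3 k)
  note [intro!] = runs_wpf[OF 3]
  show ?case by (rule runsI) (auto simp: body_defs numeral_3_eq_3, simp_all add: cost_le_def algebra_simps)
next
  case 1
  show ?case by (rule runsI) (auto simp: body_defs, simp_all add: cost_le_def)
next
  case 2
  show ?case by (rule runsI) (auto simp: body_defs numeral_2_eq_2, simp_all add: cost_le_def)
qed

lemma pow_runs: "runs P f_pow [enc_list ts] (enc_nat (trials (length ts))) (60 * (length ts + 1) * (trials (length ts) + 1))"
proof (induction ts)
  case Nil
  show ?case by (rule runsI) (auto simp: body_defs numeral_3_eq_3, simp_all add: cost_le_def algebra_simps)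
next
  case (Cons x ts)
  define k where "k = trials (length ts)"
  have "60 * (length ts + 1) * (k + 1) \<le> 60 * (length ts + 1) * (grow k + 1)"
    by (intro mult_le_mono2) (simp add: grow_ge)
  then have "runs P f_pow [enc_list ts] (enc_nat k) (60 * (length ts + 1) * (grow k + 1))"
    using runs_mono Cons.IH unfolding k_def by blast
  note [intro!] = runs_wpf[OF this] runs_wpf[OF grow_runs]
  have "k \<le> grow k"
    by (rule grow_ge)
  then show ?case by (intro runsI) (auto simp: body_defs k_def[symmetric], simp_all add: cost_le_def algebra_simps k_def[symmetric])
qed

lemma eqb_runs: "runs P f_eqb [enc_bit a, enc_bit b] (enc_bit (if a = b then 1 else 0)) 20"
  by (rule runsI) (auto simp: body_defs enc_bit_def, simp_all add: cost_le_def)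

lemmas eqb_wpf [intro!] = runs_wpf[OF eqb_runs]

lemma step2_runs:
  assumes "rank_le n S"
  shows "runs P f_step2 [Node (enc_nat (fst l)) (enc_bit (snd l)), Node (enc_nat (fst l')) (enc_bit (snd l')),
      Node (enc_bit (fst c)) (enc_bit (snd c)), enc_nat n, enc_rep n S] (enc_rep n (step2 n l l' c S))
      (3000 * (n + 1) * (n + 1))"
  using assms
  by (intro runsI) (auto simp: body_defs, simp_all add: step2_def Let_def cost_le_def algebra_simps)

lemmas step2_wpf [intro!] = runs_wpf[OF step2_runs]

lemma step_runs:
  assumes "rank_le n S"
  shows "runs P f_step [enc_clause' C, Node (enc_bit (fst c)) (enc_bit (snd c)), enc_nat n, enc_rep n S]
      (enc_rep n (step n C c S)) (3100 * (n + 1) * (n + 1))"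
proof (cases C)
  case Nil
  then show ?thesis by (intro runsI) (auto simp: body_defs step_def, simp_all add: cost_le_def algebra_simps)
next
  case (Cons l C')
  then show ?thesis using assms
    by (cases C'; intro runsI) (auto simp: body_defs step_def, simp_all add: cost_le_def algebra_simps)
qed

lemmas step_wpf [intro!] = runs_wpf[OF step_runs]

lemma walk_runs:
  "rank_le n S \<Longrightarrow> runs P f_walk [enc_cnf F, enc_choices cs, enc_nat n, enc_rep n S]
      (enc_rep n (walk n F cs S)) (3200 * (n + 1) * (n + 1) * (length F + 1))"
proof (induction F arbitrary: cs S)
  case Nil
  show ?case by (rule runsI) (auto simp: body_defs, simp_all add: cost_le_def algebra_simps)
next
  case (Cons C F)
  note [intro!] = runs_wpf[OF Cons.IH]
  show ?case using Cons.prems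
    by (cases cs; intro runsI) (auto simp: body_defs, simp_all add: cost_le_def algebra_simps)
qed

end

definition det :: "nat \<Rightarrow> clause list \<Rightarrow> equation list \<Rightarrow> vec list \<Rightarrow> vec option" where
  "det n F E B = (case twosat n F [] (\<lambda>_. 0) of None \<Rightarrow> None
     | Some y \<Rightarrow> search n F E y (rev (map y [0..<n])) (n - length B) [])"

lemma (in prog) det_runs:
  assumes wf: "\<forall>C\<in>set F. wf_clause n C" "\<forall>e\<in>set E. length (fst e) = n"
    and m: "n < m" "length F + length E < m" "length B \<le> n"
  shows "runs P f_det [enc_cnf F, enc_eqs E, enc_nat n, enc_vecs n B] (enc_res n (det n F E B))
    (15000 * m ^ 4 * binom_le n (n - length B))"
proof (rule runsI)
  \<comment> \<open>Every polynomial cost below is a constant times at most four factors, each at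
    most \<open>m\<close>.\<close>
  define M where "M = m ^ 4"
  define b where "b = binom_le n (n - length B)"
  have M: "w * x * y * z \<le> M" if "w \<le> m" "x \<le> m" "y \<le> m" "z \<le> m" for w x y z
    unfolding M_def power4_eq_xxxx using that by (intro mult_le_mono)
  have 1: "8500 * (n + 1) * (n + 1) * (length F + 1) * (length F + 1) \<le> 8500 * M"
    using M[of "n + 1" "n + 1" "length F + 1" "length F + 1"] m by (simp only: mult.assoc) simp
  have M1: "x \<le> M" if "x \<le> m" for x
    using M[of x 1 1 1] that m by simp
  have "(n + 1) * (n + 1) * (length F + length E + 1) * 1 \<le> M" using m by (intro M) auto
  then have A: "(n + 1) * (n + 1) * (length F + length E + 1) \<le> M" by (simp only: mult_1_right)
  have B: "n + 1 \<le> M" using m by (intro M1) simp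
  have "2500 * (n + 1) * (n + 1) * (length F + length E + 1) + 100 * (n + 1) \<le> 2500 * M + 100 * M"
    using add_mono[OF mult_le_mono2[OF A, of 2500] mult_le_mono2[OF B, of 100]] by (simp only: mult.assoc)
  then have "2500 * (n + 1) * (n + 1) * (length F + length E + 1) + 100 * (n + 1) \<le> 2600 * M"
    by (rule order.trans) simp
  then have "b * (2500 * (n + 1) * (n + 1) * (length F + length E + 1) + 100 * (n + 1)) \<le> b * (2600 * M)"
    by (rule mult_le_mono2)
  also have "\<dots> = 2600 * (M * b)" by simp
  finally have 2: "b * (2500 * (n + 1) * (n + 1) * (length F + length E + 1) + 100 * (n + 1)) \<le> 2600 * (M * b)" .
  have "runs P f_revapp [enc_vec n y, Leaf] (enc_bits (rev (map y [0..<n]))) (40 * (n + 1))" for y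
    using revapp_runs[of "map (\<lambda>i. enc_bit (y i)) [0..<n]" "[]"]
    by (simp add: enc_vec_def enc_bits_def rev_map comp_def)
  then have rev: "runs P f_revapp [enc_vec n y, Leaf] (enc_bits (rev (map y [0..<n]))) (40 * M)" for y
    by (rule runs_mono) (rule mult_le_mono2[OF B])
  have "length B + 1 \<le> M" using m by (intro M1) simp
  then have minus: "runs P f_minus [enc_nat n, enc_vecs n B] (enc_nat (n - length B)) (40 * M)"
    using runs_mono[OF minus_runs[of n "map (enc_vec n) B"], of "40 * M"] by (simp add: enc_vecs_list)
  have two: "runs P f_twosat [enc_cnf F, Leaf, enc_nat n, enc_vec n y] (enc_res n (twosat n F [] y)) (8500 * M)" for y
    using runs_mono[OF twosat_runs[of F n "[]" y], of "8500 * M"] wf 1 by simp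
  have search: "runs P f_search [enc_bits (rev (map y [0..<n])), enc_nat (n - length B), Leaf, enc_cnf F, enc_eqs E, enc_nat n, enc_vec n y]
      (enc_res n (search n F E y (rev (map y [0..<n])) (n - length B) [])) (2600 * (M * b))" for y
    using runs_mono[OF search_runs[OF wf refl, of "[]" "rev (map y [0..<n])" "n - length B" y], of "2600 * (M * b)"] 2
    by (simp add: b_def)
  note [intro!] = runs_wpf[OF two[of "\<lambda>_. 0", folded enc_nat_vec]] runs_wpf[OF rev] runs_wpf[OF minus] runs_wpf[OF search]
  show "f_det < length P" by (rule P_len2) simp
  fix X assume "cost_le (15000 * m ^ 4 * binom_le n (n - length B)) X"
  define W where "W = M * b"
  have "M \<ge> 1" using M1[of 1] m by simp
  moreover have "M \<le> W" using binom_le_pos[of n "n - length B"] by (simp add: b_def W_def)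
  moreover have "15000 * W \<le> X"
    using \<open>cost_le _ X\<close> by (simp add: cost_le_def M_def b_def W_def mult.assoc)
  ultimately have "8500 * M + 40 * M + 40 * M + 2600 * W + 1000 \<le> X" by simp
  then have X: "8500 * M + 40 * M + 40 * M + 2600 * (M * b) + 1000 \<le> X" by (simp add: W_def)
  show "wp P (P ! f_det) [enc_cnf F, enc_eqs E, enc_nat n, enc_vecs n B]
      (\<lambda>v' s. v' = enc_res n (det n F E B) \<and> cost_le s X)"
    unfolding P_nth(1)
    by (auto simp: body_defs det_def split: option.split)
      (use X in \<open>simp_all add: cost_le_def\<close>)
qed

section \<open>Running times of the randomized parts\<close>

text \<open>Counterpart of \<open>runs\<close> for random code: an exact distribution of values with
  a worst-case step bound. \<open>D\<close> has total mass one, so termination is included, and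
  quantifying over all larger fuel makes the notion compose.\<close>

definition yields :: "program \<Rightarrow> expr \<Rightarrow> tree list \<Rightarrow> tree pmf \<Rightarrow> nat \<Rightarrow> bool" where
  "yields P e env D T \<longleftrightarrow> (\<forall>fuel\<ge>T. map_spmf fst (exec P fuel e env) = spmf_of_pmf D \<and>
     (\<forall>x\<in>set_spmf (exec P fuel e env). snd x \<le> T))"

lemma yields_wp: "wp P e env (\<lambda>v s. v = w \<and> s \<le> T) \<Longrightarrow> yields P e env (return_pmf w) T"
proof -
  assume "wp P e env (\<lambda>v s. v = w \<and> s \<le> T)"
  then obtain s where s: "ev P e env w s" "s \<le> T"
    unfolding wp_def by blast
  show ?thesis
    unfolding yields_def
  proof (intro allI impI)
    fix fuel assume "T \<le> fuel"
    with s have "exec P fuel e env = return_spmf (w, s)"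
      by (intro exec_ev) simp_all
    with s show "map_spmf fst (exec P fuel e env) = spmf_of_pmf (return_pmf w) \<and>
        (\<forall>x\<in>set_spmf (exec P fuel e env). snd x \<le> T)"
      by simp
  qed
qed

lemma yields_mono: "yields P e env D T \<Longrightarrow> D = D' \<Longrightarrow> T \<le> T' \<Longrightarrow> yields P e env D' T'"
  unfolding yields_def by (auto dest: le_trans)

lemma yields_ECoin: "yields P ECoin env (map_pmf (\<lambda>b. if b then Node Leaf Leaf else Leaf) (pmf_of_set UNIV)) 1"
  unfolding yields_def
proof (intro allI impI)
  have coin: "coin_spmf = spmf_of_pmf (pmf_of_set UNIV)" by simp
  fix fuel :: nat assume "1 \<le> fuel"
  then obtain k where "fuel = Suc k" by (cases fuel) auto
  then show "map_spmf fst (exec P fuel ECoin env) =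
       spmf_of_pmf (map_pmf (\<lambda>b. if b then Node Leaf Leaf else Leaf) (pmf_of_set UNIV)) \<and>
       (\<forall>x\<in>set_spmf (exec P fuel ECoin env). snd x \<le> 1)"
    by (simp add: coin spmf.map_comp pmf.map_comp o_def map_spmf_of_pmf del: spmf_of_pmf_pmf_of_set)
qed

lemma yields_ECall:
  assumes "f < length P" "yields P (P ! f) (map (lookup env) xs) D T"
  shows "yields P (ECall f xs) env D (T + length xs + 1)"
  unfolding yields_def
proof (intro allI impI)
  fix fuel :: nat assume "T + length xs + 1 \<le> fuel"
  then obtain k where k: "fuel = Suc k" "T \<le> k" by (cases fuel) auto
  then have "map_spmf fst (exec P k (P ! f) (map (lookup env) xs)) = spmf_of_pmf D"
    "\<forall>x\<in>set_spmf (exec P k (P ! f) (map (lookup env) xs)). snd x \<le> T"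
    using assms(2) unfolding yields_def by auto
  then show "map_spmf fst (exec P fuel (ECall f xs) env) = spmf_of_pmf D \<and>
       (\<forall>x\<in>set_spmf (exec P fuel (ECall f xs) env). snd x \<le> T + length xs + 1)"
    using k assms(1) by (auto simp: spmf.map_comp o_def split_def)
qed

lemma yields_ECase:
  assumes "case lookup env i of Leaf \<Rightarrow> yields P e1 env D T | Node l r \<Rightarrow> yields P e2 (l # r # env) D T"
  shows "yields P (ECase i e1 e2) env D (T + 1)"
  unfolding yields_def
proof (intro allI impI)
  fix fuel :: nat assume "T + 1 \<le> fuel"
  then obtain k where k: "fuel = Suc k" "T \<le> k" by (cases fuel) auto
  then show "map_spmf fst (exec P fuel (ECase i e1 e2) env) = spmf_of_pmf D \<and>
       (\<forall>x\<in>set_spmf (exec P fuel (ECase i e1 e2) env). snd x \<le> T + 1)"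
    using assms by (auto simp: yields_def spmf.map_comp o_def split_def split: tree.splits)
qed

text \<open>\<open>D1\<close> lives on mathematical values and \<open>h\<close> encodes them, so
  that the continuation can be described in terms of the sampled value itself rather than its
  tree.\<close>

lemma yields_ELet:
  assumes "yields P e1 env (map_pmf h D1) T1"
    "\<And>x. x \<in> set_pmf D1 \<Longrightarrow> yields P e2 (h x # env) (D2 x) T2"
  shows "yields P (ELet e1 e2) env (bind_pmf D1 D2) (T1 + T2 + 1)"
  unfolding yields_def
proof (intro allI impI)
  fix fuel :: nat assume "T1 + T2 + 1 \<le> fuel"
  then obtain k where k: "fuel = Suc k" "T1 \<le> k" "T2 \<le> k" by (cases fuel) auto
  let ?e1 = "exec P k e1 env"
  have 1: "map_spmf fst ?e1 = spmf_of_pmf (map_pmf h D1)" "\<forall>x\<in>set_spmf ?e1. snd x \<le> T1"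
    using assms(1) k unfolding yields_def by auto
  have 2: "map_spmf fst (exec P k e2 (h x # env)) = spmf_of_pmf (D2 x)"
    "\<forall>y\<in>set_spmf (exec P k e2 (h x # env)). snd y \<le> T2" if "x \<in> set_pmf D1" for x
    using assms(2)[OF that] k unfolding yields_def by auto
  have "fst ` set_spmf ?e1 = h ` set_pmf D1"
    using arg_cong[OF 1(1), of set_spmf] by simp
  then have 3: "\<exists>x\<in>set_pmf D1. fst z = h x" if "z \<in> set_spmf ?e1" for z
  proof -
    have "fst z \<in> fst ` set_spmf ?e1" using that by (rule imageI)
    then show ?thesis unfolding \<open>fst ` set_spmf ?e1 = h ` set_pmf D1\<close> by blast
  qed
  have "map_spmf fst (exec P fuel (ELet e1 e2) env) = bind_spmf ?e1 (\<lambda>z. map_spmf fst (exec P k e2 (fst z # env)))"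
    by (simp add: k map_spmf_bind_spmf spmf.map_comp o_def split_def)
  also have "\<dots> = bind_spmf (map_spmf fst ?e1) (\<lambda>v. map_spmf fst (exec P k e2 (v # env)))"
    by (simp add: bind_map_spmf o_def)
  also have "\<dots> = bind_pmf D1 (\<lambda>x. map_spmf fst (exec P k e2 (h x # env)))"
    by (simp add: 1 bind_map_pmf)
  also have "\<dots> = bind_pmf D1 (\<lambda>x. spmf_of_pmf (D2 x))"
    by (rule bind_pmf_cong) (simp_all add: 2)
  also have "\<dots> = spmf_of_pmf (bind_pmf D1 D2)"
    by (simp add: spmf_of_pmf_bind)
  finally have "map_spmf fst (exec P fuel (ELet e1 e2) env) = spmf_of_pmf (bind_pmf D1 D2)" .
  moreover have "snd x \<le> T1 + T2 + 1" if "x \<in> set_spmf (exec P fuel (ELet e1 e2) env)" for x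
  proof -
    from that obtain z y where zy: "z \<in> set_spmf ?e1" "y \<in> set_spmf (exec P k e2 (fst z # env))"
      and x: "snd x = snd z + snd y + 1"
      by (auto simp: k split_def set_bind_spmf Set.bind_def o_def)
    obtain u where "u \<in> set_pmf D1" "fst z = h u" using 3[OF zy(1)] by blast
    then show ?thesis using x zy 1(2) 2(2)[of u] by force
  qed
  ultimately show "map_spmf fst (exec P fuel (ELet e1 e2) env) = spmf_of_pmf (bind_pmf D1 D2) \<and>
       (\<forall>x\<in>set_spmf (exec P fuel (ELet e1 e2) env). snd x \<le> T1 + T2 + 1)" by blast
qed

lemma yields_ELet_wp:
  assumes "wp P e1 env (\<lambda>v s. s \<le> T1 \<and> yields P e2 (v # env) D T2)"
  shows "yields P (ELet e1 e2) env D (T1 + T2 + 1)"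
proof -
  obtain v s where v: "ev P e1 env v s" "s \<le> T1" "yields P e2 (v # env) D T2"
    using assms unfolding wp_def by blast
  then have "yields P e1 env (map_pmf (\<lambda>_. v) (return_pmf ())) T1"
    by (simp, intro yields_wp) (auto simp: wp_def)
  from yields_ELet[OF this, of e2 "\<lambda>_. D" T2] v show ?thesis
    by (simp add: bind_return_pmf)
qed

text \<open>The budget \<open>T\<close> is given at the start and decreased along the program, which
  avoids guessing how a given total splits into the costs of the parts.\<close>

lemma yields_ELet_detI:
  assumes "wp P e1 env (\<lambda>v s. s + 1 \<le> T \<and> yields P e2 (v # env) D (T - (s + 1)))"
  shows "yields P (ELet e1 e2) env D T"
proof -
  obtain v s where v: "ev P e1 env v s" "s + 1 \<le> T" "yields P e2 (v # env) D (T - (s + 1))"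
    using assms unfolding wp_def by blast
  then have "wp P e1 env (\<lambda>v s'. s' \<le> s \<and> yields P e2 (v # env) D (T - (s + 1)))"
    unfolding wp_def by blast
  from yields_mono[OF yields_ELet_wp[OF this] refl] v show ?thesis by simp
qed

lemma yields_ECaseI:
  assumes "1 \<le> T"
    "case lookup env i of Leaf \<Rightarrow> yields P e1 env D (T - 1) | Node l r \<Rightarrow> yields P e2 (l # r # env) D (T - 1)"
  shows "yields P (ECase i e1 e2) env D T"
  using yields_ECase[OF assms(2)] assms(1) by simp

lemma yields_ELetI:
  assumes "yields P e1 env (map_pmf h D1) Ta"
    "\<And>x. x \<in> set_pmf D1 \<Longrightarrow> yields P e2 (h x # env) (D2 x) (T - (Ta + 1))"
    "Ta + 1 \<le> T"
  shows "yields P (ELet e1 e2) env (bind_pmf D1 D2) T"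
  using yields_ELet[OF assms(1,2)] assms(3) by (auto intro: yields_mono)

lemma yields_ECallI:
  assumes "f < length P" "yields P (P ! f) (map (lookup env) xs) D T'" "T' + length xs + 1 \<le> T"
  shows "yields P (ECall f xs) env D T"
  using yields_mono[OF yields_ECall[OF assms(1,2)] refl assms(3)] .

lemma yields_coinI:
  assumes "\<And>b. yields P e2 ((if b then Node Leaf Leaf else Leaf) # env) (D2 b) (T - 2)" "2 \<le> T"
  shows "yields P (ELet ECoin e2) env (bind_pmf (pmf_of_set UNIV) D2) T"
  by (rule yields_ELetI[OF yields_ECoin]) (use assms in \<open>simp_all add: numeral_2_eq_2\<close>)

lemma yields_detI: "wp P e env (\<lambda>v s. return_pmf v = D \<and> s \<le> T) \<Longrightarrow> yields P e env D T"
  unfolding wp_def by (auto intro!: yields_wp simp: wp_def)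

text \<open>No bounded computation turns fair coins into three options of probability \<open>1/3\<close> each. A fourth
  option is rejected and the choice repeated, with a default value after \<open>k\<close> rejections.\<close>

primrec chooseD :: "nat \<Rightarrow> (bit \<times> bit) pmf" where
  "chooseD 0 = return_pmf (0, 0)"
| "chooseD (Suc k) = bind_pmf (pmf_of_set UNIV) (\<lambda>a. bind_pmf (pmf_of_set UNIV) (\<lambda>b.
     if a \<and> b then chooseD k else return_pmf (of_bool a, of_bool b)))"

text \<open>All choices of a trial are drawn before the walk starts. The walk itself is then
  coin-free and falls under the deterministic logic.\<close>

primrec choicesD :: "nat \<Rightarrow> nat \<Rightarrow> (bit \<times> bit) list pmf" where
  "choicesD k 0 = return_pmf []"
| "choicesD k (Suc m) = bind_pmf (chooseD k) (\<lambda>c. map_pmf ((#) c) (choicesD k m))"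

primrec loopD :: "nat \<Rightarrow> clause list \<Rightarrow> rep \<Rightarrow> nat \<Rightarrow> vec option pmf" where
  "loopD n F S 0 = return_pmf None"
| "loopD n F S (Suc T) = bind_pmf (choicesD n (length F)) (\<lambda>cs.
     case walk n F cs S of None \<Rightarrow> loopD n F S T | Some (p, B) \<Rightarrow> return_pmf (Some p))"

definition enc_choice :: "bit \<times> bit \<Rightarrow> tree" where
  "enc_choice c = Node (enc_bit (fst c)) (enc_bit (snd c))"

locale coin_prog = prog P main coin_lib for P main
begin

lemma P_nth_coin [simp]: "P ! f_choose = choose_code" "P ! f_choices = choices_code" "P ! f_loop = loop_code"
  by (simp_all add: P lib_def coin_lib_def)

lemma P_len_coin [simp]: "f_choose < length P" "f_choices < length P" "f_loop < length P"
  by (simp_all add: P lib_def coin_lib_def)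

lemma choose_yields: "yields P (P ! f_choose) [enc_nat k] (map_pmf enc_choice (chooseD k)) (60 * (k + 1))"
proof (induction k)
  case 0
  show ?case
    by simp (rule yields_wp, simp add: choose_code_def code_defs enc_choice_def enc_bit_def)
next
  case (Suc k)
  have *: "map_pmf enc_choice (chooseD (Suc k)) =
      bind_pmf (pmf_of_set UNIV) (\<lambda>a. bind_pmf (pmf_of_set UNIV) (\<lambda>b.
        if a \<and> b then map_pmf enc_choice (chooseD k) else return_pmf (enc_choice (of_bool a, of_bool b))))"
    by (auto simp: map_bind_pmf intro!: bind_pmf_cong)
  show ?case unfolding *
    apply (simp add: choose_code_def code_defs)
    apply (rule yields_ELet_detI, simp)
    apply (rule yields_ECaseI, simp, simp)
    apply (rule yields_coinI)
     apply (rule yields_coinI)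
    subgoal for a b
      apply (cases a; cases b; simp)
      subgoal
       apply (rule yields_ELet_detI, simp)
       apply (rule yields_ECaseI, simp, simp)
       apply (rule yields_ELet_detI, simp)
       apply (rule yields_ECaseI, simp, simp)
       apply (rule yields_ELet_detI, simp)
       apply (rule yields_ECallI[OF P_len_coin(1)])
        apply (use Suc.IH in simp)
       apply simp
       done
      apply (rule yields_detI, simp add: enc_choice_def enc_bit_def)+
      done
     apply simp_all
    done
qed

lemma enc_choices_Cons: "enc_choices (c # cs) = Node (enc_choice c) (enc_choices cs)"
  by (simp add: enc_choice_def)

lemma choices_yields:
  "yields P (P ! f_choices) [enc_cnf F, enc_nat k] (map_pmf enc_choices (choicesD k (length F))) (100 * (k + 1) * (length F + 1))"
proof (induction F)
  case Nil
  show ?case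
    by simp (rule yields_wp, simp add: choices_code_def code_defs)
next
  case (Cons C F)
  have choose: "yields P choose_code [enc_nat k] (map_pmf enc_choice (chooseD k)) (60 * (k + 1))"
    using choose_yields unfolding P_nth_coin .
  have choices: "yields P choices_code [enc_cnf F, enc_nat k] (map_pmf enc_choices (choicesD k (length F))) (100 * (k + 1) * (length F + 1))"
    using Cons.IH unfolding P_nth_coin .
  have *: "map_pmf enc_choices (choicesD k (length (C # F))) =
      bind_pmf (chooseD k) (\<lambda>c. bind_pmf (choicesD k (length F)) (\<lambda>cs. return_pmf (Node (enc_choice c) (enc_choices cs))))"
    by (simp add: map_bind_pmf pmf.map_comp o_def map_pmf_def[symmetric] enc_choices_Cons del: enc_choices.simps)
  show ?case unfolding *
    apply (simp add: choices_code_def code_defs)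
    apply (rule yields_ELet_detI, simp)
    apply (rule yields_ECaseI, simp, simp)
    apply (rule yields_ELetI[where h = enc_choice and Ta = "60 * k + 64"])
    subgoal
      apply (rule yields_ELet_detI, simp)
      apply (rule yields_ECallI[OF P_len_coin(1)])
       apply simp
       apply (rule choose)
      apply simp
      done
    subgoal for c
      apply (rule yields_ELetI[where h = enc_choices and Ta = "100 * (k + 1) * (length F + 1) + 8"])
      subgoal
        apply (rule yields_ELet_detI, simp)
        apply (rule yields_ELet_detI, simp)
        apply (rule yields_ECallI[OF P_len_coin(2)])
         apply simp
         apply (rule choices)
        apply simp
        done
       apply (rule yields_detI)
       apply (simp add: algebra_simps)
      apply (simp add: algebra_simps)
      done
    apply (simp add: algebra_simps)
    done
qed

definition loop_cost :: "nat \<Rightarrow> clause list \<Rightarrow> nat" where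
  "loop_cost n F = 4000 * (n + 1) * (n + 1) * (length F + 1)"

lemma loop_yields:
  assumes S: "rank_le n S"
  shows "yields P (P ! f_loop) [enc_nat T, enc_cnf F, enc_nat n, enc_rep n S] (map_pmf (enc_res n) (loopD n F S T))
    (loop_cost n F * (T + 1))"
proof (induction T)
  case 0
  show ?case
    by simp (rule yields_detI, simp add: loop_code_def code_defs loop_cost_def)
next
  case (Suc T)
  let ?C1 = "100 * (n + 1) * (length F + 1)" and ?C2 = "3200 * (n + 1) * (n + 1) * (length F + 1)"
  define K where "K = loop_cost n F * (T + 1)"
  have choices: "yields P choices_code [enc_cnf F, enc_nat n] (map_pmf enc_choices (choicesD n (length F))) ?C1"
    using choices_yields[of F n] unfolding P_nth_coin .
  have loop: "yields P loop_code [enc_nat T, enc_cnf F, enc_nat n, enc_rep n S] (map_pmf (enc_res n) (loopD n F S T))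
    K"
    using Suc.IH unfolding P_nth_coin K_def .
  have *: "map_pmf (enc_res n) (loopD n F S (Suc T)) =
      bind_pmf (choicesD n (length F)) (\<lambda>cs. case walk n F cs S of
         None \<Rightarrow> map_pmf (enc_res n) (loopD n F S T)
       | Some (p, B) \<Rightarrow> return_pmf (enc_res n (Some p)))"
    by (auto simp: map_bind_pmf intro!: bind_pmf_cong split: option.split)
  define c where "c = ?C1 + ?C2 + 30"
  have "c + 40 \<le> loop_cost n F"
    unfolding c_def loop_cost_def by (simp add: algebra_simps)
  then have c: "K + c + 40 \<le> loop_cost n F * (Suc T + 1)"
    by (simp add: K_def)
  note [intro!] = runs_wpf[OF walk_runs[OF S]]
  show ?case unfolding *
    apply (rule yields_mono[OF _ refl c])
    apply (simp add: loop_code_def code_defs)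
    apply (rule yields_ELet_detI, simp)
    apply (rule yields_ECaseI, simp, simp)
    \<comment> \<open>The sample is the list of choices; the value bound by the let is the result of
      the walk, a function of that list.\<close>
    apply (rule yields_ELetI[where h = "\<lambda>cs. enc_rep n (walk n F cs S)" and Ta = c])
    subgoal
      apply (subst map_pmf_def)
      apply (rule yields_ELet_detI, simp add: c_def)
      apply (rule yields_ELetI[where h = enc_choices and Ta = "?C1 + 10"])
      subgoal
        apply (rule yields_ELet_detI, simp)
        apply (rule yields_ELet_detI, simp)
        apply (rule yields_ECallI[OF P_len_coin(2)])
         apply simp
         apply (rule choices)
        apply simp
        done
       apply (rule yields_detI)
       apply auto
       apply (simp add: c_def cost_le_def)
      done
    subgoal for cs
      apply (rule yields_ECaseI, simp)
      apply (auto split: option.split)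
      subgoal
        apply (rule yields_ELet_detI, simp)
        apply (rule yields_ELet_detI, simp)
        apply (rule yields_ELet_detI, simp)
        apply (rule yields_ELet_detI, simp)
        apply (rule yields_ECallI[OF P_len_coin(3)])
         apply simp
         apply (rule loop)
        apply simp
        done
      apply (rule yields_detI, simp)
      done
    apply simp
    done
qed

end

section \<open>The two main programs and their costs\<close>

primrec NATC :: "nat \<Rightarrow> code" where
  "NATC 0 = LEAF"
| "NATC (Suc k) = NODE LEAF (NATC k)"

definition main_det_code :: expr where
  "main_det_code = (\<lambda>x. CASE (VAR x) LEAF (\<lambda>n y. CASE (VAR y) LEAF (\<lambda>F E.
     CASE (CALL f_addeqs [VAR E, NODE (VAR n) (CALL f_basis [VAR n])]) LEAF (\<lambda>p B.
     CALL f_det [VAR F, VAR E, VAR n, VAR B])))) 0 1"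

text \<open>Truncated subtraction decides the comparison: the difference of the unary numbers is a
  leaf iff 449 t <= 52 n.\<close>

definition main_rnd_code :: expr where
  "main_rnd_code = (\<lambda>x. CASE (VAR x) LEAF (\<lambda>n y. CASE (VAR y) LEAF (\<lambda>F E.
     CASE (CALL f_addeqs [VAR E, NODE (VAR n) (CALL f_basis [VAR n])]) LEAF (\<lambda>p B.
     CASE (CALL f_minus [CALL f_mul [NATC 449, CALL f_minus [VAR n, VAR B]], CALL f_mul [NATC 52, VAR n]])
       (CALL f_det [VAR F, VAR E, VAR n, VAR B])
       (\<lambda>_ _. CALL f_loop [CALL f_pow [VAR B], VAR F, VAR n, NODE (VAR p) (VAR B)]))))) 0 1"

lemma wp_NATC: "wp P (NATC k d) env Q \<longleftrightarrow> Q (enc_nat k) (4 * k + 1)"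
proof (induction k arbitrary: d env Q)
  case (Suc k)
  have eq: "4 * Suc k + 1 = Suc (Suc (Suc (Suc (Suc (4 * k)))))" by simp
  show ?case unfolding eq by (simp add: code_defs Suc.IH[unfolded code_defs])
qed (simp add: code_defs)

definition prep :: "subsat \<Rightarrow> rep" where
  "prep I = addeqs (nvars I) (equations I) (Some (\<lambda>_. 0, map unit [0..<nvars I]))"

lemma enc_clause'_eq: "enc_clause C = enc_clause' C"
  by (induction C) (auto simp: enc_clause_def)

lemma enc_cnf_eq: "enc_list (map enc_clause F) = enc_cnf F"
  by (induction F) (simp_all add: enc_clause'_eq)

lemma enc_eqs_eq: "enc_list (map enc_equation E) = enc_eqs E"
  by (induction E) simp_all

lemma enc_input_eq: "enc_input I = Node (enc_nat (nvars I)) (Node (enc_cnf (clauses I)) (enc_eqs (equations I)))"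
  by (simp add: enc_input_def enc_cnf_eq enc_eqs_eq)

lemma tree_size_enc_list: "length ts < tree_size (enc_list ts)"
proof (induction ts)
  case (Cons t ts)
  then show ?case by (cases t) simp_all
qed simp

lemma input_size_gt:
  "nvars I < input_size I" "length (clauses I) + length (equations I) < input_size I"
  using tree_size_enc_list[of "replicate (nvars I) Leaf"] tree_size_enc_list[of "map enc_clause (clauses I)"]
    tree_size_enc_list[of "map enc_equation (equations I)"]
  by (simp_all add: input_size_def enc_input_def enc_nat_def)

lemma rank_le_addeqs: "rank_le n S \<Longrightarrow> rank_le n (addeqs n E S)"
  by (induction E arbitrary: S) simp_all

lemma rank_le_prep: "rank_le (nvars I) (prep I)"
  unfolding prep_def by (rule rank_le_addeqs) (simp add: rank_le_def)

lemma well_formedD: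
  assumes "well_formed I"
  shows "\<forall>C\<in>set (clauses I). wf_clause (nvars I) C" "\<forall>e\<in>set (equations I). length (fst e) = nvars I"
  using assms by (simp_all add: well_formed_def wf_clause_def case_prod_unfold)

context prog
begin

lemma prep_runs:
  assumes wf: "well_formed I"
  shows "wpf P f_basis [enc_nat (nvars I)] (\<lambda>v s. cost_le s (60 * input_size I ^ 4) \<and>
    wpf P f_addeqs [enc_eqs (equations I), Node (enc_nat (nvars I)) v]
      (\<lambda>v s. v = enc_rep (nvars I) (prep I) \<and> cost_le s (700 * input_size I ^ 4)))"
proof -
  let ?n = "nvars I" and ?m = "input_size I" and ?e = "length (equations I)"
  have M: "w * x * y * z \<le> ?m ^ 4" if "w \<le> ?m" "x \<le> ?m" "y \<le> ?m" "z \<le> ?m" for w x y z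
    unfolding power4_eq_xxxx using that by (intro mult_le_mono)
  have "60 * (?n + 1) * (?n + 1) \<le> 60 * ?m ^ 4"
    using M[of "?n + 1" "?n + 1" 1 1] input_size_gt[of I] by (simp only: mult.assoc) simp
  note basis = runs_mono[OF basis_runs this]
  have "700 * (?n + 1) * (?n + 1) * (?e + 1) \<le> 700 * ?m ^ 4"
    using M[of "?n + 1" "?n + 1" "?e + 1" 1] input_size_gt[of I] by (simp only: mult.assoc) simp
  note addeqs = runs_mono[OF addeqs_runs this, of "Some (\<lambda>_. 0, map unit [0..<?n])"]
  show ?thesis
    apply (rule runs_wpf[OF basis])
    apply simp
    apply (rule runs_wpf)
     apply (rule addeqs[unfolded enc_rep_simps enc_vecs_list map_map comp_def enc_nat_vec[symmetric]])
    using well_formedD(2)[OF wf]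
      apply (simp_all add: rank_le_def prep_def)
    done
qed

lemma minus_dim_runs: "runs P f_minus [enc_nat n, enc_vecs n B] (enc_nat (n - length B)) (40 * (length B + 1))"
  using minus_runs[of n "map (enc_vec n) B"] by (simp add: enc_vecs_list)

lemma minus_nat_runs: "runs P f_minus [enc_nat a, enc_nat b] (enc_nat (a - b)) (40 * (b + 1))"
  using minus_runs[of a "replicate b Leaf"] by (simp add: enc_nat_def)

end

lemma (in prog) det_wpf:
  assumes "well_formed I" "length B \<le> nvars I"
    "\<And>s. cost_le s (15000 * input_size I ^ 4 * binom_le (nvars I) (nvars I - length B)) \<Longrightarrow>
      Q (enc_res (nvars I) (det (nvars I) (clauses I) (equations I) B)) s"
  shows "wpf P (Suc 0) [enc_cnf (clauses I), enc_eqs (equations I), enc_nat (nvars I), enc_vecs (nvars I) B] Q"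
  by (rule runs_wpf[OF det_runs[OF well_formedD[OF assms(1)] input_size_gt assms(2), unfolded One_nat_def]])
    (rule assms(3))

definition solve_det :: "subsat \<Rightarrow> vec option" where
  "solve_det I = (case prep I of None \<Rightarrow> None
     | Some (p, B) \<Rightarrow> det (nvars I) (clauses I) (equations I) B)"

lemma budget:
  fixes M b :: nat
  assumes "s \<le> k1 * M" "s' \<le> k2 * M" "s'' \<le> k3 * M * b" "1 \<le> M" "1 \<le> b"
  shows "s + s' + s'' + k4 \<le> (k1 + k2 + k3 + k4) * M * b"
proof -
  define W where "W = M * b"
  have "M * 1 \<le> M * b" using assms by (intro mult_le_mono2)
  then have W: "M \<le> W" by (simp add: W_def)
  have "s \<le> k1 * W" "s' \<le> k2 * W"
    using assms(1,2) mult_le_mono2[OF W] order.trans by blast+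
  moreover have "k4 * 1 \<le> k4 * W" using W assms(4) by (intro mult_le_mono2) linarith
  moreover have "s'' \<le> k3 * W" using assms(3) by (simp add: W_def mult.assoc)
  moreover have "(k1 + k2 + k3 + k4) * M * b = k1 * W + k2 * W + k3 * W + k4 * W"
    by (simp add: W_def algebra_simps)
  ultimately show ?thesis by linarith
qed

lemma (in prog) main_det_runs:
  assumes wf: "well_formed I" and main: "main = main_det_code"
  shows "runs P 0 [enc_input I] (enc_res (nvars I) (solve_det I)) (20000 * input_size I ^ 4 *
    (case prep I of None \<Rightarrow> 1 | Some (p, B) \<Rightarrow> binom_le (nvars I) (nvars I - length B)))"
proof (rule runsI)
  show "0 < length P" by (rule P_len2) simp
  define M where "M = input_size I ^ 4"
  have M1: "M \<ge> 1" using input_size_gt(1)[of I] by (simp add: M_def)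
  fix X assume X: "cost_le (20000 * input_size I ^ 4 *
    (case prep I of None \<Rightarrow> 1 | Some (p, B) \<Rightarrow> binom_le (nvars I) (nvars I - length B))) X"
  have P0: "P ! 0 = main_det_code" by (simp add: P main)
  have rank: "length B \<le> nvars I" if "prep I = Some (p, B)" for p B
    using rank_le_prep[of I] that by (simp add: rank_le_def)
  show "wp P (P ! 0) [enc_input I] (\<lambda>v' s. v' = enc_res (nvars I) (solve_det I) \<and> cost_le s X)"
    unfolding P0 enc_input_eq
    apply (simp add: main_det_code_def code_defs)
    apply (rule wpf_mono[OF prep_runs[OF wf]])
    apply (elim conjE)
    apply (simp)
    apply (erule wpf_mono)
    apply (elim conjE)
    apply (simp)
    apply (cases "prep I")
     apply (use X M1 in \<open>auto simp add: cost_le_def M_def[symmetric] solve_det_def split: prod.splits\<close>)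
    apply (rule det_wpf[OF wf])
    subgoal for s sa p B
      using rank[of p B] by simp
    subgoal for s sa p B sb
      using budget[of s 60 M sa 700 sb 15000 "binom_le (nvars I) (nvars I - length B)" 1000] X M1
        binom_le_pos[of "nvars I" "nvars I - length B"]
      by (simp add: cost_le_def M_def[symmetric] solve_det_def)
    done
qed

definition solve_rnd :: "subsat \<Rightarrow> vec option pmf" where
  "solve_rnd I = (case prep I of None \<Rightarrow> return_pmf None
     | Some (p, B) \<Rightarrow>
         if 449 * (nvars I - length B) \<le> 52 * nvars I
         then return_pmf (det (nvars I) (clauses I) (equations I) B)
         else loopD (nvars I) (clauses I) (prep I) (trials (length B)))"

definition rnd_cost :: "subsat \<Rightarrow> nat" where
  "rnd_cost I = (case prep I of None \<Rightarrow> 1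
     | Some (p, B) \<Rightarrow>
         if 449 * (nvars I - length B) \<le> 52 * nvars I
         then binom_le (nvars I) (nvars I - length B) else trials (length B))"

lemma (in coin_prog) main_rnd_yields:
  assumes wf: "well_formed I" and main: "main = main_rnd_code"
  shows "yields P (P ! 0) [enc_input I] (map_pmf (enc_res (nvars I)) (solve_rnd I))
    (80000 * input_size I ^ 4 * rnd_cost I)"
proof -
  define M where "M = input_size I ^ 4"
  define n where "n = nvars I"
  have n: "n + 1 \<le> M"
  proof -
    have "n + 1 \<le> input_size I" using input_size_gt(1)[of I] by (simp add: n_def)
    also have "\<dots> \<le> input_size I ^ 4" using input_size_gt(1)[of I] by (intro self_le_power) simp_all
    finally show ?thesis by (simp add: M_def)
  qed
  have P0: "P ! 0 = main_rnd_code" by (simp add: P main)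
  note prep = prep_runs[OF wf, folded M_def n_def]
  show ?thesis
    unfolding P0 enc_input_eq M_def[symmetric] n_def[symmetric]
  proof (cases "prep I")
    case None
    define X where "X = 80000 * M * rnd_cost I"
    have X: "80000 * M \<le> X" using None by (simp add: X_def rnd_cost_def)
    show "yields P main_rnd_code [Node (enc_nat n) (Node (enc_cnf (clauses I)) (enc_eqs (equations I)))]
        (map_pmf (enc_res n) (solve_rnd I)) (80000 * M * rnd_cost I)"
      unfolding X_def[symmetric]
      apply (rule yields_detI)
      apply (simp add: main_rnd_code_def code_defs)
      apply (rule wpf_mono[OF prep], elim conjE, simp)
      apply (erule wpf_mono, elim conjE)
      apply (use X n in \<open>simp add: cost_le_def None solve_rnd_def\<close>)
      done
  next
    case (Some a)
    obtain p B where S: "prep I = Some (p, B)" using Some by (cases a) auto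
    have B: "length B \<le> n" using rank_le_prep[of I] S by (simp add: rank_le_def n_def)
    have "runs P f_minus [enc_nat n, enc_vecs n B] (enc_nat (n - length B)) (40 * M)"
      using B n by (intro runs_mono[OF minus_dim_runs]) simp
    note minus = runs_wpf[OF this]
    have "100 * (449 + 1) * ((n - length B) + 1) \<le> 45000 * M" using n by simp
    note mul1 = runs_wpf[OF runs_mono[OF mul_runs this]]
    have "100 * (52 + 1) * (n + 1) \<le> 5300 * M" using n by simp
    note mul2 = runs_wpf[OF runs_mono[OF mul_runs this]]
    have "40 * (52 * n + 1) \<le> 2080 * M" using n by simp
    note minus2 = runs_wpf[OF runs_mono[OF minus_nat_runs this]]
    show "yields P main_rnd_code [Node (enc_nat n) (Node (enc_cnf (clauses I)) (enc_eqs (equations I)))]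
        (map_pmf (enc_res n) (solve_rnd I)) (80000 * M * rnd_cost I)"
    proof (cases "449 * (n - length B) \<le> 52 * n")
      case True
      then have 0: "449 * (n - length B) - 52 * n = 0" by simp
      have c: "rnd_cost I = binom_le n (n - length B)"
        using True by (simp add: rnd_cost_def S n_def)
      have "M * 1 \<le> M * binom_le n (n - length B)"
        using binom_le_pos by (intro mult_le_mono2)
      then have "M \<le> M * binom_le n (n - length B)" by (simp only: mult_1_right)
      \<comment> \<open>Writing the product as \<open>M + d\<close> makes the remaining cost
        arithmetic linear.\<close>
      from le_Suc_ex[OF this] obtain d where d: "M * binom_le n (n - length B) = M + d" by blast
      show ?thesis
        unfolding c mult.assoc d
        apply (rule yields_detI)
        apply (simp add: main_rnd_code_def code_defs)
        apply (rule wpf_mono[OF prep], elim conjE, simp)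
        apply (erule wpf_mono, elim conjE)
        apply (simp add: S wp_NATC)
        apply (rule minus, simp)
        apply (rule mul1, simp add: wp_NATC)
        apply (rule mul2, simp)
        apply (rule minus2, simp add: 0)
        apply (rule det_wpf[OF wf B[unfolded n_def], folded n_def M_def])
        apply (use n True in \<open>simp add: cost_le_def solve_rnd_def S n_def[symmetric] mult.assoc d\<close>)
        done
    next
      case False
      then obtain k' where k': "449 * (n - length B) - 52 * n = Suc k'"
        by (metis diff_is_0_eq not0_implies_Suc)
      define t where "t = trials (length B)"
      have c: "rnd_cost I = t"
        using False by (simp add: rnd_cost_def S n_def t_def)
      have t: "t \<ge> 1"
        unfolding t_def by (induction B) (auto intro: order.trans[OF _ grow_ge])
      have pow: "runs P f_pow [enc_vecs n B] (enc_nat t) (120 * (M * t))"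
      proof -
        have "60 * ((length B + 1) * (t + 1)) \<le> 60 * (M * (2 * t))"
          using B n t by (intro mult_le_mono2 mult_le_mono) simp_all
        then have "60 * (length B + 1) * (t + 1) \<le> 120 * (M * t)" by (simp add: algebra_simps)
        then show ?thesis
          using runs_mono[OF pow_runs[of "map (enc_vec n) B"]] by (simp add: enc_vecs_list t_def)
      qed
      have loop: "yields P loop_code [enc_nat t, enc_cnf (clauses I), enc_nat n, Node (enc_vec n p) (enc_vecs n B)]
          (map_pmf (enc_res n) (solve_rnd I)) (8000 * (M * t))"
      proof -
        have "loop_cost n (clauses I) \<le> 4000 * M"
        proof -
          have "(n + 1) * (n + 1) * (length (clauses I) + 1) * 1 \<le> M"
            unfolding M_def power4_eq_xxxx n_def using input_size_gt[of I] by (intro mult_le_mono) simp_all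
          then show ?thesis unfolding loop_cost_def by (simp only: mult.assoc)
        qed
        then have "loop_cost n (clauses I) * (t + 1) \<le> (4000 * M) * (2 * t)"
          using t by (intro mult_le_mono) simp_all
        then have le: "loop_cost n (clauses I) * (t + 1) \<le> 8000 * (M * t)" by simp
        show ?thesis
          using yields_mono[OF loop_yields[of n "Some (p, B)" t "clauses I"] _ le] B False
          by (simp add: rank_le_def solve_rnd_def S n_def[symmetric] t_def[symmetric])
      qed
      have "M * 1 \<le> M * t" using t by (intro mult_le_mono2)
      then have "M \<le> M * t" by (simp only: mult_1_right)
      from le_Suc_ex[OF this] obtain d where d: "M * t = M + d" by blast
      show ?thesis
        unfolding c mult.assoc d
        apply (simp add: main_rnd_code_def code_defs)
        apply (rule yields_ELet_detI, simp)
        apply (rule conjI, use n in simp)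
        apply (rule yields_ECaseI, use n in simp, simp)
        apply (rule yields_ELet_detI, simp)
        apply (rule conjI, use n in simp)
        apply (rule yields_ECaseI, use n in simp, simp)
        apply (rule yields_ELet_detI, simp)
        apply (rule wpf_mono[OF prep], elim conjE, simp)
        apply (erule wpf_mono, elim conjE)
        apply (simp add: cost_le_def)
        apply (rule conjI, use n in simp)
        apply (rule yields_ECaseI, use n in simp)
        apply (simp add: S wp_NATC)
        apply (rule yields_ELet_detI, simp add: wp_NATC)
        apply (rule minus, simp)
        apply (rule mul1, simp add: wp_NATC)
        apply (rule mul2, simp)
        apply (rule minus2, simp add: cost_le_def)
        apply (rule conjI, use n in simp)
        apply (rule yields_ECaseI, use n in simp)
        apply (simp add: k')
        apply (rule yields_ELet_detI, simp)
        apply (rule runs_wpf[OF pow], simp add: cost_le_def d)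
        apply (rule conjI, use n in simp)
        apply (rule yields_ELet_detI, simp)
        apply (rule conjI, use n in simp)
        apply (rule yields_ELet_detI, simp)
        apply (rule conjI, use n in simp)
        apply (rule yields_ELet_detI, simp)
        apply (rule conjI, use n in simp)
        apply (rule yields_ECallI[OF P_len_coin(3)], simp, rule loop)
        apply (use n in \<open>simp add: d\<close>)
        done
    qed
  qed
qed

section \<open>Affine spaces in parametric form\<close>

declare plus_fun_apply [simp del]

primrec pts :: "vec \<Rightarrow> vec list \<Rightarrow> vec set" where
  "pts p [] = {p}"
| "pts p (v # B) = pts p B \<union> pts (p + v) B"

definition rep_pts :: "rep \<Rightarrow> vec set" where
  "rep_pts S = (case S of None \<Rightarrow> {} | Some (p, B) \<Rightarrow> pts p B)"

lemma rep_pts_simps [simp]: "rep_pts None = {}" "rep_pts (Some (p, B)) = pts p B"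
  by (simp_all add: rep_pts_def)

lemma vec_add_self [simp]: "(x :: vec) + x = 0"
  by (rule ext) (simp add: plus_fun_apply)

lemma vec_add_self_left [simp]: "(x :: vec) + (x + y) = y"
  by (simp add: add.assoc[symmetric])

lemma vec_minus: "(x :: vec) - y = x + y"
  by (rule ext) (simp add: plus_fun_apply)

lemma dot_add: "dot n a (x + y) = dot n a x + dot n a y"
  unfolding dot_def plus_fun_def by (simp only: distrib_left sum.distrib)

text \<open>Adding the generator \<open>w\<close> to other generators only moves points between the
  two translates by \<open>w\<close>.\<close>

lemma pts_elim: "pts p B \<union> pts (p + w) B = pts p (elim n a w B) \<union> pts (p + w) (elim n a w B)"
proof (induction B arbitrary: p)
  case (Cons u B)
  have "p + w + (u + w) = p + u + (w + w)" by (simp only: ac_simps)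
  then have 1: "p + w + (u + w) = p + u" by simp
  have 2: "p + (u + w) = p + u + w" "p + w + u = p + u + w" by (simp_all only: ac_simps)
  let ?E = "elim n a w B"
  have "pts p (u # B) \<union> pts (p + w) (u # B) = (pts p B \<union> pts (p + w) B) \<union> (pts (p + u) B \<union> pts (p + u + w) B)"
    unfolding pts.simps 2 by (simp only: Un_ac)
  also have "\<dots> = (pts p ?E \<union> pts (p + w) ?E) \<union> (pts (p + u) ?E \<union> pts (p + u + w) ?E)"
    by (simp only: Cons.IH[of p] Cons.IH[of "p + u"])
  also have "\<dots> = pts p (elim n a w (u # B)) \<union> pts (p + w) (elim n a w (u # B))"
    by (cases "dot n a u = 1") (simp_all only: elim_simps if_True if_False pts.simps 1 2 simp_thms Un_ac)
  finally show ?case .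
qed simp

lemma elim_dot: "dot n a w = 1 \<Longrightarrow> u \<in> set (elim n a w B) \<Longrightarrow> dot n a u = 0"
  by (induction B) (use bit_cases in \<open>force simp: dot_add split: if_splits\<close>)+

lemma red_None: "red n a B = None \<Longrightarrow> \<forall>w\<in>set B. dot n a w = 0"
  by (induction B) (use bit_cases in \<open>force split: if_splits option.splits\<close>)+

lemma red_Some:
  "red n a B = Some (v, B') \<Longrightarrow> dot n a v = 1 \<and> (\<forall>w\<in>set B'. dot n a w = 0) \<and> (\<forall>p. pts p B = pts p B' \<union> pts (p + v) B')"
proof (induction B arbitrary: v B')
  case (Cons w B)
  show ?case
  proof (cases "dot n a w = 1")
    case True
    then have *: "v = w" "B' = elim n a w B" using Cons.prems by auto
    show ?thesis
      unfolding * pts.simps using True elim_dot[OF True] pts_elim by blast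
  next
    case False
    then obtain B'' where B'': "red n a B = Some (v, B'')" "B' = w # B''"
      using Cons.prems by (auto split: option.splits)
    note IH = Cons.IH[OF B''(1)]
    have "dot n a w = 0" using False bit_cases by blast
    moreover have "pts p (w # B) = pts p B' \<union> pts (p + v) B'" for p
      using IH by (simp add: B'' add.assoc add.commute[of v w]) blast
    ultimately show ?thesis using IH B'' by simp
  qed
qed simp

lemma pts_dot: "\<forall>w\<in>set B. dot n a w = 0 \<Longrightarrow> x \<in> pts p B \<Longrightarrow> dot n a x = dot n a p"
  by (induction B arbitrary: p) (auto simp: dot_add)

text \<open>\<open>red\<close> cuts the space into two halves that differ by the pivot. The
  functional is constant on each half and takes different values on the two, so the equation selects
  exactly one of them; without a pivot it is all or nothing.\<close>

lemma addeq_pts: "rep_pts (addeq n a b S) = {x \<in> rep_pts S. dot n a x = b}"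
proof (cases S)
  case (Some q)
  obtain p B where S: "S = Some (p, B)" using Some by (cases q) auto
  show ?thesis
  proof (cases "red n a B")
    case None
    then show ?thesis using pts_dot[OF red_None[OF None]]
      by (auto simp: S addeq_def)
  next
    case (Some r)
    obtain v B' where r: "red n a B = Some (v, B')" using Some by (cases r) auto
    from red_Some[OF r] have v: "dot n a v = 1" and B': "\<forall>w\<in>set B'. dot n a w = 0"
      and p: "pts p B = pts p B' \<union> pts (p + v) B'" by auto
    have "dot n a (p + v) = b \<longleftrightarrow> dot n a p \<noteq> b"
      using bit_cases[of "dot n a p"] bit_cases[of b] by (auto simp: dot_add v)
    then show ?thesis
      using pts_dot[OF B'] by (auto simp: S addeq_def r p)
  qed
qed (simp add: addeq_def)

section \<open>Independence and dimension by counting points\<close>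

lemma card_pts_le: "card (pts p B) \<le> 2 ^ length B" and finite_pts: "finite (pts p B)"
proof (induction B arbitrary: p)
  case (Cons v B)
  { case 1 show ?case using card_Un_le[of "pts p B" "pts (p + v) B"] Cons.IH(1)[of p] Cons.IH(1)[of "p + v"] by simp }
  { case 2 show ?case using Cons.IH(2) by simp }
qed simp_all

text \<open>Linear independence as a count: different coefficients give different points. In this
  form it passes to both halves of a cut, and it leads directly to the dimension.\<close>

definition indep :: "rep \<Rightarrow> bool" where
  "indep S \<longleftrightarrow> (case S of None \<Rightarrow> True | Some (p, B) \<Rightarrow> card (pts p B) = 2 ^ length B)"

text \<open>The two halves cover all points and neither can contain more than half of the maximal
  number, so both are full.\<close>

lemma indep_addeq:
  assumes "indep S"
  shows "indep (addeq n a b S)"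
proof (cases S)
  case (Some q)
  obtain p B where S: "S = Some (p, B)" using Some by (cases q) auto
  show ?thesis
  proof (cases "red n a B")
    case None
    then show ?thesis using assms by (simp add: S addeq_def indep_def)
  next
    case (Some r)
    obtain v B' where r: "red n a B = Some (v, B')" using Some by (cases r) auto
    have "card (pts p B) \<le> card (pts p B') + card (pts (p + v) B')"
      using red_Some[OF r] card_Un_le[of "pts p B'" "pts (p + v) B'"] by simp
    moreover have "card (pts p B) = 2 * 2 ^ length B'"
      using assms length_red[OF r] by (simp add: S indep_def)
    ultimately have "card (pts p B') = 2 ^ length B'" "card (pts (p + v) B') = 2 ^ length B'"
      using card_pts_le[of p B'] card_pts_le[of "p + v" B'] by simp_all
    then show ?thesis by (simp add: S addeq_def indep_def r)
  qed
qed (simp add: addeq_def indep_def)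

lemma indep_addeqs: "indep S \<Longrightarrow> indep (addeqs n E S)"
  by (induction E arbitrary: S) (simp_all add: indep_addeq)

lemma addeqs_pts: "rep_pts (addeqs n E S) = {x \<in> rep_pts S. checkeqs n E x}"
  by (induction E arbitrary: S) (auto simp: addeq_pts)

lemma pts_snoc: "pts p (B @ [v]) = pts p B \<union> pts (p + v) B"
  by (induction B arbitrary: p) (auto simp: ac_simps)

lemma pts_units: "pts p (map unit [0..<n]) = {x. \<forall>i\<ge>n. x i = p i}"
proof (induction n arbitrary: p)
  case 0
  show ?case by auto
next
  case (Suc n)
  have "pts p (map unit [0..<Suc n]) = {x. \<forall>i\<ge>n. x i = p i} \<union> {x. \<forall>i\<ge>n. x i = (p + unit n) i}"
    by (simp add: pts_snoc Suc.IH del: upt_Suc add: upt_Suc_append)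
  also have "\<dots> = {x. \<forall>i\<ge>Suc n. x i = p i}"
  proof (intro equalityI subsetI)
    fix x assume "x \<in> {x. \<forall>i\<ge>Suc n. x i = p i}"
    moreover have "x n = p n \<or> x n = p n + 1"
      using bit_cases[of "x n"] bit_cases[of "p n"] by auto
    ultimately show "x \<in> {x. \<forall>i\<ge>n. x i = p i} \<union> {x. \<forall>i\<ge>n. x i = (p + unit n) i}"
      by (auto simp: unit_def plus_fun_apply le_eq_less_or_eq[of n] Suc_le_eq)
  qed (auto simp: unit_def plus_fun_apply)
  finally show ?case .
qed

lemma pts_units_F2_space: "pts (\<lambda>_. 0) (map unit [0..<n]) = F2_space n"
  by (simp add: pts_units F2_space_def)

lemma bij_F2_space: "bij_betw (\<lambda>x. {i. x i = 1}) (F2_space n) (Pow {..<n})"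
proof (rule bij_betwI[where g = "\<lambda>K i. if i \<in> K then 1 else 0"])
  show "(\<lambda>i. if i \<in> {i. x i = 1} then 1 else 0) = x" for x :: vec
    using bit_cases by (intro ext) auto
qed (force simp: F2_space_def not_le[symmetric])+

lemma finite_F2_space [simp]: "finite (F2_space n)"
  using bij_betw_finite[OF bij_F2_space] by simp

lemma card_F2_space: "card (F2_space n) = 2 ^ n"
  using bij_betw_same_card[OF bij_F2_space, of n] by (simp add: card_Pow)

lemma indep_prep: "indep (prep I)"
  unfolding prep_def by (rule indep_addeqs) (simp add: indep_def pts_units_F2_space card_F2_space)

lemma affine_part_eq: "affine_part I = {x \<in> F2_space (nvars I). checkeqs (nvars I) (equations I) x}"
  by (auto simp: affine_part_def checkeqs_def dot_def)

lemma prep_pts: "rep_pts (prep I) = affine_part I"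
  by (simp add: prep_def addeqs_pts pts_units_F2_space affine_part_eq)

text \<open>Each equation survives because b + b + b = b: this is affine closure over the
  two-element field.\<close>

lemma affine_part_triple:
  "x \<in> affine_part I \<Longrightarrow> y \<in> affine_part I \<Longrightarrow> z \<in> affine_part I \<Longrightarrow> x + y + z \<in> affine_part I"
  by (simp add: affine_part_eq F2_space_def checkeqs_def dot_add plus_fun_apply) (simp add: add.assoc[symmetric])?

text \<open>The only scalars are 0 and 1, so a new basis vector adds one disjoint translate and
  doubles the span.\<close>

lemma card_span_independent:
  assumes "finite b" "F2.independent b"
  shows "finite (F2.span b) \<and> card (F2.span b) = 2 ^ card b"
  using assms
proof (induction b rule: finite_induct)
  case (insert v b)
  then have v: "v \<notin> F2.span b" and ind: "F2.independent b"
    by (auto simp: F2.independent_insert split: if_splits)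
  have sc: "F2_scale 0 v = 0" "F2_scale 1 v = v" by (auto simp: F2_scale_def)
  have eq: "F2.span (insert v b) = F2.span b \<union> (\<lambda>x. x + v) ` F2.span b"
  proof (intro equalityI subsetI)
    fix x assume "x \<in> F2.span (insert v b)"
    then obtain k where k: "x - F2_scale k v \<in> F2.span b" by (auto simp: F2.span_insert)
    from bit_cases[of k] show "x \<in> F2.span b \<union> (\<lambda>x. x + v) ` F2.span b"
    proof
      assume "k = 1"
      then have "x - v \<in> F2.span b" using k by (simp add: sc)
      then have "x - v + v \<in> (\<lambda>x. x + v) ` F2.span b" by (rule imageI)
      then show ?thesis by simp
    qed (use k in \<open>simp add: sc\<close>)
  next
    fix x assume "x \<in> F2.span b \<union> (\<lambda>x. x + v) ` F2.span b"
    then have "x - F2_scale 0 v \<in> F2.span b \<or> x - F2_scale 1 v \<in> F2.span b"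
      by (auto simp: sc)
    then show "x \<in> F2.span (insert v b)" unfolding F2.span_insert by blast
  qed
  have disj: "F2.span b \<inter> (\<lambda>x. x + v) ` F2.span b = {}"
  proof -
    have "x + v \<notin> F2.span b" if "x \<in> F2.span b" for x
      using F2.span_diff[of "x + v" b x] that v by auto
    then show ?thesis by auto
  qed
  have "inj_on (\<lambda>x. x + v) (F2.span b)" by (auto simp: inj_on_def)
  then show ?case
    using insert.IH[OF ind] insert.hyps unfolding eq
    by (simp add: card_Un_disjoint[OF _ _ disj] card_image)
qed simp

lemma card_subspace:
  assumes "F2.subspace V" "finite V"
  shows "card V = 2 ^ F2.dim V"
proof -
  obtain b where b: "b \<subseteq> V" "F2.independent b" "V \<subseteq> F2.span b" "card b = F2.dim V"
    by (rule F2.basis_exists)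
  then have "F2.span b = V" using assms(1) F2.span_minimal by blast
  then show ?thesis
    using card_span_independent[of b] b assms(2) finite_subset by auto
qed

text \<open>The direction space is a translate of the affine part, so the two have equally many
  points, and the exponents of 2 agree.\<close>

lemma dim_A_eq:
  assumes "prep I = Some (p, B)"
  shows "dim_A I = length B"
proof -
  define A where "A = affine_part I"
  define V where "V = {x - y | x y. x \<in> A \<and> y \<in> A}"
  have A: "A = pts p B" using prep_pts[of I] assms by (simp add: A_def)
  have card: "card A = 2 ^ length B" using indep_prep[of I] assms by (simp add: A indep_def)
  then have "A \<noteq> {}" by auto
  then obtain q where q: "q \<in> A" by blast
  have V: "V = (\<lambda>x. x + q) ` A"
  proof (intro equalityI subsetI)
    fix z assume "z \<in> V"
    then obtain x y where xy: "z = x + y" "x \<in> A" "y \<in> A" by (auto simp: V_def vec_minus)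
    then have "x + y + q \<in> A" using affine_part_triple q unfolding A_def by blast
    then have "x + y + q + q \<in> (\<lambda>x. x + q) ` A" by (rule imageI)
    then show "z \<in> (\<lambda>x. x + q) ` A" by (simp add: xy add.assoc)
  qed (use q in \<open>auto simp: V_def vec_minus\<close>)
  have "F2.subspace V"
  proof (rule F2.subspaceI)
    show "0 \<in> V" using q by (force simp: V_def)
    show "x + y \<in> V" if "x \<in> V" "y \<in> V" for x y
    proof -
      obtain x' y' where "x = x' + q" "y = y' + q" "x' \<in> A" "y' \<in> A"
        using \<open>x \<in> V\<close> \<open>y \<in> V\<close> unfolding V image_iff by blast
      moreover from this have "x' + y' + q \<in> A" using affine_part_triple q unfolding A_def by blast
      ultimately show ?thesis unfolding V
        by (auto simp: ac_simps intro!: image_eqI[of _ _ "x' + y' + q"])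
    qed
    show "F2_scale c x \<in> V" if "x \<in> V" for c x
    proof -
      have "F2_scale 0 x = 0" "F2_scale 1 x = x" by (auto simp: F2_scale_def)
      then show ?thesis using bit_cases[of c] that \<open>0 \<in> V\<close> by auto
    qed
  qed
  moreover have "finite V" unfolding V A by (simp add: finite_pts)
  ultimately have "card V = 2 ^ F2.dim V" by (rule card_subspace)
  moreover have "card V = card A" unfolding V by (rule card_image) (auto simp: inj_on_def)
  ultimately have "(2::nat) ^ F2.dim V = 2 ^ length B" using card by simp
  then show ?thesis by (simp add: dim_A_def V_def A_def)
qed

section \<open>Correctness of the deterministic algorithm\<close>

lemma satall_iff_satisfies: "satisfies z F \<longleftrightarrow> satall z F"
  by (simp add: satisfies_def satall_def satc_def case_prod_unfold)

section \<open>Majority and propagation\<close>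

definition maj :: "vec \<Rightarrow> vec \<Rightarrow> vec \<Rightarrow> vec" where
  "maj x y z = (\<lambda>i. if x i = y i then x i else z i)"

lemma clause_cases:
  assumes "length C \<le> 2"
  obtains "C = []" | l where "C = [l]" | l l' where "C = [l, l']"
  using assms by (cases C rule: remdups_adj.cases) (auto simp: le_Suc_eq numeral_2_eq_2)

text \<open>Two of three satisfying assignments satisfy the clause by the same literal, and the
  majority agrees with them there. This closure property of 2-CNF is the source of the lattice
  below.\<close>

lemma satc_maj:
  assumes "length C \<le> 2" "satc x C" "satc y C" "satc z C"
  shows "satc (maj x y z) C"
  using assms(1)
proof (cases rule: clause_cases)
  case (3 l l')
  have "a = b \<or> a = c \<or> b = c" for a b c :: bit
    using bit_cases by metis
  then show ?thesis using assms by (auto simp: 3 maj_def)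
qed (use assms in \<open>auto simp: maj_def\<close>)

lemma satall_maj:
  "\<forall>C\<in>set F. length C \<le> 2 \<Longrightarrow> satall x F \<Longrightarrow> satall y F \<Longrightarrow> satall z F \<Longrightarrow> satall (maj x y z) F"
  by (auto simp: satall_def satc_maj)

text \<open>Every flip from \<open>y\<close> to \<open>z\<close> is also a flip from
  \<open>y\<close> to \<open>x\<close>: the invariant of propagation towards a solution
  \<open>x\<close>.\<close>

definition between :: "vec \<Rightarrow> vec \<Rightarrow> vec \<Rightarrow> bool" where
  "between y z x \<longleftrightarrow> (\<forall>i. z i = y i \<or> z i = x i)"

lemma bit_neq: "(a :: bit) \<noteq> b \<Longrightarrow> c \<noteq> b \<Longrightarrow> a = c"
  using bit_cases[of a] bit_cases[of b] bit_cases[of c] by auto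

lemma flip_eq: "(z + unit i) j = (if j = i then z i + 1 else z j)"
  by (simp add: unit_def plus_fun_apply)

lemma between_flip: "between y z x \<Longrightarrow> z i = y i \<Longrightarrow> x i \<noteq> y i \<Longrightarrow> between y (z + unit i) x"
  using bit_neq[of "z i + 1" "y i" "x i"] bit_cases[of "y i"] by (auto simp: between_def flip_eq)

text \<open>A clause that \<open>y\<close> satisfies and \<open>z\<close> violates has a flipped literal; if \<open>x\<close> satisfies it, then
  its other literal is not yet flipped and must be.\<close>

lemma fixl_flips:
  assumes "length C \<le> 2" "satc y C" "satc x C" "\<not> satc z C" "between y z x"
  shows "\<exists>l\<in>set C. z (fst l) = y (fst l) \<and> x (fst l) \<noteq> y (fst l) \<and> fixl C y z = z + unit (fst l)"
  using assms(1)
proof (cases rule: clause_cases)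
  case 1
  then show ?thesis using assms by simp
next
  case (2 l)
  have "z (fst l) = y (fst l) \<or> z (fst l) = x (fst l)" using assms(5) by (simp add: between_def)
  then show ?thesis using assms by (simp add: 2)
next
  case (3 l l')
  have "z (fst l) = y (fst l) \<or> z (fst l) = x (fst l)" "z (fst l') = y (fst l') \<or> z (fst l') = x (fst l')"
    using assms(5) by (simp_all add: between_def)
  then show ?thesis using assms(2-4) by (auto simp: 3 dest: bit_neq)
qed

lemma pass_spec:
  assumes "\<forall>C\<in>set F. length C \<le> 2" "satall y F" "satall x F" "between y z x"
  shows "between y (pass F y z) x \<and> (\<forall>i. z i \<noteq> y i \<longrightarrow> pass F y z i \<noteq> y i) \<and>
    (\<not> satall z F \<longrightarrow> (\<exists>i. z i = y i \<and> pass F y z i \<noteq> y i))"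
  using assms
proof (induction F arbitrary: z)
  case (Cons C F)
  show ?case
  proof (cases "satc z C")
    case True
    then show ?thesis using Cons by simp
  next
    case False
    from fixl_flips[OF _ _ _ False, of y x] Cons.prems obtain l
      where l: "z (fst l) = y (fst l)" "x (fst l) \<noteq> y (fst l)" "fixl C y z = z + unit (fst l)"
      by auto
    define z' where "z' = z + unit (fst l)"
    have pass: "pass (C # F) y z = pass F y z'" using False l by (simp add: z'_def)
    have "between y z' x" unfolding z'_def using between_flip Cons.prems(4) l by blast
    then have IH: "between y (pass F y z') x" "\<forall>i. z' i \<noteq> y i \<longrightarrow> pass F y z' i \<noteq> y i"
      using Cons by simp_all
    have z': "z' (fst l) \<noteq> y (fst l)" "\<forall>i. z i \<noteq> y i \<longrightarrow> z' i \<noteq> y i"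
      using l(1) bit_cases[of "y (fst l)"] by (auto simp: z'_def flip_eq)
    show ?thesis unfolding pass using IH z' l(1) by blast
  qed
qed simp

lemma pass_satall: "satall z F \<Longrightarrow> pass F y z = z"
  by (induction F) simp_all

lemma passes_satall: "satall z F \<Longrightarrow> passes k F y z = z"
  by (induction k) (simp_all add: pass_satall)

text \<open>The number of flipped variables is a potential: a round that starts with a violated
  clause raises it by at least one.\<close>

lemma passes_spec:
  assumes F: "\<forall>C\<in>set F. length C \<le> 2" "satall y F" "satall x F" and z: "between y z x"
    and D: "\<forall>i. x i \<noteq> y i \<longrightarrow> i < n"
  shows "between y (passes k F y z) x \<and> (\<forall>i. z i \<noteq> y i \<longrightarrow> passes k F y z i \<noteq> y i) \<and>
    (satall (passes k F y z) F \<or> card {i. z i \<noteq> y i} + k \<le> card {i. passes k F y z i \<noteq> y i})"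
  using z
proof (induction k arbitrary: z)
  case (Suc k)
  show ?case
  proof (cases "satall z F")
    case True
    then show ?thesis using Suc.prems passes_satall[OF True, of "Suc k" y] by auto
  next
    case False
    note pass = pass_spec[OF F Suc.prems]
    note IH = Suc.IH[of "pass F y z"]
    have "{i. pass F y z i \<noteq> y i} \<subseteq> {..<n}"
      using pass D by (auto simp: between_def; metis)
    then have "finite {i. pass F y z i \<noteq> y i}" by (rule finite_subset) simp
    moreover have "{i. z i \<noteq> y i} \<subset> {i. pass F y z i \<noteq> y i}"
      using pass False by blast
    ultimately have "card {i. z i \<noteq> y i} < card {i. pass F y z i \<noteq> y i}"
      by (rule psubset_card_mono)
    then show ?thesis using IH pass by auto
  qed
qed simp

lemma passes_reach:
  assumes F: "\<forall>C\<in>set F. length C \<le> 2" "satall y F" "satall x F" and z: "between y z x"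
    and D: "\<forall>i. x i \<noteq> y i \<longrightarrow> i < n"
  shows "satall (passes n F y z) F" "between y (passes n F y z) x"
    "\<And>i. z i \<noteq> y i \<Longrightarrow> passes n F y z i \<noteq> y i"
proof -
  let ?z = "passes n F y z"
  note spec = passes_spec[OF F z D, of n]
  show b: "between y ?z x" "\<And>i. z i \<noteq> y i \<Longrightarrow> ?z i \<noteq> y i" using spec by blast+
  show "satall ?z F"
  proof (rule ccontr)
    assume "\<not> satall ?z F"
    \<comment> \<open>After \<open>n\<close> rounds without success all \<open>n\<close> variables
      are flipped. Then \<open>x\<close> differs from \<open>y\<close> exactly on the flipped ones,
      so \<open>x\<close> has been reached, and it satisfies \<open>F\<close>.\<close>
    then have n: "n \<le> card {i. ?z i \<noteq> y i}" using spec by linarith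
    have sub: "{i. ?z i \<noteq> y i} \<subseteq> {i. x i \<noteq> y i}"
      using b(1) by (auto simp: between_def; metis)
    have "{i. x i \<noteq> y i} \<subseteq> {..<n}" using D by auto
    then have "{i. ?z i \<noteq> y i} \<subseteq> {..<n}" "card {i. x i \<noteq> y i} \<le> n" "finite {i. x i \<noteq> y i}"
      using sub card_mono[of "{..<n}"] finite_subset[of _ "{..<n}"] by auto
    then have "{i. ?z i \<noteq> y i} = {i. x i \<noteq> y i}"
      using sub n card_mono[of "{i. x i \<noteq> y i}" "{i. ?z i \<noteq> y i}"] by (intro card_subset_eq) simp_all
    then have "?z i \<noteq> y i \<longleftrightarrow> x i \<noteq> y i" for i by (simp add: set_eq_iff)
    then have "?z i = x i" for i
      using bit_neq[of "?z i" "y i" "x i"] by fastforce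
    then have "?z = x" by (rule ext)
    then show False using \<open>\<not> satall ?z F\<close> F(3) by simp
  qed
qed

lemma fixl_F2_space: "\<forall>l\<in>set C. fst l < n \<Longrightarrow> z \<in> F2_space n \<Longrightarrow> fixl C y z \<in> F2_space n"
  by (induction C) (auto simp: F2_space_def flip_eq)

lemma passes_F2_space:
  assumes "\<forall>C\<in>set F. wf_clause n C" "z \<in> F2_space n"
  shows "passes k F y z \<in> F2_space n"
proof -
  have pass: "pass G y z \<in> F2_space n" if "\<forall>C\<in>set G. wf_clause n C" "z \<in> F2_space n" for G z
    using that by (induction G arbitrary: z) (auto simp: wf_clause_def fixl_F2_space)
  show ?thesis
    using assms(2) by (induction k arbitrary: z) (simp_all add: pass assms(1))
qed

lemma wf_length: "\<forall>C\<in>set F. wf_clause n C \<Longrightarrow> \<forall>C\<in>set F. length C \<le> 2"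
  by (simp add: wf_clause_def)

lemma flip_F2_space: "i < n \<Longrightarrow> y \<in> F2_space n \<Longrightarrow> y + unit i \<in> F2_space n"
  by (simp add: F2_space_def flip_eq)

section \<open>Correctness of incremental 2-SAT\<close>

lemma tryl_Some:
  "tryl n C F D y = Some z \<Longrightarrow> \<forall>l\<in>set C. fst l < n \<Longrightarrow> \<forall>C\<in>set F. wf_clause n C \<Longrightarrow> y \<in> F2_space n \<Longrightarrow>
    satall z D \<and> z \<in> F2_space n"
  by (induction C) (auto simp: Let_def passes_F2_space flip_F2_space split: if_splits)

text \<open>A solution \<open>x\<close> satisfies the new clause by some literal, which is false
  under \<open>y\<close>. Propagation from the flip of that literal stays between \<open>y\<close>
  and \<open>x\<close> and never undoes the flip, so in the end the new clause holds together with
  the old ones.\<close>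

lemma tryl_complete:
  assumes F: "\<forall>C\<in>set (C # F). wf_clause n C" "satall y F" "y \<in> F2_space n" "\<not> satc y C"
    and x: "x \<in> F2_space n" "satall x (C # F)"
  shows "tryl n C F (C # F) y \<noteq> None"
proof -
  obtain l where l: "l \<in> set C" "x (fst l) = snd l" using x by (auto simp: satc_def)
  then have y: "y (fst l) \<noteq> snd l" using F(4) by (auto simp: satc_def)
  let ?z = "passes n F y (y + unit (fst l))"
  have b: "between y (y + unit (fst l)) x"
    using y l(2) by (intro between_flip) (auto simp: between_def)
  have D: "\<forall>i. x i \<noteq> y i \<longrightarrow> i < n"
    using x(1) F(3) by (auto simp: F2_space_def not_le[symmetric])
  have F': "\<forall>C\<in>set F. length C \<le> 2" "satall x F" using F(1) x(2) by (simp_all add: wf_clause_def)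
  note reach = passes_reach[OF F'(1) F(2) F'(2) b D]
  have "?z (fst l) \<noteq> y (fst l)"
    using bit_cases[of "y (fst l)"] by (intro reach(3)) (auto simp: flip_eq)
  then have "?z (fst l) = snd l" using y bit_neq by metis
  then have "satall ?z (C # F)" using reach(1) l(1) by (auto simp: satc_def)
  then have "tryl n C' F (C # F) y \<noteq> None" if "l \<in> set C'" for C'
    using that by (induction C') (auto simp: Let_def)
  then show ?thesis using l(1) by blast
qed

lemma twosat_Some:
  "twosat n R F y = Some z \<Longrightarrow> \<forall>C\<in>set R. wf_clause n C \<Longrightarrow> \<forall>C\<in>set F. wf_clause n C \<Longrightarrow> y \<in> F2_space n \<Longrightarrow>
    satall y F \<Longrightarrow> satall z R \<and> satall z F \<and> z \<in> F2_space n"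
proof (induction R arbitrary: F y)
  case (Cons C R)
  show ?case
  proof (cases "satc y C")
    case True
    then show ?thesis using Cons.IH[of "C # F" y] Cons.prems by simp
  next
    case False
    then obtain y' where y': "tryl n C F (C # F) y = Some y'" "twosat n R (C # F) y' = Some z"
      using Cons.prems(1) by (auto split: option.splits)
    have "satall y' (C # F) \<and> y' \<in> F2_space n"
      using tryl_Some[OF y'(1)] Cons.prems by (simp add: wf_clause_def)
    then show ?thesis using Cons.IH[OF y'(2)] Cons.prems by simp
  qed
qed simp

lemma twosat_None:
  "twosat n R F y = None \<Longrightarrow> \<forall>C\<in>set R. wf_clause n C \<Longrightarrow> \<forall>C\<in>set F. wf_clause n C \<Longrightarrow> y \<in> F2_space n \<Longrightarrow>
    satall y F \<Longrightarrow> x \<in> F2_space n \<Longrightarrow> satall x R \<Longrightarrow> \<not> satall x F"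
proof (induction R arbitrary: F y)
  case (Cons C R)
  show ?case
  proof (cases "satc y C")
    case True
    then show ?thesis using Cons.IH[of "C # F" y] Cons.prems by simp
  next
    case False
    show ?thesis
    proof
      assume x: "satall x F"
      have "tryl n C F (C # F) y \<noteq> None"
        using Cons.prems False x by (intro tryl_complete[of C F n y x]) auto
      then obtain y' where y': "tryl n C F (C # F) y = Some y'" "twosat n R (C # F) y' = None"
        using Cons.prems(1) False by (auto split: option.splits)
      have "satall y' (C # F) \<and> y' \<in> F2_space n"
        using tryl_Some[OF y'(1)] Cons.prems by (simp add: wf_clause_def)
      then show False using Cons.IH[OF y'(2)] Cons.prems x by simp
    qed
  qed
qed simp

section \<open>Correctness of the search, and small generating sets\<close>

lemma attempt_Some: "attempt n F E y z0 = Some z \<Longrightarrow> \<forall>C\<in>set F. wf_clause n C \<Longrightarrow> z0 \<in> F2_space n \<Longrightarrow>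
    satall z F \<and> checkeqs n E z \<and> z \<in> F2_space n"
  by (auto simp: attempt_def Let_def passes_F2_space split: if_splits)

lemma vec_of_F2_space: "length xs \<le> n \<Longrightarrow> vec_of xs \<in> F2_space n"
  by (simp add: vec_of_def F2_space_def)

lemma search_Some: "search n F E y w t acc = Some z \<Longrightarrow> \<forall>C\<in>set F. wf_clause n C \<Longrightarrow> length acc + length w = n \<Longrightarrow>
    satall z F \<and> checkeqs n E z \<and> z \<in> F2_space n"
  by (induction w arbitrary: t acc) (auto simp: vec_of_F2_space dest!: attempt_Some split: option.splits if_splits)

text \<open>The branch that follows \<open>z\<close> spends one unit of the budget on each variable
  where \<open>z\<close> and \<open>y\<close> differ.\<close>

lemma search_None:
  "search n F E y (map y is) t acc = None \<Longrightarrow> length (filter (\<lambda>i. z i \<noteq> y i) is) \<le> t \<Longrightarrow>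
    attempt n F E y (vec_of (rev (map z is) @ acc)) = None"
proof (induction "is" arbitrary: t acc)
  case (Cons i "is")
  show ?case
  proof (cases "z i = y i")
    case True
    then show ?thesis using Cons.IH[of t "y i # acc"] Cons.prems by (auto split: option.splits)
  next
    case False
    then have "z i = y i + 1" using bit_neq[of "z i" "y i" "y i + 1"] bit_cases[of "y i"] by auto
    then show ?thesis using Cons.IH[of "t - 1" "(y i + 1) # acc"] Cons.prems False
      by (auto split: option.splits if_splits)
  qed
qed simp

lemma det_Some:
  assumes "det n F E B = Some z" "\<forall>C\<in>set F. wf_clause n C"
  shows "satall z F \<and> checkeqs n E z \<and> z \<in> F2_space n"
  using assms by (auto simp: det_def search_Some split: option.splits)

text \<open>The sets \<open>W s\<close> are the complements in \<open>X\<close> of the largest members of the lattice \<open>L\<close> that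
  avoid \<open>s\<close>. They are disjoint for a generating set \<open>S\<close> of least size: an element of
  \<open>W s \<inter> W s'\<close> could replace both \<open>s\<close> and \<open>s'\<close>.\<close>

lemma lattice_generators:
  fixes L :: "'a set set"
  assumes X: "finite X" "X \<in> L" "{} \<in> L" "\<And>Z. Z \<in> L \<Longrightarrow> Z \<subseteq> X"
    and L: "\<And>Z Z'. Z \<in> L \<Longrightarrow> Z' \<in> L \<Longrightarrow> Z \<union> Z' \<in> L" "\<And>Z Z'. Z \<in> L \<Longrightarrow> Z' \<in> L \<Longrightarrow> Z \<inter> Z' \<in> L"
  obtains S W where "S \<subseteq> X" "\<And>Z. Z \<in> L \<Longrightarrow> S \<subseteq> Z \<Longrightarrow> Z = X"
    "\<And>s. s \<in> S \<Longrightarrow> s \<in> W s \<and> W s \<subseteq> X"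
    "\<And>s s'. s \<in> S \<Longrightarrow> s' \<in> S \<Longrightarrow> s \<noteq> s' \<Longrightarrow> W s \<inter> W s' = {}"
    "\<And>J. J \<subseteq> S \<Longrightarrow> X - \<Union>(W ` J) \<in> L"
proof -
  define gen where "gen S \<longleftrightarrow> S \<subseteq> X \<and> (\<forall>Z\<in>L. S \<subseteq> Z \<longrightarrow> Z = X)" for S
  have "gen X" using X by (auto simp: gen_def)
  then obtain S where S: "gen S" and min: "\<And>S'. gen S' \<Longrightarrow> card S \<le> card S'"
    using arg_min_natI[of gen X card] arg_min_nat_le[of gen _ card] by blast
  have finL: "finite L" using X by (intro finite_subset[of L "Pow X"]) auto
  define Zs where "Zs s = \<Union>{Z \<in> L. s \<notin> Z}" for s
  define W where "W s = X - Zs s" for s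
  have Un: "\<Union>K \<in> L" if "K \<subseteq> L" for K
  proof -
    have "finite K" using that finL by (rule finite_subset)
    then show ?thesis using that by (induction K) (auto simp: X(3) L(1))
  qed
  have Zs: "Zs s \<in> L" "s \<notin> Zs s" for s
    unfolding Zs_def by (rule Un) auto
  have "s \<in> W s \<and> W s \<subseteq> X" if "s \<in> S" for s
    using that S Zs(2) by (auto simp: W_def gen_def)
  moreover have "W s \<inter> W s' = {}" if s: "s \<in> S" "s' \<in> S" "s \<noteq> s'" for s s'
  proof (rule ccontr)
    assume "W s \<inter> W s' \<noteq> {}"
    then obtain u where u: "u \<in> X" "u \<notin> Zs s" "u \<notin> Zs s'" by (auto simp: W_def)
    define S' where "S' = insert u (S - {s, s'})"
    have "Z = X" if Z: "Z \<in> L" "S' \<subseteq> Z" for Z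
    proof -
      \<comment> \<open>A member of \<open>L\<close> that contains \<open>u\<close> but not
        \<open>s\<close> would be part of \<open>Zs s\<close>, which omits \<open>u\<close>;
        likewise for \<open>s'\<close>.\<close>
      have "s \<in> Z" "s' \<in> Z" using u Z by (auto simp: Zs_def S'_def)
      then have "S \<subseteq> Z" using Z by (auto simp: S'_def)
      then show ?thesis using S Z by (auto simp: gen_def)
    qed
    then have "gen S'" using S u by (auto simp: gen_def S'_def)
    have "finite S" using S X(1) by (auto simp: gen_def intro: finite_subset)
    then have "card S' \<le> Suc (card (S - {s, s'}))" by (simp add: S'_def card_insert_le_m1 card_insert_if)
    also have "card (S - {s, s'}) = card S - 2" using s \<open>finite S\<close> by (subst card_Diff_subset) auto
    also have "card S \<ge> card {s, s'}" using s \<open>finite S\<close> by (intro card_mono) auto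
    then have "Suc (card S - 2) < card S" using s by simp
    finally show False using min[OF \<open>gen S'\<close>] by simp
  qed
  moreover have "X - \<Union>(W ` J) \<in> L" if "J \<subseteq> S" for J
  proof -
    have "finite J" using that S X(1) by (auto simp: gen_def intro: finite_subset)
    then show ?thesis
    proof (induction J)
      case (insert s J)
      \<comment> \<open>Removing \<open>W s\<close> is the same as intersecting with the member
        \<open>Zs s\<close>.\<close>
      have "X - \<Union>(W ` insert s J) = Zs s \<inter> (X - \<Union>(W ` J))"
        using X(4)[OF Zs(1)] by (auto simp: W_def)
      then show ?case using insert L(2) Zs(1) by simp
    qed (simp add: X)
  qed
  ultimately show thesis using that[of S W] S by (auto simp: gen_def)
qed

definition flips :: "vec \<Rightarrow> nat set \<Rightarrow> vec" where
  "flips y K = (\<lambda>i. if i \<in> K then y i + 1 else y i)"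

lemma flips_empty [simp]: "flips y {} = y"
  by (simp add: flips_def)

lemma flips_diff: "flips y {i. x i \<noteq> y i} = x"
proof (rule ext)
  show "flips y {i. x i \<noteq> y i} i = x i" for i
    using bit_cases[of "x i"] bit_cases[of "y i"] by (auto simp: flips_def)
qed

text \<open>Flip \<open>y\<close> to a solution in the affine space \<open>A\<close> on a set \<open>X\<close> of
  least size. If \<open>X\<close> had more than \<open>n - r\<close> generators, then by the pigeonhole principle some
  nonempty union of the sets \<open>W s\<close> could be removed from \<open>X\<close> without leaving \<open>A\<close>.\<close>

lemma small_generators:
  assumes F: "\<forall>C\<in>set F. length C \<le> 2" "satall y F" "y \<in> F2_space n"
    and A: "A \<subseteq> F2_space n" "card A = 2 ^ r" "\<And>u v w. u \<in> A \<Longrightarrow> v \<in> A \<Longrightarrow> w \<in> A \<Longrightarrow> u + v + w \<in> A"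
    and x0: "x0 \<in> A" "satall x0 F"
  obtains x S where "x \<in> A" "satall x F" "S \<subseteq> {i. x i \<noteq> y i}" "card S \<le> n - r"
    "\<And>z. satall z F \<Longrightarrow> between y z x \<Longrightarrow> S \<subseteq> {i. z i \<noteq> y i} \<Longrightarrow> z = x"
proof -
  define good where "good X \<longleftrightarrow> flips y X \<in> A \<and> satall (flips y X) F" for X
  have fin: "K \<subseteq> {..<n}" if "flips y K \<in> A" for K
  proof
    fix i assume "i \<in> K"
    have "flips y K \<in> F2_space n" using that A(1) by blast
    then show "i \<in> {..<n}" using \<open>i \<in> K\<close> F(3) by (force simp: flips_def F2_space_def not_less[symmetric])
  qed
  have "good {i. x0 i \<noteq> y i}" using x0 by (simp add: good_def flips_diff)
  then obtain X where X: "good X" and min: "\<And>X'. good X' \<Longrightarrow> card X \<le> card X'"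
    using arg_min_natI[of good _ card] arg_min_nat_le[of good _ card] by blast
  have finX: "finite X" using fin[of X] X by (auto simp: good_def intro: finite_subset)
  define L where "L = {Z. Z \<subseteq> X \<and> satall (flips y Z) F}"
  \<comment> \<open>Meets are majorities with \<open>y\<close> as third argument, joins with the top
    solution \<open>flips y X\<close>.\<close>
  have cap: "flips y (Z \<inter> Z') = maj (flips y Z) (flips y Z') y" for Z Z'
    using bit_cases by (intro ext) (auto simp: flips_def maj_def)
  have cup: "flips y (Z \<union> Z') = maj (flips y Z) (flips y Z') (flips y X)" if "Z \<in> L" "Z' \<in> L" for Z Z'
    using that by (intro ext) (auto simp: flips_def maj_def L_def)
  have Un: "Z \<union> Z' \<in> L" if "Z \<in> L" "Z' \<in> L" for Z Z'
    using that satall_maj[OF F(1), of "flips y Z" "flips y Z'" "flips y X"] X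
    by (simp add: L_def cup[OF that, symmetric] good_def)
  have Int: "Z \<inter> Z' \<in> L" if "Z \<in> L" "Z' \<in> L" for Z Z'
    using that satall_maj[OF F(1), of "flips y Z" "flips y Z'" y] F(2)
    by (auto simp: L_def cap[symmetric])
  have L: "X \<in> L" "{} \<in> L" "\<And>Z. Z \<in> L \<Longrightarrow> Z \<subseteq> X"
    using X F(2) by (simp_all add: L_def good_def)
  obtain S W where S: "S \<subseteq> X" "\<And>Z. Z \<in> L \<Longrightarrow> S \<subseteq> Z \<Longrightarrow> Z = X"
    and W: "\<And>s. s \<in> S \<Longrightarrow> s \<in> W s \<and> W s \<subseteq> X"
      "\<And>s s'. s \<in> S \<Longrightarrow> s' \<in> S \<Longrightarrow> s \<noteq> s' \<Longrightarrow> W s \<inter> W s' = {}"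
      "\<And>J. J \<subseteq> S \<Longrightarrow> X - \<Union>(W ` J) \<in> L"
    by (rule lattice_generators[OF finX L Un Int]) blast+
  have finS: "finite S" using S(1) finX by (rule finite_subset)
  define x where "x = flips y X"
  define ind :: "nat set \<Rightarrow> vec" where "ind K = (\<lambda>i. if i \<in> K then 1 else 0)" for K
  define U where "U J = \<Union>(W ` J)" for J
  have UX: "U J \<subseteq> X" if "J \<subseteq> S" for J using W(1) that by (auto simp: U_def)
  have "card S \<le> n - r"
  proof (rule ccontr)
    assume "\<not> card S \<le> n - r"
    moreover have "r \<le> n"
    proof -
      have "card A \<le> card (F2_space n)" using A(1) by (intro card_mono) auto
      then show ?thesis by (simp add: A(2) card_F2_space)
    qed
    ultimately have big: "n < card S + r" by simp
    \<comment> \<open>A collision of this map writes the sum of two indicators as a sum of two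
      points of \<open>A\<close>, hence as a direction of \<open>A\<close>.\<close>
    let ?f = "\<lambda>(J, a). a + ind (U J)"
    have "?f ` (Pow S \<times> A) \<subseteq> F2_space n"
    proof clarify
      fix J a assume J: "J \<subseteq> S" and a: "a \<in> A"
      have "U J \<subseteq> {..<n}" using UX[OF J] fin[of X] X by (auto simp: good_def)
      then show "a + ind (U J) \<in> F2_space n"
        using a A(1) by (force simp: F2_space_def ind_def plus_fun_apply not_less[symmetric])
    qed
    then have "card (?f ` (Pow S \<times> A)) \<le> card (F2_space n)" by (intro card_mono) auto
    also have "\<dots> < 2 ^ (card S + r)" using big by (simp add: card_F2_space)
    also have "\<dots> = card (Pow S \<times> A)" using finS by (simp add: card_cartesian_product card_Pow A(2) power_add)
    finally have "\<not> inj_on ?f (Pow S \<times> A)" by (auto dest: card_image)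
    then obtain J a J' a' where J: "J \<subseteq> S" "J' \<subseteq> S" and a: "a \<in> A" "a' \<in> A"
      and eq: "a + ind (U J) = a' + ind (U J')" and ne: "(J, a) \<noteq> (J', a')"
      by (auto simp: inj_on_def)
    have "J \<noteq> J'" using eq ne by auto
    \<comment> \<open>The sets \<open>W s\<close> are disjoint, so the indicators of two unions add
      up to that of the union over the symmetric difference.\<close>
    define K where "K = (J - J') \<union> (J' - J)"
    have K: "K \<subseteq> S" "K \<noteq> {}" using J \<open>J \<noteq> J'\<close> by (auto simp: K_def)
    have indK: "ind (U K) = ind (U J) + ind (U J')"
    proof (rule ext)
      fix i
      have "i \<in> U K \<longleftrightarrow> (i \<in> U J) \<noteq> (i \<in> U J')"
      proof (cases "\<exists>s\<in>S. i \<in> W s")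
        case True
        then obtain s where s: "s \<in> S" "i \<in> W s" by blast
        then have *: "i \<in> U G \<longleftrightarrow> s \<in> G" if "G \<subseteq> S" for G
          using that W(2)[OF s(1)] by (fastforce simp: U_def)
        show ?thesis using *[OF K(1)] *[OF J(1)] *[OF J(2)] by (auto simp: K_def)
      next
        case False
        then show ?thesis using J K(1) by (auto simp: U_def)
      qed
      then show "ind (U K) i = (ind (U J) + ind (U J')) i" by (auto simp: ind_def plus_fun_apply)
    qed
    have "ind (U J) + ind (U J') = (a + ind (U J)) + (a + ind (U J'))"
      by (simp add: ac_simps)
    also have "\<dots> = a + a'" unfolding eq by (simp add: ac_simps)
    finally have aa: "ind (U K) = a + a'" using indK by simp
    \<comment> \<open>Undoing the flips in \<open>U K\<close> adds a direction of \<open>A\<close>,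
      so the result is a strictly smaller solution in \<open>A\<close>.\<close>
    have "flips y (X - U K) = x + ind (U K)"
      using UX[OF K(1)] by (intro ext) (auto simp: flips_def x_def ind_def plus_fun_apply)
    also have "\<dots> = x + a + a'" by (simp add: aa add.assoc)
    also have "\<dots> \<in> A" using A(3) a X by (simp add: good_def x_def)
    finally have "good (X - U K)" using W(3)[OF K(1)] by (simp add: good_def L_def U_def)
    then have "card X \<le> card (X - U K)" by (rule min)
    moreover obtain s where "s \<in> K" using K(2) by blast
    then have "s \<in> U K" "s \<in> X" using K(1) W(1) by (auto simp: U_def)
    then have "X - U K \<subset> X" by blast
    then have "card (X - U K) < card X" using finX by (rule psubset_card_mono[rotated])
    ultimately show False by simp
  qed
  moreover have "z = x" if z: "satall z F" "between y z x" "S \<subseteq> {i. z i \<noteq> y i}" for z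
  proof -
    have "z i = y i" if "i \<notin> X" for i
      using z(2) that by (auto simp: between_def x_def flips_def; metis)
    then have "{i. z i \<noteq> y i} \<in> L" using z(1) by (auto simp: L_def flips_diff)
    from S(2)[OF this z(3)] show ?thesis by (metis flips_diff x_def)
  qed
  moreover have "S \<subseteq> {i. x i \<noteq> y i}" using S(1) by (auto simp: x_def flips_def)
  ultimately show thesis using that[of x S] X by (simp add: good_def x_def)
qed

text \<open>One of the attempts starts from the flips of a small generating set \<open>S\<close>.
  Propagation from there ends in a solution between \<open>y\<close> and \<open>x\<close> that
  differs from \<open>y\<close> on all of \<open>S\<close>; the generating property leaves only
  \<open>x\<close> itself, which passes the equations.\<close>

lemma det_None:
  assumes F: "\<forall>C\<in>set F. wf_clause n C"
    and A: "A = {x \<in> F2_space n. checkeqs n E x}" "card A = 2 ^ length B"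
      "\<And>u v w. u \<in> A \<Longrightarrow> v \<in> A \<Longrightarrow> w \<in> A \<Longrightarrow> u + v + w \<in> A"
    and None: "det n F E B = None"
  shows "\<not> (x0 \<in> A \<and> satall x0 F)"
proof
  assume x0: "x0 \<in> A \<and> satall x0 F"
  have zero: "(\<lambda>_. 0) \<in> F2_space n" by (simp add: F2_space_def)
  have "twosat n F [] (\<lambda>_. 0) \<noteq> None"
    using twosat_None[of n F "[]" "\<lambda>_. 0" x0] F zero x0 A(1) by auto
  then obtain y where y: "twosat n F [] (\<lambda>_. 0) = Some y" by blast
  then have y': "satall y F" "y \<in> F2_space n" using twosat_Some[OF y F] zero by simp_all
  obtain x S where x: "x \<in> A" "satall x F" "S \<subseteq> {i. x i \<noteq> y i}" "card S \<le> n - length B"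
    and gen: "\<And>z. satall z F \<Longrightarrow> between y z x \<Longrightarrow> S \<subseteq> {i. z i \<noteq> y i} \<Longrightarrow> z = x"
    by (rule small_generators[OF wf_length[OF F] y' _ A(2,3), of x0]) (use A(1) x0 in auto)
  define z0 where "z0 = flips y S"
  have D: "\<forall>i. x i \<noteq> y i \<longrightarrow> i < n"
    using x(1) y'(2) A(1) by (auto simp: F2_space_def not_le[symmetric])
  have z0: "between y z0 x" "{i. z0 i \<noteq> y i} = S"
    using x(3) bit_cases by (auto simp: between_def z0_def flips_def intro: bit_neq)
  note reach = passes_reach[OF wf_length[OF F] y'(1) x(2) z0(1) D]
  have "passes n F y z0 = x" using z0(2) reach by (intro gen) auto
  then have "attempt n F E y z0 \<noteq> None" using x(1,2) A(1) by (simp add: attempt_def)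
  moreover have "attempt n F E y (vec_of (rev (map z0 (rev [0..<n])) @ [])) = None"
  proof (rule search_None)
    show "search n F E y (map y (rev [0..<n])) (n - length B) [] = None"
      using None y by (simp add: det_def rev_map)
    have "{i. i < n \<and> z0 i \<noteq> y i} \<subseteq> S" "finite S"
      using z0(2) x(3) D by (auto intro: finite_subset[of _ "{..<n}"])
    then have "card {i. i < n \<and> z0 i \<noteq> y i} \<le> card S" by (intro card_mono)
    moreover have "length (filter (\<lambda>i. z0 i \<noteq> y i) (rev [0..<n])) = card {i. i < n \<and> z0 i \<noteq> y i}"
      by (subst distinct_card[symmetric]) (auto intro!: arg_cong[where f = card])
    ultimately show "length (filter (\<lambda>i. z0 i \<noteq> y i) (rev [0..<n])) \<le> n - length B"
      using x(4) by simp
  qed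
  moreover have "vec_of (rev (map z0 (rev [0..<n])) @ []) = z0"
  proof -
    have "z0 i = 0" if "i \<ge> n" for i
      using that x(3) D y'(2) by (auto simp: z0_def flips_def F2_space_def)
    then show ?thesis by (auto simp: rev_map vec_of_def fun_eq_iff)
  qed
  ultimately show False by simp
qed

section \<open>Success probability of the randomized algorithm\<close>

lemma dot_add_left: "dot n (a + a') x = dot n a x + dot n a' x"
  unfolding dot_def plus_fun_def by (simp only: distrib_right sum.distrib)

lemma implied_pts: "implied n a b S \<Longrightarrow> x \<in> rep_pts S \<Longrightarrow> dot n a x = b"
proof -
  assume *: "implied n a b S" "x \<in> rep_pts S"
  then obtain p B where "S = Some (p, B)" "red n a B = None" "dot n a p = b"
    by (auto simp: implied_def split: option.splits)
  then show ?thesis using pts_dot[OF red_None] * by simp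
qed

text \<open>The hypothesis says that the truth values of the two literals add up to 1.\<close>

lemma parity_lit:
  assumes "(x :: bit) + x' = (if b = b' then 1 else 0)"
  shows "x = b \<or> x' = b'"
  using assms bit_cases[of x] bit_cases[of x'] bit_cases[of b] bit_cases[of b'] by auto

lemma step2_pts:
  assumes "fst l < n" "fst l' < n"
  shows "rep_pts (step2 n l l' c S) \<subseteq> {x \<in> rep_pts S. x (fst l) = snd l \<or> x (fst l') = snd l'}"
proof
  fix x assume x: "x \<in> rep_pts (step2 n l l' c S)"
  let ?u = "unit (fst l)" and ?u' = "unit (fst l')" and ?b = "if snd l = snd l' then 1 else 0 :: bit"
  have "x \<in> rep_pts S"
    using x by (auto simp: step2_def Let_def addeq_pts split: if_splits)
  moreover have "dot n ?u x = snd l \<or> dot n ?u' x = snd l' \<or> dot n (?u + ?u') x = ?b"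
    using x by (auto simp: step2_def Let_def addeq_pts split: if_splits dest: implied_pts)
  ultimately show "x \<in> {x \<in> rep_pts S. x (fst l) = snd l \<or> x (fst l') = snd l'}"
    using assms parity_lit[of "x (fst l)" "x (fst l')" "snd l" "snd l'"] by (auto simp: dot_add_left)
qed

lemma step_pts:
  assumes "wf_clause n C"
  shows "rep_pts (step n C c S) \<subseteq> {x \<in> rep_pts S. satc x C}"
proof (cases C)
  case (Cons l C')
  define l' where "l' = (case C' of [] \<Rightarrow> l | l' # _ \<Rightarrow> l')"
  have l': "l' \<in> set C" by (simp add: l'_def Cons split: list.split)
  have "rep_pts (step n C c S) \<subseteq> {x \<in> rep_pts S. x (fst l) = snd l \<or> x (fst l') = snd l'}"
    using step2_pts[of l n l' c S] assms l' by (auto simp: step_def Cons l'_def wf_clause_def)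
  then show ?thesis using l' by (auto simp: satc_def Cons)
qed (simp add: step_def)

lemma walk_pts:
  "\<forall>C\<in>set F. wf_clause n C \<Longrightarrow> rep_pts (walk n F cs S) \<subseteq> {x \<in> rep_pts S. satall x F}"
proof (induction n F cs S rule: walk.induct)
  case (3 n C F c cs S)
  then show ?case using step_pts[of n C c S] by fastforce
qed simp_all

lemma pts_self: "p \<in> pts p B"
  by (induction B arbitrary: p) auto

lemma prob_bind_ge:
  assumes "\<And>c. c \<in> G \<Longrightarrow> r \<le> measure (measure_pmf (f c)) A" "0 \<le> r" "q \<le> measure (measure_pmf p) G"
  shows "q * r \<le> measure (measure_pmf (bind_pmf p f)) A"
proof -
  have "ennreal (measure p G * r) = (\<integral>\<^sup>+c. ennreal r * indicator G c \<partial>measure_pmf p)"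
    using assms(2) by (simp add: nn_integral_cmult_indicator measure_pmf.emeasure_eq_measure ennreal_mult'[symmetric] mult.commute)
  also have "\<dots> \<le> (\<integral>\<^sup>+c. emeasure (measure_pmf (f c)) A \<partial>measure_pmf p)"
    using assms(1) by (intro nn_integral_mono)
      (auto simp: indicator_def measure_pmf.emeasure_eq_measure intro!: ennreal_leI)
  also have "\<dots> = ennreal (measure (measure_pmf (bind_pmf p f)) A)"
    by (simp add: measure_pmf.emeasure_eq_measure[symmetric] emeasure_bind_pmf)
  finally have "measure p G * r \<le> measure (measure_pmf (bind_pmf p f)) A"
    by simp
  then show ?thesis using mult_right_mono[OF assms(3,2)] by linarith
qed

lemma pmf_bind_coin:
  "pmf (bind_pmf (pmf_of_set (UNIV :: bool set)) f) c = (pmf (f True) c + pmf (f False) c) / 2"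
  by (simp add: pmf_bind integral_pmf_of_set UNIV_bool)

text \<open>Each option obeys p' = (p + 1) / 4, a contraction by 1/4 towards the fixed point
  1/3.\<close>

lemma pmf_chooseD:
  assumes "c \<in> {(0, 0), (0, 1), (1, 0)}"
  shows "pmf (chooseD k) c \<ge> (1 - (1 / 4) ^ k) / 3"
proof (induction k)
  case (Suc k)
  have "pmf (chooseD (Suc k)) c = (pmf (chooseD k) c + 1) / 4"
    using assms by (auto simp: pmf_bind_coin)
  then show ?case using Suc by simp
qed simp

lemma prob_chooseD:
  assumes "c1 \<noteq> c2" "{c1, c2} \<subseteq> {(0, 0), (0, 1), (1, 0)}" "{c1, c2} \<subseteq> G"
  shows "2 / 3 * (1 - (1 / 4) ^ k) \<le> measure (measure_pmf (chooseD k)) G"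
proof -
  have "2 / 3 * (1 - (1 / 4) ^ k) \<le> pmf (chooseD k) c1 + pmf (chooseD k) c2"
    using pmf_chooseD[of c1 k] pmf_chooseD[of c2 k] assms(2) by simp
  also have "\<dots> = measure (measure_pmf (chooseD k)) {c1, c2}"
    using assms(1) by (simp add: measure_measure_pmf_finite)
  also have "\<dots> \<le> measure (measure_pmf (chooseD k)) G"
    using assms(3) by (intro measure_pmf.finite_measure_mono) auto
  finally show ?thesis .
qed

text \<open>Without a pivot the equation is constant on the space, so it is implied or empties it;
  otherwise the pivot leaves the basis.\<close>

lemma length_addeq:
  assumes "addeq n a b (Some (p, B)) = Some (p', B')" "\<not> implied n a b (Some (p, B))"
  shows "length B = Suc (length B')"
  using assms length_red by (auto simp: addeq_def implied_def split: option.splits if_splits)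

text \<open>A solution satisfies exactly two of the three equations among which a step chooses.\<close>

lemma step_prob:
  assumes "wf_clause n C" "x \<in> pts p B" "satc x C" "step n C (0, 0) (Some (p, B)) \<noteq> Some (p, B)"
  shows "2 / 3 * (1 - (1 / 4) ^ k) \<le> measure (measure_pmf (chooseD k))
    {c. \<exists>p' B'. step n C c (Some (p, B)) = Some (p', B') \<and> x \<in> pts p' B' \<and> length B = Suc (length B')}"
    (is "_ \<le> measure _ ?G")
proof -
  obtain l C' where C: "C = l # C'" using assms(3) by (cases C) auto
  define l' where "l' = (case C' of [] \<Rightarrow> l | l' # _ \<Rightarrow> l')"
  have step: "step n C c S = step2 n l l' c S" for c S by (simp add: step_def C l'_def)
  have lt: "fst l < n" "fst l' < n"
    using assms(1) by (auto simp: C wf_clause_def l'_def split: list.split)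
  have "length C \<le> 2" using assms(1) by (simp add: wf_clause_def)
  then have lit: "x (fst l) = snd l \<or> x (fst l') = snd l'"
    using assms(3) by (cases rule: clause_cases) (auto simp: C l'_def)
  define u where "u = unit (fst l)"
  define u' where "u' = unit (fst l')"
  define b'' where "b'' = (if snd l = snd l' then 1 else 0 :: bit)"
  let ?S = "Some (p, B)"
  have dots: "dot n u x = x (fst l)" "dot n u' x = x (fst l')" "dot n (u + u') x = x (fst l) + x (fst l')"
    using lt by (simp_all add: u_def u'_def dot_add_left)
  \<comment> \<open>The change under the choice (0,0) is the test: an implied equation would make
    \<open>step\<close> ignore the choice and keep the space.\<close>
  have not: "\<not> implied n u (snd l) ?S" "\<not> implied n u' (snd l') ?S" "\<not> implied n (u + u') b'' ?S"
    using assms(4) by (auto simp: step step2_def Let_def u_def u'_def b''_def split: if_splits)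
  have step2: "step n C c ?S =
      (if fst c = 1 then addeq n u (snd l) ?S else if snd c = 1 then addeq n u' (snd l') ?S else addeq n (u + u') b'' ?S)" for c
    using not by (simp add: step step2_def Let_def u_def u'_def b''_def)
  have good: "\<exists>p' B'. addeq n a b ?S = Some (p', B') \<and> x \<in> pts p' B' \<and> length B = Suc (length B')"
    if "dot n a x = b" "\<not> implied n a b ?S" for a b
  proof -
    have "x \<in> rep_pts (addeq n a b ?S)" using that(1) assms(2) by (simp add: addeq_pts)
    then obtain p' B' where "addeq n a b ?S = Some (p', B')" "x \<in> pts p' B'"
      by (auto simp: rep_pts_def split: option.splits)
    then show ?thesis using length_addeq that(2) by blast
  qed
  have 1: "(1, 0) \<in> ?G" if "x (fst l) = snd l" using good[OF _ not(1)] that by (simp add: step2 dots)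
  have 2: "(0, 1) \<in> ?G" if "x (fst l') = snd l'" using good[OF _ not(2)] that by (simp add: step2 dots)
  have 3: "(0, 0) \<in> ?G" if "x (fst l) + x (fst l') = b''" using good[OF _ not(3)] that by (simp add: step2 dots)
  consider "x (fst l) = snd l" "x (fst l') = snd l'"
    | "x (fst l) = snd l" "x (fst l) + x (fst l') = b''"
    | "x (fst l') = snd l'" "x (fst l) + x (fst l') = b''"
    using lit bit_cases[of "x (fst l)"] bit_cases[of "x (fst l')"] bit_cases[of "snd l"] bit_cases[of "snd l'"]
    by (auto simp: b''_def)
  then show ?thesis
  proof cases
    case 1
    then show ?thesis using \<open>x (fst l) = snd l \<Longrightarrow> (1, 0) \<in> ?G\<close> 2
      by (intro prob_chooseD[of "(1, 0)" "(0, 1)"]) auto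
  next
    case 2
    then show ?thesis using \<open>x (fst l) = snd l \<Longrightarrow> (1, 0) \<in> ?G\<close> 3
      by (intro prob_chooseD[of "(1, 0)" "(0, 0)"]) auto
  next
    case 3
    then show ?thesis using \<open>x (fst l') = snd l' \<Longrightarrow> (0, 1) \<in> ?G\<close> \<open>_ \<Longrightarrow> (0, 0) \<in> ?G\<close>
      by (intro prob_chooseD[of "(0, 1)" "(0, 0)"]) auto
  qed
qed

text \<open>An equation that is not implied shortens the basis or empties the space. So an unchanged
  space means that one of the three equations is implied, and then the choice is ignored.\<close>

lemma step_fixed:
  assumes "step n C (0, 0) (Some (p, B)) = Some (p, B)" "C \<noteq> []"
  shows "step n C c (Some (p, B)) = Some (p, B)"
proof -
  obtain l C' where C: "C = l # C'" using assms(2) by (cases C) auto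
  define l' where "l' = (case C' of [] \<Rightarrow> l | l' # _ \<Rightarrow> l')"
  have step: "step n C c S = step2 n l l' c S" for c S by (simp add: step_def C l'_def)
  have "addeq n a b (Some (p, B)) = Some (p, B) \<Longrightarrow> implied n a b (Some (p, B))" for a b
    using length_addeq[of n a b p B p B] by auto
  then show ?thesis
    using assms(1) unfolding step step2_def Let_def by (auto split: if_splits)
qed

lemma walk_prob:
  assumes "\<forall>C\<in>set F. wf_clause n C" "x \<in> pts p B" "satall x F"
  shows "(2 / 3 * (1 - (1 / 4) ^ k)) ^ length B \<le>
    measure (measure_pmf (choicesD k (length F))) {cs. walk n F cs (Some (p, B)) \<noteq> None}"
  using assms
proof (induction F arbitrary: p B)
  case Nil
  define e where "e = (1 / 4 :: real) ^ k"
  have "0 \<le> e" "e \<le> 1" by (simp_all add: e_def power_le_one)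
  then have "0 \<le> 2 / 3 * (1 - e)" "2 / 3 * (1 - e) \<le> 1" by simp_all
  then have "(2 / 3 * (1 - e)) ^ length B \<le> 1" by (rule power_le_one)
  then show ?case by (simp add: e_def)
next
  case (Cons C F)
  let ?q = "2 / 3 * (1 - (1 / 4) ^ k) :: real"
  have q: "0 \<le> ?q" by (simp add: power_le_one)
  let ?A = "\<lambda>S. {cs. walk n F cs S \<noteq> None}"
  have vim: "(#) c -` {cs. walk n (C # F) cs (Some (p, B)) \<noteq> None} = ?A (step n C c (Some (p, B)))" for c
    by auto
  show ?case
  proof (cases "step n C (0, 0) (Some (p, B)) = Some (p, B)")
    case True
    have "C \<noteq> []" using Cons.prems(3) by auto
    note fixed = step_fixed[OF True this]
    have "1 * ?q ^ length B \<le> measure (measure_pmf (choicesD k (length (C # F)))) {cs. walk n (C # F) cs (Some (p, B)) \<noteq> None}"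
      unfolding list.size choicesD.simps add_0_right add_Suc_right
      \<comment> \<open>Every choice is good here: the walk continues in the same space.\<close>
      by (rule prob_bind_ge[where G = UNIV])
        (use Cons q in \<open>simp_all add: vim fixed\<close>)
    then show ?thesis by simp
  next
    case False
    let ?G = "{c. \<exists>p' B'. step n C c (Some (p, B)) = Some (p', B') \<and> x \<in> pts p' B' \<and> length B = Suc (length B')}"
    have "?q * ?q ^ (length B - 1) \<le> measure (measure_pmf (choicesD k (length (C # F)))) {cs. walk n (C # F) cs (Some (p, B)) \<noteq> None}"
      unfolding list.size choicesD.simps add_0_right add_Suc_right
    proof (rule prob_bind_ge[where G = ?G])
      fix c assume "c \<in> ?G"
      then obtain p' B' where "step n C c (Some (p, B)) = Some (p', B')" "x \<in> pts p' B'" "length B = Suc (length B')"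
        by blast
      then show "?q ^ (length B - 1) \<le> measure (measure_pmf (map_pmf ((#) c) (choicesD k (length F))))
          {cs. walk n (C # F) cs (Some (p, B)) \<noteq> None}"
        using Cons.IH[of p' B'] Cons.prems by (simp add: vim)
    qed (use Cons.prems q step_prob[OF _ Cons.prems(2) _ False, of k] in auto)
    moreover have "?q ^ length B \<le> ?q * ?q ^ (length B - 1)"
    proof (cases B)
      case Nil
      have "addeq n a b (Some (p, [])) = Some (p, []) \<or> addeq n a b (Some (p, [])) = None" for a b
        by (simp add: addeq_def)
      \<comment> \<open>With rank 0 there is no room for a change: \<open>?G\<close> is empty,
        whereas \<open>step_prob\<close> for \<open>k = 1\<close> gives it probability at least 1/2.
        So the truncated \<open>length B - 1\<close> does no harm.\<close>
      have "measure (measure_pmf (chooseD 1)) ?G = 0" by (simp add: Nil)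
      then show ?thesis using step_prob[OF _ Cons.prems(2) _ False, of 1] Cons.prems by simp
    qed simp
    ultimately show ?thesis by linarith
  qed
qed

lemma pmf_loopD_None:
  assumes "s \<le> measure (measure_pmf (choicesD n (length F))) {cs. walk n F cs S \<noteq> None}"
  shows "pmf (loopD n F S T) None \<le> (1 - s) ^ T"
proof (induction T)
  case (Suc T)
  let ?p = "choicesD n (length F)"
  let ?N = "{cs. walk n F cs S = None}"
  have "pmf (loopD n F S (Suc T)) None = (\<integral>cs. indicator ?N cs * pmf (loopD n F S T) None \<partial>measure_pmf ?p)"
    unfolding loopD.simps pmf_bind
    by (rule Bochner_Integration.integral_cong) (auto simp: indicator_def split: option.split)
  also have "\<dots> = measure (measure_pmf ?p) ?N * pmf (loopD n F S T) None"
    by simp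
  also have "?N = space (measure_pmf ?p) - {cs. walk n F cs S \<noteq> None}"
  proof (rule set_eqI)
    show "cs \<in> ?N \<longleftrightarrow> cs \<in> space (measure_pmf ?p) - {cs. walk n F cs S \<noteq> None}" for cs
      by (cases "walk n F cs S") simp_all
  qed
  also have "measure (measure_pmf ?p) \<dots> = 1 - measure (measure_pmf ?p) {cs. walk n F cs S \<noteq> None}"
    by (rule measure_pmf.prob_compl) simp
  also have "(1 - measure (measure_pmf ?p) {cs. walk n F cs S \<noteq> None}) * pmf (loopD n F S T) None
      \<le> (1 - s) * (1 - s) ^ T"
    using assms Suc by (intro mult_mono) (auto simp: pmf_nonneg intro: order.trans[OF assms])
  finally show ?case by simp
qed simp

text \<open>The value returned is the offset of the final space, a point of that space;
  \<open>walk_pts\<close> covers all of its points.\<close>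

lemma loopD_Some:
  assumes "Some z \<in> set_pmf (loopD n F S T)" "\<forall>C\<in>set F. wf_clause n C"
  shows "z \<in> rep_pts S \<and> satall z F"
  using assms(1)
proof (induction T)
  case (Suc T)
  then obtain cs where "Some z \<in> set_pmf (case walk n F cs S of None \<Rightarrow> loopD n F S T | Some (p, B) \<Rightarrow> return_pmf (Some p))"
    by auto
  then consider "Some z \<in> set_pmf (loopD n F S T)" | B where "walk n F cs S = Some (z, B)"
    by (auto split: option.splits)
  then show ?case
  proof cases
    case 2
    then show ?thesis using walk_pts[OF assms(2), of cs S] pts_self[of z B] by auto
  qed (rule Suc.IH)
qed simp

section \<open>The three bounds\<close>

text \<open>The two numerical inequalities are reduced to small exponents by following the Euclidean
  algorithm for 449 and 397, with rounded quotients of the bases.\<close>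

lemma euclid_up:
  fixes a b c :: real
  assumes "a ^ q * c \<le> b" "a ^ k \<le> c ^ m" "0 \<le> a" "0 \<le> c"
  shows "a ^ (q * m + k) \<le> b ^ m"
proof -
  have "a ^ (q * m + k) = (a ^ q) ^ m * a ^ k" by (simp add: power_add power_mult)
  also have "\<dots> \<le> (a ^ q) ^ m * c ^ m" using assms by (intro mult_left_mono) simp_all
  also have "\<dots> = (a ^ q * c) ^ m" by (simp add: power_mult_distrib)
  also have "\<dots> \<le> b ^ m" using assms by (intro power_mono) simp_all
  finally show ?thesis .
qed

lemma euclid_down:
  fixes a c d :: real
  assumes "a \<le> d * c ^ q" "d ^ m \<le> c ^ k" "0 \<le> a" "0 \<le> c"
  shows "a ^ m \<le> c ^ (q * m + k)"
proof -
  have "a ^ m \<le> (d * c ^ q) ^ m" using assms by (intro power_mono) simp_all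
  also have "\<dots> = d ^ m * (c ^ q) ^ m" by (simp add: power_mult_distrib)
  also have "\<dots> \<le> c ^ k * (c ^ q) ^ m" using assms by (intro mult_right_mono) simp_all
  also have "\<dots> = c ^ (q * m + k)" by (simp add: power_add power_mult)
  finally show ?thesis .
qed

text \<open>Dividing by (3/23)^449 turns the claim into (26/3)^449 <= (23/2)^397.\<close>

lemma numeric1: "(26 / 23 :: real) ^ 449 \<le> (3 / 2) ^ 397 * (3 / 23) ^ 52"
proof -
  \<comment> \<open>From \<open>c\<close> on these are the successive quotients b/a, a/c^7, c/d,
    d/e, e/f, rounded down and up in alternation, as the chain requires. The exponents 1, 7, 1, 1, 1
    are the quotients of the Euclidean algorithm.\<close>
  define a b c d e f g :: real where num: "a = 26 / 3" "b = 23 / 2" "c = 13269230 / 10000000"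
    "d = 11965533 / 10000000" "e = 11089543 / 10000000" "f = 10789925 / 10000000" "g = 10277683 / 10000000"
  have pos: "0 \<le> a" "0 \<le> c" "0 \<le> d" "0 \<le> e" "0 \<le> f" "0 \<le> g" by (simp_all add: num)
  have le: "f ^ 1 * g \<le> e" "d \<le> f * e ^ 1" "d ^ 1 * e \<le> c" "a \<le> d * c ^ 7" "a ^ 1 * c \<le> b"
    unfolding num by (simp_all add: power_divide)
  have "f ^ 5 \<le> g ^ 14" unfolding num by (simp add: power_divide)
  from euclid_up[OF le(1) this pos(5,6)] have "f ^ 19 \<le> e ^ 14" by simp
  from euclid_down[OF le(2) this pos(3,4)] have "d ^ 19 \<le> e ^ 33" by simp
  from euclid_up[OF le(3) this pos(3,4)] have "d ^ 52 \<le> c ^ 33" by simp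
  from euclid_down[OF le(4) this pos(1,2)] have "a ^ 52 \<le> c ^ 397" by simp
  from euclid_up[OF le(5) this pos(1,2)] have "a ^ 449 \<le> b ^ 397" by simp
  then have "a ^ 449 * (3 / 23) ^ 449 \<le> b ^ 397 * (3 / 23) ^ 449" by (intro mult_right_mono) simp_all
  also have "(3 / 23 :: real) ^ 449 = (3 / 23) ^ 397 * (3 / 23) ^ 52" by (simp only: power_add[symmetric]) simp
  finally have "(a * (3 / 23)) ^ 449 \<le> (b * (3 / 23)) ^ 397 * (3 / 23) ^ 52"
    by (simp only: power_mult_distrib power_add[symmetric] mult.assoc) simp
  moreover have "a * (3 / 23) = 26 / 23" "b * (3 / 23) = 3 / 2" by (simp_all add: num)
  ultimately show ?thesis by (simp only:)
qed

lemma numeric2: "(3 / 2 :: real) ^ 397 \<le> 1.4312 ^ 449"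
proof -
  \<comment> \<open>The same scheme with the roles exchanged: \<open>w\<close> is u/v rounded up,
    and the alternation goes on from there.\<close>
  define u v w z y x t :: real where num: "u = 3 / 2" "v = 1.4312" "w = 10480716 / 10000000"
    "z = 10302998 / 10000000" "y = 10172492 / 10000000" "x = 10128293 / 10000000" "t = 10043640 / 10000000"
  have pos: "0 \<le> u" "0 \<le> v" "0 \<le> w" "0 \<le> z" "0 \<le> y" "0 \<le> x" by (simp_all add: num)
  have le: "y \<le> t * x ^ 1" "y ^ 1 * x \<le> z" "w \<le> y * z ^ 1" "w ^ 7 * z \<le> v" "u \<le> w * v ^ 1"
    unfolding num by (simp_all add: power_divide)
  have "t ^ 14 \<le> x ^ 5" unfolding num by (simp add: power_divide)
  from euclid_down[OF le(1) this pos(5,6)] have "y ^ 14 \<le> x ^ 19" by simp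
  from euclid_up[OF le(2) this pos(5,6)] have "y ^ 33 \<le> z ^ 19" by simp
  from euclid_down[OF le(3) this pos(3,4)] have "w ^ 33 \<le> z ^ 52" by simp
  from euclid_up[OF le(4) this pos(3,4)] have "w ^ 397 \<le> v ^ 52" by simp
  from euclid_down[OF le(5) this pos(1,2)] have "u ^ 397 \<le> v ^ 449" by simp
  then show ?thesis by (simp only: num)
qed

text \<open>The exponential-moment bound for a binomial tail: x^t <= x^i for i <= t, then the
  binomial theorem.\<close>

lemma binom_le_bound:
  fixes x :: real
  assumes "0 < x" "x \<le> 1" "t \<le> n"
  shows "real (binom_le n t) * x ^ t \<le> (1 + x) ^ n"
proof -
  have "real (binom_le n t) * x ^ t = (\<Sum>i\<le>t. real (n choose i) * x ^ t)"
    by (simp add: binom_le_def sum_distrib_right)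
  also have "\<dots> \<le> (\<Sum>i\<le>t. real (n choose i) * x ^ i)"
    using assms by (intro sum_mono mult_left_mono power_decreasing) auto
  also have "\<dots> \<le> (\<Sum>i\<le>n. real (n choose i) * x ^ i)"
    using assms by (intro sum_mono2) auto
  also have "\<dots> = (1 + x) ^ n"
    using binomial_ring[of x 1 n] by (simp add: add.commute)
  finally show ?thesis .
qed

text \<open>Taking 449th powers clears the fractional exponents, so that natural powers
  suffice.\<close>

lemma binom_le_small:
  assumes "449 * t \<le> 52 * n" "t \<le> n"
  shows "real (binom_le n t) ^ 449 \<le> ((3 / 2) ^ 397) ^ n"
proof -
  \<comment> \<open>A simple fraction near 52/397, the ratio t/(n - t) at the threshold, where the
    tail bound is sharpest.\<close>
  let ?x = "3 / 23 :: real"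
  have "(real (binom_le n t) * ?x ^ t) ^ 449 \<le> ((1 + ?x) ^ n) ^ 449"
    using assms by (intro power_mono binom_le_bound) simp_all
  then have "real (binom_le n t) ^ 449 * ?x ^ (449 * t) \<le> ((26 / 23) ^ 449) ^ n"
    by (simp add: power_mult_distrib power_mult[symmetric] mult.commute)
  also have "\<dots> \<le> ((3 / 2) ^ 397 * ?x ^ 52) ^ n"
    using numeric1 by (intro power_mono) simp_all
  also have "\<dots> = ((3 / 2) ^ 397) ^ n * ?x ^ (52 * n)"
    by (simp add: power_mult_distrib power_mult)
  also have "\<dots> \<le> ((3 / 2) ^ 397) ^ n * ?x ^ (449 * t)"
    using assms by (intro mult_left_mono power_decreasing) simp_all
  finally show ?thesis by simp
qed

lemma root_le: "(a :: real) ^ 449 \<le> b ^ 449 \<Longrightarrow> 0 \<le> b \<Longrightarrow> a \<le> b"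
  by (rule power_le_imp_le_base[of a 448]) simp_all

lemma binom_le_small_rank:
  assumes "449 * (n - r) \<le> 52 * n" "r \<le> n"
  shows "real (binom_le n (n - r)) \<le> (3 / 2) ^ r" "real (binom_le n (n - r)) \<le> 1.4312 ^ n"
proof -
  note small = binom_le_small[OF assms(1) diff_le_self]
  have "397 * n \<le> r * 449" using assms by simp
  then have "((3 / 2 :: real) ^ 397) ^ n \<le> (3 / 2) ^ (r * 449)"
    unfolding power_mult[symmetric] by (intro power_increasing) simp_all
  also have "\<dots> = ((3 / 2) ^ r) ^ 449" by (rule power_mult)
  finally have 1: "((3 / 2 :: real) ^ 397) ^ n \<le> ((3 / 2) ^ r) ^ 449" .
  show "real (binom_le n (n - r)) \<le> (3 / 2) ^ r"
    by (rule root_le[OF order.trans[OF small 1]]) simp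
  have "((3 / 2 :: real) ^ 397) ^ n \<le> (1.4312 ^ 449) ^ n"
    using numeric2 by (intro power_mono) simp_all
  also have "\<dots> = (1.4312 ^ n) ^ 449" by (simp only: power_mult[symmetric] mult.commute)
  finally have 2: "((3 / 2 :: real) ^ 397) ^ n \<le> (1.4312 ^ n) ^ 449" .
  show "real (binom_le n (n - r)) \<le> 1.4312 ^ n"
    by (rule root_le[OF order.trans[OF small 2]]) simp
qed

lemma large_codim:
  assumes "\<not> 449 * (n - r) \<le> 52 * n" "r \<le> n"
  shows "(3 / 2 :: real) ^ r \<le> 1.4312 ^ n"
proof (rule root_le)
  have "r * 449 \<le> 397 * n" using assms by simp
  then have "(3 / 2 :: real) ^ (r * 449) \<le> (3 / 2) ^ (397 * n)" by (intro power_increasing) simp_all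
  also have "\<dots> = ((3 / 2) ^ 397) ^ n" by (simp only: power_mult)
  also have "\<dots> \<le> (1.4312 ^ 449) ^ n" using numeric2 by (intro power_mono) simp_all
  also have "\<dots> = (1.4312 ^ n) ^ 449" by (simp only: power_mult[symmetric] mult.commute)
  finally show "((3 / 2 :: real) ^ r) ^ 449 \<le> (1.4312 ^ n) ^ 449" by (simp only: power_mult)
qed simp

lemma grow_bounds: "3 * k \<le> 2 * grow k \<and> 2 * grow k \<le> 3 * k + 1"
  by (induction k rule: grow.induct) auto

lemma trials_lower: "3 * (3 / 2) ^ r \<le> real (trials r)"
proof (induction r)
  case (Suc r)
  have "3 * real (trials r) \<le> 2 * real (grow (trials r))"
    using grow_bounds[of "trials r"] by linarith
  then show ?case using Suc by simp
qed simp

text \<open>The \<open>+ 1\<close> absorbs the rounding: (3T + 1)/2 + 1 = (3/2)(T + 1).\<close>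

lemma trials_upper: "real (trials r) + 1 \<le> 4 * (3 / 2) ^ r"
proof (induction r)
  case (Suc r)
  have "2 * real (grow (trials r)) \<le> 3 * real (trials r) + 1"
    using grow_bounds[of "trials r"] by linarith
  then show ?case using Suc by simp
qed simp

lemma rnd_cost_pos: "1 \<le> rnd_cost I"
proof -
  have "1 \<le> trials r" for r
    by (induction r) (auto intro: order.trans[OF _ grow_ge])
  moreover have "Suc 0 \<le> binom_le n t" for n t using binom_le_pos[of n t] by simp
  ultimately show ?thesis by (simp add: rnd_cost_def split: option.split)
qed

text \<open>For small codimension the binomial sum obeys both bounds. Otherwise the number of trials
  is within 4 * 1.5 ^ r, and the rank is small enough for 1.4312 ^ n.\<close>

lemma rnd_cost_le:
  "real (rnd_cost I) \<le> 4 * 1.5 ^ dim_A I" "real (rnd_cost I) \<le> 4 * 1.4312 ^ nvars I"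
proof -
  have "real (rnd_cost I) \<le> 4 * (3 / 2) ^ dim_A I \<and> real (rnd_cost I) \<le> 4 * 1.4312 ^ nvars I"
  proof (cases "prep I")
    case None
    have "1 \<le> 4 * (3 / 2 :: real) ^ dim_A I" "1 \<le> 4 * (1.4312 :: real) ^ nvars I"
    proof -
      have "1 \<le> (3 / 2 :: real) ^ dim_A I" "1 \<le> (1.4312 :: real) ^ nvars I" by (rule one_le_power; simp)+
      then show "1 \<le> 4 * (3 / 2 :: real) ^ dim_A I" "1 \<le> 4 * (1.4312 :: real) ^ nvars I" by linarith+
    qed
    moreover have "real (rnd_cost I) = 1" using None by (simp add: rnd_cost_def)
    ultimately show ?thesis by simp
  next
    case (Some q)
    obtain p B where S: "prep I = Some (p, B)" using Some by (cases q) auto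
    let ?n = "nvars I" and ?r = "length B"
    have r: "?r \<le> ?n" "dim_A I = ?r" using rank_le_prep[of I] dim_A_eq[OF S] by (simp_all add: S rank_le_def)
    have pos: "0 \<le> (3 / 2 :: real) ^ ?r" "0 \<le> (1.4312 :: real) ^ ?n" by simp_all
    show ?thesis
    proof (cases "449 * (?n - ?r) \<le> 52 * ?n")
      case True
      then have c: "rnd_cost I = binom_le ?n (?n - ?r)" by (simp add: rnd_cost_def S)
      show ?thesis unfolding c r using binom_le_small_rank[OF True r(1)] pos by linarith
    next
      case False
      then have c: "rnd_cost I = trials ?r" by (simp add: rnd_cost_def S)
      show ?thesis unfolding c r using large_codim[OF False r(1)] trials_upper[of ?r] pos by linarith
    qed
  qed
  then show "real (rnd_cost I) \<le> 4 * 1.5 ^ dim_A I" "real (rnd_cost I) \<le> 4 * 1.4312 ^ nvars I"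
    by simp_all
qed

section \<open>Correctness of both algorithms and the final bounds\<close>

lemma solutions_eq: "solutions I = {x \<in> affine_part I. satall x (clauses I)}"
  by (simp add: solutions_def satall_iff_satisfies)

lemma correct_solutions_eq: "correct_solutions I = (\<lambda>z. enc_res (nvars I) (Some z)) ` solutions I"
  by (simp add: correct_solutions_def solution_found_def enc_vec_def)

lemma det_correct:
  assumes wf: "well_formed I" and S: "prep I = Some (p, B)"
  defines "d \<equiv> det (nvars I) (clauses I) (equations I) B"
  shows "(solutions I = {} \<longrightarrow> d = None) \<and> (solutions I \<noteq> {} \<longrightarrow> d \<in> Some ` solutions I)"
proof (cases d)
  case None
  have A: "card (affine_part I) = 2 ^ length B"
    using prep_pts[of I] indep_prep[of I] by (simp add: S indep_def)
  have "\<not> (x \<in> affine_part I \<and> satall x (clauses I))" for x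
    using None unfolding d_def
    by (intro det_None[OF well_formedD(1)[OF wf] affine_part_eq A affine_part_triple]) auto
  then show ?thesis using None by (auto simp: solutions_eq)
next
  case (Some z)
  then have "z \<in> solutions I"
    using det_Some[of "nvars I" "clauses I" "equations I" B z] well_formedD(1)[OF wf]
    by (simp add: d_def solutions_eq affine_part_eq)
  then show ?thesis using Some by auto
qed

lemma solve_det_correct:
  assumes "well_formed I"
  shows "(solutions I = {} \<longrightarrow> solve_det I = None) \<and> (solutions I \<noteq> {} \<longrightarrow> solve_det I \<in> Some ` solutions I)"
proof (cases "prep I")
  case None
  then have "solutions I = {}" using prep_pts[of I] by (auto simp: solutions_eq)
  then show ?thesis by (simp add: solve_det_def None)
next
  case (Some q)
  then show ?thesis using det_correct[OF assms] by (cases q) (simp add: solve_det_def)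
qed

text \<open>A trial succeeds with probability at least (3/4)(2/3)^r, so 3(3/2)^r trials have at
  least 9/4 expected successes. All of them fail with probability at most exp(-9/4), and exp(9/4) >=
  1 + 9/4 > 3.\<close>

lemma success_bound:
  assumes "r \<le> n"
  shows "(1 - (2 / 3 * (1 - (1 / 4) ^ n)) ^ r) ^ trials r \<le> (1 / 3 :: real)"
proof -
  define e where "e = (1 / 4 :: real) ^ n"
  have e: "0 \<le> e" "e \<le> 1" by (simp_all add: e_def power_le_one)
  \<comment> \<open>With \<open>n\<close> rounds of rejection the bias of the choices is so small
    that over r <= n steps it costs at most a factor 3/4.\<close>
  have ne: "real n * e \<le> 1 / 4"
  proof -
    have "4 * real n \<le> 4 ^ n"
    proof (induction n)
      case (Suc n)
      then show ?case by (cases n) auto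
    qed simp
    then show ?thesis by (simp add: e_def power_one_over field_simps)
  qed
  have "1 - real n * e \<le> (1 - e) ^ n"
    using Bernoulli_inequality[of "- e" n] e by simp
  also have "\<dots> \<le> (1 - e) ^ r" using e assms by (intro power_decreasing) simp_all
  finally have "3 / 4 \<le> (1 - e) ^ r" using ne by linarith
  then have "(2 / 3) ^ r * (3 / 4) \<le> (2 / 3) ^ r * (1 - e) ^ r" by (intro mult_left_mono) simp_all
  then have s: "(2 / 3) ^ r * (3 / 4) \<le> (2 / 3 * (1 - e)) ^ r" by (simp only: power_mult_distrib)
  define s where "s = (2 / 3 * (1 - e)) ^ r"
  have s01: "0 \<le> s" "s \<le> 1" using e by (auto simp: s_def intro!: power_le_one)
  have "9 / 4 = ((2 / 3) ^ r * (3 / 4)) * (3 * (3 / 2 :: real) ^ r)"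
    by (simp add: power_mult_distrib[symmetric])
  also have "\<dots> \<le> s * real (trials r)"
    using s trials_lower[of r] s01 unfolding s_def by (intro mult_mono) simp_all
  finally have sN: "9 / 4 \<le> s * real (trials r)" .
  have "(1 - s) ^ trials r \<le> exp (- s) ^ trials r"
    using s01 exp_ge_add_one_self[of "- s"] by (intro power_mono) simp_all
  also have "\<dots> = exp (- (s * real (trials r)))" by (simp add: exp_of_nat_mult[symmetric] mult.commute)
  also have "\<dots> \<le> exp (- (9 / 4))" using sN by simp
  also have "\<dots> \<le> 1 / 3"
  proof -
    have "3 \<le> exp (9 / 4 :: real)" using exp_ge_add_one_self[of "9 / 4 :: real"] by simp
    then show ?thesis by (simp add: exp_minus field_simps)
  qed
  finally show ?thesis by (simp add: s_def e_def)
qed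

lemma solve_rnd_sound:
  assumes wf: "well_formed I" and z: "Some z \<in> set_pmf (solve_rnd I)"
  shows "z \<in> solutions I"
proof -
  obtain p B where S: "prep I = Some (p, B)" using z by (auto simp: solve_rnd_def split: option.splits)
  show ?thesis
  proof (cases "449 * (nvars I - length B) \<le> 52 * nvars I")
    case True
    then have "Some z = det (nvars I) (clauses I) (equations I) B" using z by (simp add: solve_rnd_def S)
    then show ?thesis using det_correct[OF wf S] by auto
  next
    case False
    then have "Some z \<in> set_pmf (loopD (nvars I) (clauses I) (prep I) (trials (length B)))"
      using z by (simp add: solve_rnd_def S)
    from loopD_Some[OF this well_formedD(1)[OF wf]] show ?thesis by (simp add: solutions_eq prep_pts)
  qed
qed

lemma solve_rnd_complete:
  assumes wf: "well_formed I" and sol: "solutions I \<noteq> {}"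
  shows "pmf (solve_rnd I) None \<le> 1 / 3"
proof -
  obtain x where x: "x \<in> affine_part I" "satall x (clauses I)" using sol by (auto simp: solutions_eq)
  then obtain p B where S: "prep I = Some (p, B)" "x \<in> pts p B"
    using prep_pts[of I] by (auto simp: rep_pts_def split: option.splits)
  have r: "length B \<le> nvars I" using rank_le_prep[of I] by (simp add: S rank_le_def)
  show ?thesis
  proof (cases "449 * (nvars I - length B) \<le> 52 * nvars I")
    case True
    then have "solve_rnd I = return_pmf (det (nvars I) (clauses I) (equations I) B)" by (simp add: solve_rnd_def S)
    then show ?thesis using det_correct[OF wf S(1)] sol by (auto simp: pmf_return)
  next
    case False
    then have "solve_rnd I = loopD (nvars I) (clauses I) (Some (p, B)) (trials (length B))"
      by (simp add: solve_rnd_def S)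
    with order.trans[OF pmf_loopD_None[OF walk_prob[OF well_formedD(1)[OF wf] S(2) x(2)]] success_bound[OF r]]
    show ?thesis by (simp only:)
  qed
qed

definition prog_det :: program where
  "prog_det = main_det_code # lib"

definition prog_rnd :: program where
  "prog_rnd = main_rnd_code # lib @ coin_lib"

text \<open>The extra 2 pays for the initial call with its one argument.\<close>

definition time_det :: "subsat \<Rightarrow> nat" where
  "time_det I = 20000 * input_size I ^ 4 *
    (case prep I of None \<Rightarrow> 1 | Some (p, B) \<Rightarrow> binom_le (nvars I) (nvars I - length B)) + 2"

definition time_rnd :: "subsat \<Rightarrow> nat" where
  "time_rnd I = 80000 * input_size I ^ 4 * rnd_cost I + 2"

lemma prog_det_correct: "deterministic_algorithm prog_det time_det"
  unfolding deterministic_algorithm_def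
proof (intro conjI allI impI)
  show "list_all coin_free prog_det"
    by (simp add: prog_det_def lib_def body_defs main_det_code_def)
  fix I assume wf: "well_formed I"
  interpret prog prog_det main_det_code "[]" by unfold_locales (simp add: prog_det_def)
  let ?x = "enc_input I"
  obtain s where s: "ev prog_det (prog_det ! 0) [?x] (enc_res (nvars I) (solve_det I)) s" "s + 2 \<le> time_det I"
    using main_det_runs[OF wf refl] by (auto simp: runs_def wpf_def wp_def time_det_def)
  have "ev prog_det (ECall 0 [0]) [?x] (enc_res (nvars I) (solve_det I)) (s + 2)"
    using ev_ECall[of 0 prog_det "[?x]" "[0]" "enc_res (nvars I) (solve_det I)" s] s(1)
    by (simp add: prog_det_def)
  then have run: "run prog_det (time_det I) ?x = return_spmf (enc_res (nvars I) (solve_det I), s + 2)"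
    unfolding run_def using s(2) by (rule exec_ev)
  show "halts_within prog_det (time_det I) ?x"
    using s(2) by (simp add: halts_within_def run)
  show "set_spmf (output_dist prog_det (time_det I) ?x) \<subseteq>
      (if solutions I = {} then {no_solution_found} else correct_solutions I)"
    using solve_det_correct[OF wf] by (auto simp: output_dist_def run no_solution_found_def correct_solutions_eq)
qed

lemma prog_rnd_correct: "randomized_algorithm prog_rnd time_rnd"
  unfolding randomized_algorithm_def
proof (intro conjI allI impI)
  fix I assume wf: "well_formed I"
  interpret coin_prog prog_rnd main_rnd_code by unfold_locales (simp add: prog_rnd_def)
  let ?x = "enc_input I" and ?D = "map_pmf (enc_res (nvars I)) (solve_rnd I)"
  have "yields prog_rnd (ECall 0 [0]) [?x] ?D (time_rnd I)"
    using main_rnd_yields[OF wf refl]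
    by (intro yields_ECallI[of 0 prog_rnd "[?x]" "[0]" ?D "80000 * input_size I ^ 4 * rnd_cost I"])
      (simp_all add: prog_rnd_def time_rnd_def)
  then have out: "output_dist prog_rnd (time_rnd I) ?x = spmf_of_pmf ?D"
    and steps: "\<forall>x\<in>set_spmf (run prog_rnd (time_rnd I) ?x). snd x \<le> time_rnd I"
    unfolding yields_def output_dist_def run_def by blast+
  have "lossless_spmf (output_dist prog_rnd (time_rnd I) ?x)"
    unfolding out by simp
  then show "halts_within prog_rnd (time_rnd I) ?x"
    using steps by (auto simp: halts_within_def output_dist_def)
  show "set_spmf (output_dist prog_rnd (time_rnd I) ?x) \<subseteq> {no_solution_found} \<union> correct_solutions I"
  proof
    fix v assume "v \<in> set_spmf (output_dist prog_rnd (time_rnd I) ?x)"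
    then obtain r where r: "r \<in> set_pmf (solve_rnd I)" "v = enc_res (nvars I) r" by (auto simp: out)
    then show "v \<in> {no_solution_found} \<union> correct_solutions I"
      using solve_rnd_sound[OF wf] by (cases r) (auto simp: no_solution_found_def correct_solutions_eq simp del: enc_res_simps(2))
  qed
  assume sol: "solutions I \<noteq> {}"
  have "2 / 3 \<le> 1 - pmf (solve_rnd I) None" using solve_rnd_complete[OF wf sol] by simp
  also have "\<dots> = measure (measure_pmf (solve_rnd I)) (- {None})"
    using measure_pmf.prob_compl[of "{None}" "solve_rnd I"] by (simp add: Compl_eq_Diff_UNIV measure_pmf_single)
  \<comment> \<open>Soundness speaks of values in the support only, hence the restriction.\<close>
  also have "\<dots> = measure (measure_pmf (solve_rnd I)) (- {None} \<inter> set_pmf (solve_rnd I))"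
    by (simp add: measure_Int_set_pmf)
  also have "\<dots> \<le> measure (measure_pmf (solve_rnd I)) (enc_res (nvars I) -` correct_solutions I)"
    using solve_rnd_sound[OF wf] by (intro measure_pmf.finite_measure_mono) (auto simp: correct_solutions_eq simp del: enc_res_simps(2))
  also have "\<dots> = measure (measure_spmf (output_dist prog_rnd (time_rnd I) ?x)) (correct_solutions I)"
    by (simp add: out measure_spmf_spmf_of_pmf)
  finally show "2 / 3 \<le> measure (measure_spmf (output_dist prog_rnd (time_rnd I) ?x)) (correct_solutions I)" .
qed

lemma in_O_starI:
  assumes "\<And>I. well_formed I \<Longrightarrow> \<tau> I = a * input_size I ^ 4 * c I + 2"
    "\<And>I. 1 \<le> c I" "\<And>I. well_formed I \<Longrightarrow> real (c I) \<le> 4 * f I"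
  shows "in_O_star \<tau> f"
  unfolding in_O_star_def
proof (intro exI allI impI)
  fix I assume wf: "well_formed I"
  let ?m = "real (input_size I) ^ 4"
  have "1 \<le> ?m" using input_size_gt(1)[of I] by (intro one_le_power) simp
  then have "1 * 1 \<le> ?m * real (c I)" using assms(2)[of I] by (intro mult_mono) simp_all
  then have "real (\<tau> I) \<le> (real a + 2) * (?m * real (c I))" by (simp add: assms(1)[OF wf] algebra_simps)
  also have "\<dots> \<le> (real a + 2) * (?m * (4 * f I))"
    using assms(3)[OF wf] by (intro mult_left_mono) simp_all
  also have "\<dots> = ((real a + 2) * 4) * ?m * f I" by (simp only: mult_ac)
  finally show "real (\<tau> I) \<le> ((real a + 2) * 4) * ?m * f I" .
qed

lemma time_det_bound: "in_O_star time_det (\<lambda>I. real (binom_le (nvars I) (codim_A I)))"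
proof (rule in_O_starI)
  fix I
  let ?c = "case prep I of None \<Rightarrow> 1 | Some (p, B) \<Rightarrow> binom_le (nvars I) (nvars I - length B)"
  show "time_det I = 20000 * input_size I ^ 4 * ?c + 2" by (simp add: time_det_def)
  show "1 \<le> ?c"
    using binom_le_pos[unfolded One_nat_def] by (simp split: option.split)
  have "?c \<le> binom_le (nvars I) (codim_A I)"
    using dim_A_eq[of I] binom_le_pos[unfolded One_nat_def]
    by (auto simp: codim_A_def split: option.split)
  then show "real ?c \<le> 4 * real (binom_le (nvars I) (codim_A I))" by linarith
qed

theorem theorem2:
  shows
    "(\<exists>P \<tau>. randomized_algorithm P \<tau> \<and> in_O_star \<tau> (\<lambda>I. 1.5 ^ dim_A I)) \<and>
     (\<exists>P \<tau>. deterministic_algorithm P \<tau> \<and>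
        in_O_star \<tau> (\<lambda>I. real (binom_le (nvars I) (codim_A I)))) \<and>
     (\<exists>P \<tau>. randomized_algorithm P \<tau> \<and> in_O_star \<tau> (\<lambda>I. 1.4312 ^ nvars I))"
proof -
  have "in_O_star time_rnd (\<lambda>I. 1.5 ^ dim_A I)" "in_O_star time_rnd (\<lambda>I. 1.4312 ^ nvars I)"
    by (rule in_O_starI[OF time_rnd_def rnd_cost_pos]; rule rnd_cost_le)+
  then show ?thesis using prog_rnd_correct prog_det_correct time_det_bound by blast
qed

end
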